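(* Let $N\in\{1,2\}$, $\alpha>-2$, $\sigma>-1$, $m<\frac{N}{2}-1$ and $1<p<\frac{N-2m+\alpha}{N-2m-2}$. Let $\zeta(t)=t^\sigma$ for $0<t<1$ and $\zeta(t)=t^m$ for $t\ge 1$, and let $\mathbf{w}\in C_0(\mathbb{R}^N)\cap L^1(\mathbb{R}^N)$ satisfy $\int_{\mathbb{R}^N}\mathbf{w}(x)\,dx>0$. Then the Cauchy problem $$u_t-\Delta u=|x|^\alpha|u|^p+\zeta(t)\,\mathbf{w}(x)\ \text{ in }(0,\infty)\times\mathbb{R}^N,\qquad u(0,x)=u_0(x)\ \text{ in }\mathbb{R}^N,$$ has no global solutions (whatever the initial datum $u_0$).
   Context: $C_0(\mathbb{R}^N)$ is the space of continuous real-valued functions on $\mathbb{R}^N$ vanishing at infinity; $C_B(\mathbb{R}^N)=C(\mathbb{R}^N)\cap L^\infty(\mathbb{R}^N)$, and $C_B([0,T]\times\mathbb{R}^N)$ is defined similarly; $e^{t\Delta}$ is the heat semigroup, i.e. convolution with $G_t(x)=(4\pi t)^{-N/2}e^{-|x|^2/(4t)}$. Solutions may change sign. A global solution is a function $u$ on $[0,\infty)\times\mathbb{R}^N$ as follows. (a) If $\alpha\le 0$: $u_0\in C_B(\mathbb{R}^N)$, $u\in C_B([0,T]\times\mathbb{R}^N)$ for every $T>0$, and $u$ is a mild solution, i.e. for all $t\ge0$ (with the integrals convergent) $$u(t)=e^{t\Delta}u_0+\int_0^t e^{(t-\tau)\Delta}\left(|\cdot|^\alpha|u(\tau)|^p\right)d\tau+\int_0^t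 e^{(t-\tau)\Delta}\left(\zeta(\tau)\mathbf{w}\right)d\tau .$$ (b) If $\alpha>0$: let $\nu(x)=(1+|x|)^{\frac{\alpha}{p-1}}$ and $C_\nu(\mathbb{R}^N)=\{\varphi\in C(\mathbb{R}^N):\|\nu\varphi\|_{L^\infty}<\infty\}$ with norm $\|\nu\varphi\|_{L^\infty}$; then $u_0\in C_\nu(\mathbb{R}^N)$, $u\in L^\infty([0,T];C_\nu(\mathbb{R}^N))$ for every $T>0$, and $u$ is a classical solution, i.e. $u$ is continuous on $[0,\infty)\times\mathbb{R}^N$, $u_t$ and $\partial_{x_i}\partial_{x_j}u$ are continuous on $(0,\infty)\times\mathbb{R}^N$, the equation holds pointwise there, and $u(0,\cdot)=u_0$. *)

theory Defs
  imports "HOL-Analysis.Analysis"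
begin

text \<open>The space \<open>\<real>\<^sup>N\<close> is \<open>real ^ 'n\<close> with \<open>N = CARD('n)\<close>.  Functions of \<open>(t, x)\<close> are curried, and only
  their values for \<open>t \<ge> 0\<close> matter.\<close>

section \<open>Function spaces\<close>

definition C0_space :: "(real ^ 'n \<Rightarrow> real) set" where
  "C0_space = {f. continuous_on UNIV f \<and> (f \<longlongrightarrow> 0) at_infinity}"

definition CB_space :: "'a::topological_space set \<Rightarrow> ('a \<Rightarrow> real) set" where
  "CB_space S = {f. continuous_on S f \<and> bounded (f ` S)}"

definition weight :: "real \<Rightarrow> real \<Rightarrow> real ^ 'n \<Rightarrow> real" where
  "weight \<alpha> p x = (1 + norm x) powr (\<alpha> / (p - 1))"

definition C_weight :: "(real ^ 'n \<Rightarrow> real) \<Rightarrow> (real ^ 'n \<Rightarrow> real) set" where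
  "C_weight \<nu> = {f. continuous_on UNIV f \<and> bounded (range (\<lambda>x. \<nu> x * f x))}"

definition strongly_measurable :: "'a measure \<Rightarrow> ('a \<Rightarrow> 'b::metric_space) \<Rightarrow> bool" where
  "strongly_measurable M f \<longleftrightarrow>
     (\<exists>s. (\<forall>k::nat. simple_function M (s k)) \<and> (AE t in M. (\<lambda>k. s k t) \<longlonglongrightarrow> f t))"

text \<open>For continuous \<open>\<nu> > 0\<close>, multiplication by \<open>\<nu>\<close> is an isometry from \<open>C_weight \<nu>\<close>, normed by
  the supremum of \<open>\<bar>\<nu> f\<bar>\<close>, onto the Banach space of bounded continuous functions; hence the
  Bochner space \<open>L\<^sup>\<infinity>([0,T]; C_weight \<nu>)\<close> is expressed through \<open>U t = \<nu> (u t)\<close>.\<close>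

definition Linf_C_weight :: "real \<Rightarrow> (real ^ 'n \<Rightarrow> real) \<Rightarrow> (real \<Rightarrow> real ^ 'n \<Rightarrow> real) set" where
  "Linf_C_weight T \<nu> = {u. \<exists>U :: real \<Rightarrow> (real ^ 'n) \<Rightarrow>\<^sub>C real.
     (AE t in lebesgue_on {0..T}. \<forall>x. apply_bcontfun (U t) x = \<nu> x * u t x) \<and>
     strongly_measurable (lebesgue_on {0..T}) U \<and>
     (\<exists>K. AE t in lebesgue_on {0..T}. norm (U t) \<le> K)}"

section \<open>Heat semigroup\<close>

definition heat_kernel :: "real \<Rightarrow> real ^ 'n \<Rightarrow> real" where
  "heat_kernel t x =
     (4 * pi * t) powr (- (real CARD('n) / 2)) * exp (- (norm x)\<^sup>2 / (4 * t))"

definition heat_convergent :: "real \<Rightarrow> (real ^ 'n \<Rightarrow> real) \<Rightarrow> real ^ 'n \<Rightarrow> bool" where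
  "heat_convergent t f x \<longleftrightarrow>
     (t \<noteq> 0 \<longrightarrow> integrable lborel (\<lambda>y. heat_kernel t (x - y) * f y))"

definition heat_semigroup :: "real \<Rightarrow> (real ^ 'n \<Rightarrow> real) \<Rightarrow> real ^ 'n \<Rightarrow> real" where
  "heat_semigroup t f x =
     (if t = 0 then f x else (\<integral>y. heat_kernel t (x - y) * f y \<partial>lborel))"

definition duhamel_convergent :: "real \<Rightarrow> (real \<Rightarrow> real ^ 'n \<Rightarrow> real) \<Rightarrow> real ^ 'n \<Rightarrow> bool" where
  "duhamel_convergent t g x \<longleftrightarrow>
     (AE \<tau> in lborel. \<tau> \<in> {0<..<t} \<longrightarrow> heat_convergent (t - \<tau>) (g \<tau>) x) \<and>
     set_integrable lborel {0..t} (\<lambda>\<tau>. heat_semigroup (t - \<tau>) (g \<tau>) x)"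

definition duhamel :: "real \<Rightarrow> (real \<Rightarrow> real ^ 'n \<Rightarrow> real) \<Rightarrow> real ^ 'n \<Rightarrow> real" where
  "duhamel t g x = (LINT \<tau>:{0..t}|lborel. heat_semigroup (t - \<tau>) (g \<tau>) x)"

section \<open>The Cauchy problem\<close>

text \<open>Only the values for \<open>t > 0\<close> are meaningful.\<close>

definition zeta :: "real \<Rightarrow> real \<Rightarrow> real \<Rightarrow> real" where
  "zeta \<sigma> m t = (if t < 1 then t powr \<sigma> else t powr m)"

text \<open>For \<open>\<alpha> \<le> 0\<close> the (arbitrary) value \<open>0 powr \<alpha> = 0\<close> at the origin is immaterial: the
  nonlinearity then occurs only under the integral over \<open>\<real>\<^sup>N\<close>.\<close>

definition nonlinearity :: "real \<Rightarrow> real \<Rightarrow> (real ^ 'n \<Rightarrow> real) \<Rightarrow> real ^ 'n \<Rightarrow> real" where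
  "nonlinearity \<alpha> p v x = norm x powr \<alpha> * \<bar>v x\<bar> powr p"

definition mild_solution :: "real \<Rightarrow> real \<Rightarrow> (real \<Rightarrow> real) \<Rightarrow> (real ^ 'n \<Rightarrow> real) \<Rightarrow>
    (real ^ 'n \<Rightarrow> real) \<Rightarrow> (real \<Rightarrow> real ^ 'n \<Rightarrow> real) \<Rightarrow> bool" where
  "mild_solution \<alpha> p \<zeta> w u0 u \<longleftrightarrow>
     (\<forall>t\<ge>0. \<forall>x.
        heat_convergent t u0 x \<and>
        duhamel_convergent t (\<lambda>\<tau>. nonlinearity \<alpha> p (u \<tau>)) x \<and>
        duhamel_convergent t (\<lambda>\<tau> y. \<zeta> \<tau> * w y) x \<and>
        u t x = heat_semigroup t u0 x
              + duhamel t (\<lambda>\<tau>. nonlinearity \<alpha> p (u \<tau>)) x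
              + duhamel t (\<lambda>\<tau> y. \<zeta> \<tau> * w y) x)"

definition has_partial_derivative ::
    "(real ^ 'n \<Rightarrow> real) \<Rightarrow> 'n \<Rightarrow> real \<Rightarrow> real ^ 'n \<Rightarrow> bool" where
  "has_partial_derivative f i D x \<longleftrightarrow>
     ((\<lambda>s. f (x + s *\<^sub>R axis i 1)) has_real_derivative D) (at 0)"

definition classical_solution :: "real \<Rightarrow> real \<Rightarrow> (real \<Rightarrow> real) \<Rightarrow> (real ^ 'n \<Rightarrow> real) \<Rightarrow>
    (real ^ 'n \<Rightarrow> real) \<Rightarrow> (real \<Rightarrow> real ^ 'n \<Rightarrow> real) \<Rightarrow> bool" where
  "classical_solution \<alpha> p \<zeta> w u0 u \<longleftrightarrow>
     continuous_on ({0..} \<times> UNIV) (\<lambda>(t, x). u t x) \<and>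
     (\<exists>ut ux uxx.
        (\<forall>t>0. \<forall>x.
           ((\<lambda>s. u s x) has_real_derivative ut t x) (at t) \<and>
           (\<forall>j. has_partial_derivative (u t) j (ux j t x) x) \<and>
           (\<forall>i j. has_partial_derivative (ux j t) i (uxx i j t x) x)) \<and>
        continuous_on ({0<..} \<times> UNIV) (\<lambda>(t, x). ut t x) \<and>
        (\<forall>i j. continuous_on ({0<..} \<times> UNIV) (\<lambda>(t, x). uxx i j t x)) \<and>
        (\<forall>t>0. \<forall>x.
           ut t x - (\<Sum>i\<in>UNIV. uxx i i t x) = nonlinearity \<alpha> p (u t) x + \<zeta> t * w x)) \<and>
     (\<forall>x. u 0 x = u0 x)"

definition global_solution :: "real \<Rightarrow> real \<Rightarrow> (real \<Rightarrow> real) \<Rightarrow> (real ^ 'n \<Rightarrow> real) \<Rightarrow>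
    (real ^ 'n \<Rightarrow> real) \<Rightarrow> (real \<Rightarrow> real ^ 'n \<Rightarrow> real) \<Rightarrow> bool" where
  "global_solution \<alpha> p \<zeta> w u0 u \<longleftrightarrow>
     (if \<alpha> \<le> 0 then
        u0 \<in> CB_space UNIV \<and>
        (\<forall>T>0. (\<lambda>(t, x). u t x) \<in> CB_space ({0..T} \<times> UNIV)) \<and>
        mild_solution \<alpha> p \<zeta> w u0 u
      else
        u0 \<in> C_weight (weight \<alpha> p) \<and>
        (\<forall>T>0. u \<in> Linf_C_weight T (weight \<alpha> p)) \<and>
        classical_solution \<alpha> p \<zeta> w u0 u)"

end

(*
  Test the equation with psi_T(t, x) = psi(t/T - 1, x/sqrt T) supported in T <= t <= 2T, so that the
  initial datum plays no role: the forcing contributes c T^(m+1) with c > 0, while Young's inequality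
  bounds the remaining terms by C T^theta with theta = 1 + N/2 - (2p + alpha)/(2(p-1)), and the
  condition on p says theta < m + 1.  Young's inequality produces the weight |x|^(-alpha/(p-1)),
  which need not be integrable at the origin; hence psi is built so that psi_t + Laplace psi vanishes
  to high order on the axis x = 0.

  A mild solution satisfies the tested equation because the heat kernel integrates
  -(psi_t + Laplace psi) back to psi.  The exchange of integrals is free of assumptions on |x|^alpha:
  the nonlinearity is nonnegative, and its Duhamel term is bounded as a difference of bounded terms.
*)
theory Submission
  imports Defs "HOL-Probability.Distributions"
begin

section \<open>Directional derivatives and test functions\<close>

text \<open>Young's inequality calls for a bound of |\<psi>_t + \<Delta>\<psi>| by a constant times
  |x|^(\<alpha>/p) \<psi>^(1/p). Two obstacles shape \<psi>. At the edge of the support its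
  derivatives must be dominated by \<psi>^(1/p), which high powers of functions vanishing there
  achieve. At x = 0 the bound vanishes if \<alpha> > 0, yet \<psi> must not vanish on the axis,
  since for large T the forcing sees only the axis values of the profile. A product of cutoffs in
  time and space that is constant near the axis fails, because its time derivative survives there;
  the dependence on x has to compensate it, as in a solution of the backward heat equation
  prescribed on the axis.

  Classical solutions have derivatives along the coordinate axes, with no continuity of the
  first-order ones in space. Hence derivatives are taken along lines, and integrations by parts are
  arranged so that only continuous derivatives are integrated.\<close>

definition dird :: "('a::real_vector \<Rightarrow> real) \<Rightarrow> 'a \<Rightarrow> real \<Rightarrow> 'a \<Rightarrow> bool" where
  "dird f e D z \<longleftrightarrow> ((\<lambda>s. f (z + s *\<^sub>R e)) has_real_derivative D) (at 0)"

lemma dird_along_line: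
  "dird f e D (z + s *\<^sub>R e) \<longleftrightarrow> ((\<lambda>r. f (z + r *\<^sub>R e)) has_real_derivative D) (at s)"
  using DERIV_shift[of "\<lambda>r. f (z + r *\<^sub>R e)" D 0 s]
  by (simp add: dird_def algebra_simps)

lemma dird_mult:
  assumes "dird f e a z" "dird g e b z"
  shows "dird (\<lambda>z. f z * g z) e (a * g z + f z * b) z"
  using DERIV_mult[OF assms[unfolded dird_def]] by (simp add: dird_def algebra_simps)

lemma dird_diff:
  assumes "dird f e a z" "dird g e b z"
  shows "dird (\<lambda>z. f z - g z) e (a - b) z"
  using DERIV_diff[OF assms[unfolded dird_def]] by (simp add: dird_def)

lemma line_eventually_in_open:
  fixes z e :: "'a::real_normed_vector"
  assumes "open U" "z \<in> U"
  shows "eventually (\<lambda>s::real. z + s *\<^sub>R e \<in> U) (nhds 0)"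
proof -
  have "((\<lambda>s::real. z + s *\<^sub>R e) \<longlongrightarrow> z + 0 *\<^sub>R e) (nhds 0)"
    by (intro tendsto_intros filterlim_ident)
  then show ?thesis using topological_tendstoD[OF _ assms(1)] assms(2) by auto
qed

lemma dird_cong_open:
  fixes z e :: "'a::real_normed_vector"
  assumes "open U" "z \<in> U" "\<And>y. y \<in> U \<Longrightarrow> f y = g y"
  shows "dird f e D z \<longleftrightarrow> dird g e D z"
  unfolding dird_def
  by (rule DERIV_cong_ev[OF refl _ refl])
     (rule eventually_mono[OF line_eventually_in_open[OF assms(1,2)]], use assms(3) in auto)

lemma dird_const: "dird (\<lambda>_. c) e 0 z"
  by (simp add: dird_def)

lemma dird_zero_outside:
  fixes z e :: "'a::real_normed_vector"
  assumes "closed S" "z \<notin> S" "\<And>y. y \<notin> S \<Longrightarrow> f y = 0"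
  shows "dird f e 0 z"
proof -
  have "dird f e 0 z \<longleftrightarrow> dird (\<lambda>_. 0) e 0 z"
    using assms by (intro dird_cong_open[of "- S"]) auto
  then show ?thesis by (simp add: dird_const)
qed

lemma dird_unique: "dird f e a z \<Longrightarrow> dird f e b z \<Longrightarrow> a = b"
  unfolding dird_def by (rule DERIV_unique)

section \<open>Integrals of derivatives of compactly supported functions\<close>

lemma integrable_compact_support:
  fixes f :: "'a::euclidean_space \<Rightarrow> real"
  assumes "compact S" "continuous_on S f" "\<And>x. x \<notin> S \<Longrightarrow> f x = 0"
  shows "integrable lborel f"
proof -
  have "(\<lambda>x. indicator S x *\<^sub>R f x) = f" using assms(3) by (fastforce simp: fun_eq_iff indicator_def)
  with borel_integrable_compact[OF assms(1,2)] show ?thesis by simp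
qed

lemma continuous_on_mult_support:
  fixes g h :: "'a::t2_space \<Rightarrow> real"
  assumes "open U" "S \<subseteq> U" "closed S" "continuous_on U g" "continuous_on U h"
    and "\<And>x. x \<notin> S \<Longrightarrow> h x = 0"
  shows "continuous_on UNIV (\<lambda>x. g x * h x)"
proof -
  have "continuous_on U (\<lambda>x. g x * h x)" using assms by (intro continuous_intros)
  moreover have "continuous_on (- S) (\<lambda>x. g x * h x)"
    using assms(6) by (subst continuous_on_cong[OF refl, of _ _ "\<lambda>_. 0"]) auto
  ultimately have "continuous_on (U \<union> - S) (\<lambda>x. g x * h x)"
    using assms by (intro continuous_on_open_Un) auto
  moreover have "U \<union> - S = UNIV" using assms(2) by auto
  ultimately show ?thesis by simp
qed

lemma integral_lborel_translation:
  fixes f :: "'a::euclidean_space \<Rightarrow> real"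
  assumes "f \<in> borel_measurable borel"
  shows "(\<integral>x. f (x + c) \<partial>lborel) = (\<integral>x. f x \<partial>lborel)"
  using integral_distr[of "(+) c" lborel borel f] assms
  by (simp only: lborel_distr_plus) (simp add: add.commute)

text \<open>The difference quotients of \<open>F\<close> along \<open>e\<close> have integral 0 by
  translation invariance and converge dominatedly to \<open>F'\<close>. Only \<open>F'\<close> is
  known to be continuous; continuity, and with it integrability, of \<open>F\<close> has to be
  derived, since the lemma is applied to products containing first-order derivatives of unknown
  regularity.\<close>

lemma integral_dird_zero:
  fixes F :: "'a::euclidean_space \<Rightarrow> real"
  assumes S: "compact S" and F0: "\<And>x. x \<notin> S \<Longrightarrow> F x = 0"
    and cont: "continuous_on UNIV F'" and der: "\<And>z. dird F e (F' z) z" and e: "e \<noteq> 0"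
  shows "(\<integral>x. F' x \<partial>lborel) = 0"
proof -
  have F'0: "F' x = 0" if "x \<notin> S" for x
  proof (rule dird_unique[OF der])
    show "dird F e 0 x"
      by (rule dird_zero_outside[OF compact_imp_closed[OF S] that F0])
  qed
  obtain B where B: "B > 0" "\<And>x. x \<in> S \<Longrightarrow> norm x \<le> B"
    using compact_imp_bounded[OF S] by (auto simp: bounded_pos)
  have line: "((\<lambda>r. F (z + r *\<^sub>R e)) has_real_derivative F' (z + s *\<^sub>R e)) (at s)" for z s
    using der dird_along_line by blast
  \<comment> \<open>Moving along \<open>e\<close> by the factor \<open>R\<close> leaves the support
    from every point of the ball \<open>U\<close>. So on \<open>U\<close> the function
    \<open>F\<close> is minus the integral of \<open>F'\<close> over a segment, which depends
    continuously on the starting point.\<close>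
  have contF: "isCont F x0" for x0
  proof -
    define U where "U = ball (0::'a) (norm x0 + 1)"
    define R where "R = (B + norm x0 + 1) / norm e"
    have R: "R > 0" using B e by (simp add: R_def add_pos_nonneg)
    have eq: "F x = - integral (cbox 0 R) (\<lambda>s. F' (x + s *\<^sub>R e))" if "x \<in> U" for x
    proof -
      have "norm (R *\<^sub>R e) = B + norm x0 + 1" using e B(1) by (simp add: R_def add_pos_nonneg)
      moreover have "norm x < norm x0 + 1" using that by (simp add: U_def)
      ultimately have "norm (x + R *\<^sub>R e) > B"
        using norm_diff_ineq[of "R *\<^sub>R e" x] by (simp add: add.commute)
      then have FR: "F (x + R *\<^sub>R e) = 0" using B F0 by force
      have "((\<lambda>s. F' (x + s *\<^sub>R e)) has_integral F (x + R *\<^sub>R e) - F (x + 0 *\<^sub>R e)) {0..R}"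
        using R line
        by (intro fundamental_theorem_of_calculus)
           (auto simp: has_real_derivative_iff_has_vector_derivative[symmetric]
              intro: has_field_derivative_at_within)
      then show ?thesis using FR by (simp add: integral_unique)
    qed
    have "continuous_on U (\<lambda>x. integral (cbox 0 R) (\<lambda>s. F' (x + s *\<^sub>R e)))"
      by (rule integral_continuous_on_param)
         (auto simp: case_prod_unfold intro!: continuous_intros continuous_on_compose2[OF cont])
    then have "continuous_on U (\<lambda>x. - integral (cbox 0 R) (\<lambda>s. F' (x + s *\<^sub>R e)))"
      by (intro continuous_intros)
    then have "continuous_on U F" using eq by (simp cong: continuous_on_cong)
    then show ?thesis by (simp add: U_def continuous_on_eq_continuous_at)
  qed
  then have contF': "continuous_on A F" for A by (simp add: continuous_at_imp_continuous_on)
  have intF: "integrable lborel F"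
    by (rule integrable_compact_support[OF S contF' F0])
  have measF: "F \<in> borel_measurable borel" using intF by auto
  have "compact (F' ` S)"
    using S cont continuous_on_subset compact_continuous_image by blast
  then obtain M where M: "M > 0" "\<And>x. x \<in> S \<Longrightarrow> \<bar>F' x\<bar> \<le> M"
    using compact_imp_bounded[of "F' ` S"] by (auto simp: bounded_pos)
  have M': "\<bar>F' x\<bar> \<le> M" for x using M F'0 by (cases "x \<in> S") auto
  \<comment> \<open>Difference quotients with steps of length at most \<open>norm e\<close>, which
    explains the radius in the majorant \<open>w\<close>; its height comes from the mean value
    theorem.\<close>
  define D where "D n x = real (Suc n) * (F (x + (1 / real (Suc n)) *\<^sub>R e) - F x)" for n x
  define w where "w x = M * indicator (cball 0 (B + norm e)) x" for x :: 'a
  have "(\<lambda>n. \<integral>x. D n x \<partial>lborel) \<longlonglongrightarrow> (\<integral>x. F' x \<partial>lborel)"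
  proof (rule integral_dominated_convergence[where w = w])
    show "F' \<in> borel_measurable lborel"
      using borel_measurable_continuous_onI[OF cont] by simp
    show "D n \<in> borel_measurable lborel" for n
      unfolding D_def using measF by measurable
    show "integrable lborel w"
      unfolding w_def using borel_integrable_compact[OF compact_cball, of 0 "B + norm e" "\<lambda>_. M"]
      by (simp add: mult.commute)
    show "AE x in lborel. (\<lambda>n. D n x) \<longlonglongrightarrow> F' x"
    proof (rule AE_I2)
      fix x
      have "((\<lambda>h. (F (x + h *\<^sub>R e) - F x) / h) \<longlongrightarrow> F' x) (at 0)"
        using der[of x] by (simp add: dird_def DERIV_def)
      moreover have "filterlim (\<lambda>n. 1 / real (Suc n)) (at 0) sequentially"
        unfolding filterlim_at using LIMSEQ_inverse_real_of_nat by (simp add: inverse_eq_divide)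
      ultimately have "(\<lambda>n. (F (x + (1 / real (Suc n)) *\<^sub>R e) - F x) / (1 / real (Suc n))) \<longlonglongrightarrow> F' x"
        by (rule filterlim_compose)
      then show "(\<lambda>n. D n x) \<longlonglongrightarrow> F' x" by (simp add: D_def mult.commute)
    qed
    show "AE x in lborel. norm (D n x) \<le> w x" for n
    proof (rule AE_I2)
      fix x
      let ?h = "1 / real (Suc n)"
      have h: "0 < ?h" "?h \<le> 1" by auto
      show "norm (D n x) \<le> w x"
      proof (cases "norm x \<le> B + norm e")
        case True
        obtain s where "F (x + ?h *\<^sub>R e) - F (x + 0 *\<^sub>R e) = (?h - 0) * F' (x + s *\<^sub>R e)"
          using MVT2[of 0 ?h "\<lambda>r. F (x + r *\<^sub>R e)" "\<lambda>r. F' (x + r *\<^sub>R e)"] line h by blast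
        then have "D n x = F' (x + s *\<^sub>R e)" by (simp add: D_def)
        then show ?thesis using M' True by (simp add: w_def)
      next
        case False
        have "norm x \<le> norm (x + ?h *\<^sub>R e) + norm (?h *\<^sub>R e)"
          by (metis add_diff_cancel_right' norm_triangle_ineq4)
        moreover have "norm (?h *\<^sub>R e) \<le> norm e" using mult_left_le_one_le[of "norm e" ?h] h by simp
        ultimately have "norm (x + ?h *\<^sub>R e) > B" using False by linarith
        moreover have "norm x > B" using False norm_ge_zero[of e] by linarith
        ultimately have "F (x + ?h *\<^sub>R e) = 0" "F x = 0" using B F0 by force+
        then show ?thesis by (simp add: D_def w_def M(1) less_imp_le)
      qed
    qed
  qed
  moreover have "(\<integral>x. D n x \<partial>lborel) = 0" for n
  proof -
    have i: "integrable lborel (\<lambda>x. F (x + c))" for c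
    proof (rule integrable_compact_support)
      show "compact ((\<lambda>x. x - c) ` S)" using S compact_translation_subtract by blast
      show "continuous_on ((\<lambda>x. x - c) ` S) (\<lambda>x. F (x + c))"
        by (intro continuous_on_compose2[OF contF'[of UNIV]] continuous_intros) auto
      show "F (x + c) = 0" if "x \<notin> (\<lambda>x. x - c) ` S" for x
        using that F0[of "x + c"] by (metis add_diff_cancel_right' image_eqI)
    qed
    show ?thesis
      unfolding D_def using i intF
      by (simp add: Bochner_Integration.integral_diff integral_lborel_translation measF)
  qed
  ultimately show ?thesis by (simp add: LIMSEQ_const_iff)
qed

text \<open>Just the regularity used by one integration by parts in time and two in each coordinate;
  mixed derivatives do not occur. Finite smoothness is the point, because the bumps are built from
  powers of positive parts. Vanishing outside the closed set \<open>S\<close> passes from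
  \<open>\<psi>\<close> to its derivatives.\<close>

locale test_function =
  fixes S :: "(real \<times> (real ^ 'n)) set" and \<psi> \<psi>t :: "real \<times> (real ^ 'n) \<Rightarrow> real"
    and \<psi>x \<psi>xx :: "'n \<Rightarrow> real \<times> (real ^ 'n) \<Rightarrow> real"
  assumes compact_S: "compact S"
    and zero: "z \<notin> S \<Longrightarrow> \<psi> z = 0"
    and cont: "continuous_on UNIV \<psi>" "continuous_on UNIV \<psi>t" "continuous_on UNIV (\<psi>xx i)"
    and der_t: "dird \<psi> (1, 0) (\<psi>t z) z"
    and der_x: "dird \<psi> (0, axis i 1) (\<psi>x i z) z"
    and der_xx: "dird (\<psi>x i) (0, axis i 1) (\<psi>xx i z) z"
begin

lemma closed_S: "closed S" using compact_S by (rule compact_imp_closed)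

lemma zero_derivs: assumes "z \<notin> S" shows "\<psi>t z = 0" "\<psi>x i z = 0" "\<psi>xx i z = 0"
proof -
  show "\<psi>t z = 0" by (rule dird_unique[OF der_t dird_zero_outside[OF closed_S assms zero]])
  have x: "\<psi>x i z = 0" if "z \<notin> S" for z
    by (rule dird_unique[OF der_x dird_zero_outside[OF closed_S that zero]])
  show "\<psi>x i z = 0" using x assms by blast
  show "\<psi>xx i z = 0" by (rule dird_unique[OF der_xx dird_zero_outside[OF closed_S assms x]])
qed

text \<open>Minus the formal adjoint of u_t - \<Delta>u, that is, the backward heat
  operator.\<close>

definition "heat_op z = \<psi>t z + (\<Sum>i\<in>UNIV. \<psi>xx i z)"

lemma cont_heat_op: "continuous_on UNIV heat_op"
  unfolding heat_op_def by (intro continuous_intros cont)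

lemma heat_op_zero: "z \<notin> S \<Longrightarrow> heat_op z = 0"
  by (simp add: heat_op_def zero_derivs)

text \<open>Green's identity, from integrating the time derivative of \<open>u z * \<psi> z\<close>
  and, for each coordinate, the derivative of \<open>ux i z * \<psi> z - u z * \<psi>x i z\<close>.
  In the latter the products of two first-order derivatives cancel, so the integrand is continuous
  even if \<open>ux\<close> and \<open>\<psi>x\<close> are not. In the applications \<open>U\<close>
  consists of the times after the pole of the heat kernel, or of the positive times.\<close>

lemma weak_form:
  assumes U: "open U" "S \<subseteq> U"
    and c: "continuous_on U u" "continuous_on U ut" "\<And>i. continuous_on U (uxx i)"
    and d: "\<And>z. z \<in> U \<Longrightarrow> dird u (1, 0) (ut z) z"
      "\<And>z i. z \<in> U \<Longrightarrow> dird u (0, axis i 1) (ux i z) z"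
      "\<And>z i. z \<in> U \<Longrightarrow> dird (ux i) (0, axis i 1) (uxx i z) z"
  shows "integrable lborel (\<lambda>z. (ut z - (\<Sum>i\<in>UNIV. uxx i z)) * \<psi> z)"
    and "integrable lborel (\<lambda>z. u z * heat_op z)"
    and "(\<integral>z. (ut z - (\<Sum>i\<in>UNIV. uxx i z)) * \<psi> z \<partial>lborel) = - (\<integral>z. u z * heat_op z \<partial>lborel)"
proof -
  have cs: "continuous_on UNIV (\<lambda>z. g z * h z)" "integrable lborel (\<lambda>z. g z * h z)"
    if "continuous_on U g" "continuous_on UNIV h" "\<And>z. z \<notin> S \<Longrightarrow> h z = 0"
    for g h :: "real \<times> (real ^ 'n) \<Rightarrow> real"
  proof -
    show 1: "continuous_on UNIV (\<lambda>z. g z * h z)"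
      using that by (intro continuous_on_mult_support[OF U closed_S that(1)] continuous_on_subset[OF that(2)]) auto
    show "integrable lborel (\<lambda>z. g z * h z)"
      by (rule integrable_compact_support[OF compact_S continuous_on_subset[OF 1]])
         (use that(3) in auto)
  qed
  note z = zero zero_derivs
  have t0: "(\<integral>z. ut z * \<psi> z + u z * \<psi>t z \<partial>lborel) = 0"
  proof (rule integral_dird_zero[OF compact_S])
    show "continuous_on UNIV (\<lambda>z. ut z * \<psi> z + u z * \<psi>t z)"
      by (intro continuous_intros cs c cont z)
    show "dird (\<lambda>z. u z * \<psi> z) (1, 0) (ut w * \<psi> w + u w * \<psi>t w) w" for w
    proof (cases "w \<in> U")
      case True then show ?thesis using d(1) der_t by (intro dird_mult)
    next
      case False
      then have "w \<notin> S" using U by auto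
      then show ?thesis
        using dird_zero_outside[OF closed_S, of w "\<lambda>z. u z * \<psi> z"] zero zero_derivs by simp
    qed
  qed (auto simp: zero zero_prod_def)
  have x0: "(\<integral>z. uxx i z * \<psi> z - u z * \<psi>xx i z \<partial>lborel) = 0" for i
  proof (rule integral_dird_zero[OF compact_S])
    show "continuous_on UNIV (\<lambda>z. uxx i z * \<psi> z - u z * \<psi>xx i z)"
      by (intro continuous_intros cs c cont z)
    show "dird (\<lambda>z. ux i z * \<psi> z - u z * \<psi>x i z) (0, axis i 1) (uxx i w * \<psi> w - u w * \<psi>xx i w) w" for w
    proof (cases "w \<in> U")
      case True
      have "dird (\<lambda>z. ux i z * \<psi> z - u z * \<psi>x i z) (0, axis i 1)
          ((uxx i w * \<psi> w + ux i w * \<psi>x i w) - (ux i w * \<psi>x i w + u w * \<psi>xx i w)) w"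
        using True d der_x der_xx by (intro dird_diff dird_mult)
      then show ?thesis by simp
    next
      case False
      then have "w \<notin> S" using U by auto
      then show ?thesis
        using dird_zero_outside[OF closed_S, of w "\<lambda>z. ux i z * \<psi> z - u z * \<psi>x i z"]
          zero zero_derivs by simp
    qed
    show "(0, axis i 1) \<noteq> (0 :: real \<times> (real ^ 'n))" by (simp add: zero_prod_def axis_eq_0_iff)
  qed (auto simp: zero zero_derivs)
  have i1: "integrable lborel (\<lambda>z. ut z * \<psi> z)" "integrable lborel (\<lambda>z. u z * \<psi>t z)"
    "\<And>i. integrable lborel (\<lambda>z. uxx i z * \<psi> z)" "\<And>i. integrable lborel (\<lambda>z. u z * \<psi>xx i z)"
    by (intro cs c cont z; simp)+
  have e1: "(\<lambda>z. (ut z - (\<Sum>i\<in>UNIV. uxx i z)) * \<psi> z) = (\<lambda>z. ut z * \<psi> z - (\<Sum>i\<in>UNIV. uxx i z * \<psi> z))"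
    by (simp add: fun_eq_iff left_diff_distrib sum_distrib_right)
  have e2: "(\<lambda>z. u z * heat_op z) = (\<lambda>z. u z * \<psi>t z + (\<Sum>i\<in>UNIV. u z * \<psi>xx i z))"
    by (simp add: fun_eq_iff heat_op_def distrib_left sum_distrib_left)
  show "integrable lborel (\<lambda>z. (ut z - (\<Sum>i\<in>UNIV. uxx i z)) * \<psi> z)"
    unfolding e1 using i1 by auto
  show "integrable lborel (\<lambda>z. u z * heat_op z)"
    unfolding e2 using i1 by auto
  have "(\<integral>z. uxx i z * \<psi> z \<partial>lborel) = (\<integral>z. u z * \<psi>xx i z \<partial>lborel)" for i
    using x0[of i] i1 by simp
  moreover have "(\<integral>z. ut z * \<psi> z \<partial>lborel) = - (\<integral>z. u z * \<psi>t z \<partial>lborel)"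
    using t0 i1 by simp
  ultimately show "(\<integral>z. (ut z - (\<Sum>i\<in>UNIV. uxx i z)) * \<psi> z \<partial>lborel) = - (\<integral>z. u z * heat_op z \<partial>lborel)"
    unfolding e1 e2 using i1 by simp
qed

end

section \<open>The heat kernel\<close>

text \<open>The source of compact supports with finite smoothness: exponent 2 serves the time
  cutoff, exponents \<open>q\<close> and \<open>q - 1\<close> the first two derivatives of the
  bump.\<close>

lemma DERIV_max_0_power:
  assumes "q \<ge> 2"
  shows "((\<lambda>y::real. max 0 y ^ q) has_real_derivative real q * max 0 x ^ (q - 1)) (at x)"
proof -
  consider "x > 0" | "x < 0" | "x = 0" by linarith
  then show ?thesis
  proof cases
    case 1
    have "((\<lambda>y::real. y ^ q) has_real_derivative real q * x ^ (q - 1)) (at x)"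
      by (auto intro!: derivative_eq_intros)
    moreover have "eventually (\<lambda>y. max 0 y ^ q = y ^ q) (nhds x)"
      using eventually_nhds_in_open[of "{0<..}" x] 1 by (auto elim!: eventually_mono)
    ultimately show ?thesis using 1 DERIV_cong_ev[of x x "\<lambda>y. max 0 y ^ q" "\<lambda>y. y ^ q"] by auto
  next
    case 2
    have "eventually (\<lambda>y. max 0 y ^ q = 0) (nhds x)"
      using eventually_nhds_in_open[of "{..<0}" x] 2 assms by (auto elim!: eventually_mono)
    then show ?thesis
      using 2 assms DERIV_cong_ev[of x x "\<lambda>y. max 0 y ^ q" "\<lambda>y. 0"] by (auto simp: power_0_left)
  next
    case 3
    have "((\<lambda>h::real. max 0 h ^ q / h) \<longlongrightarrow> 0) (at 0)"
    proof (rule Lim_null_comparison)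
      show "((\<lambda>h::real. \<bar>h\<bar> ^ (q - 1)) \<longlongrightarrow> 0) (at 0)"
        using assms by (auto intro!: tendsto_eq_intros)
      have "norm (max 0 h ^ q / h) \<le> \<bar>h\<bar> ^ (q - 1)" if "h \<noteq> 0" for h :: real
      proof -
        have "\<bar>max 0 h\<bar> ^ q \<le> \<bar>h\<bar> ^ q" by (intro power_mono) auto
        also have "\<dots> = \<bar>h\<bar> ^ (q - 1) * \<bar>h\<bar>"
          using assms by (metis Suc_diff_1 less_le_trans pos2 power_Suc2)
        finally show ?thesis using that by (simp add: divide_le_eq power_abs abs_mult)
      qed
      then show "\<forall>\<^sub>F h::real in at 0. norm (max 0 h ^ q / h) \<le> \<bar>h\<bar> ^ (q - 1)"
        by (auto simp: eventually_at_filter)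
    qed
    then show ?thesis using 3 assms by (simp add: DERIV_def power_0_left)
  qed
qed

section \<open>Mass and scaling of the heat kernel\<close>

lemma heat_kernel_measurable [measurable]:
  assumes [measurable]: "f \<in> borel_measurable M" "g \<in> borel_measurable M"
  shows "(\<lambda>z. heat_kernel (f z) (g z :: real ^ 'n)) \<in> borel_measurable M"
  unfolding heat_kernel_def by measurable

lemma heat_kernel_nonneg: "heat_kernel t x \<ge> 0"
  by (simp add: heat_kernel_def)

lemma heat_kernel_minus_commute: "heat_kernel t (x - y) = heat_kernel t (y - x)"
  by (simp add: heat_kernel_def norm_minus_commute)

lemma inverse_sqrt_power_eq_powr:
  "a > 0 \<Longrightarrow> (1 / sqrt a) ^ n = a powr (- (real n / 2))"
proof -
  assume a: "a > 0"
  then have "1 / sqrt a = a powr (- (1 / 2))" by (simp add: powr_half_sqrt powr_minus_divide)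
  with a show ?thesis by (simp add: powr_power)
qed

text \<open>At time 1 the kernel is the product over the coordinates of normal densities of variance
  2, so its mass is a product of one-dimensional masses.\<close>

lemma heat_kernel_1_mass: "(\<integral>\<^sup>+x. ennreal (heat_kernel 1 (x :: real ^ 'n)) \<partial>lborel) = 1"
proof -
  have eq: "heat_kernel 1 x = (\<Prod>b\<in>Basis. normal_density 0 (sqrt 2) (x \<bullet> b))" for x :: "real ^ 'n"
  proof -
    have "(\<Prod>b\<in>(Basis :: (real ^ 'n) set). normal_density 0 (sqrt 2) (x \<bullet> b)) =
        (1 / sqrt (4 * pi)) ^ CARD('n) * exp (\<Sum>b\<in>Basis. - (x \<bullet> b)\<^sup>2 / 4)"
      by (simp add: normal_density_def prod.distrib prod_dividef exp_sum power_divide)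
    also have "(\<Sum>b\<in>Basis. - (x \<bullet> b)\<^sup>2 / 4) = - (norm x)\<^sup>2 / 4"
      unfolding power2_norm_eq_inner euclidean_inner[of x x]
      by (simp add: sum_negf sum_divide_distrib[symmetric] power2_eq_square)
    also have "(1 / sqrt (4 * pi)) ^ CARD('n) = (4 * pi) powr (- (real CARD('n) / 2))"
      by (simp add: inverse_sqrt_power_eq_powr)
    finally show ?thesis by (simp add: heat_kernel_def)
  qed
  have nd: "(\<integral>\<^sup>+x. ennreal (normal_density 0 (sqrt 2) x) \<partial>lborel) = 1"
    using nn_integral_eq_integral[OF integrable_normal_density] integral_normal_density
    by simp
  interpret product_sigma_finite "\<lambda>_. lborel :: real measure" ..
  have "(\<integral>\<^sup>+x. ennreal (heat_kernel 1 (x :: real ^ 'n)) \<partial>lborel) =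
      (\<integral>\<^sup>+f. ennreal (heat_kernel 1 (\<Sum>b\<in>(Basis :: (real ^ 'n) set). f b *\<^sub>R b)) \<partial>(\<Pi>\<^sub>M b\<in>Basis. lborel))"
    by (subst lborel_eq) (simp add: nn_integral_distr)
  also have "\<dots> = (\<integral>\<^sup>+f. (\<Prod>b\<in>(Basis :: (real ^ 'n) set). ennreal (normal_density 0 (sqrt 2) (f b))) \<partial>(\<Pi>\<^sub>M b\<in>Basis. lborel))"
    by (intro nn_integral_cong) (simp add: eq prod_ennreal inner_sum_left inner_Basis if_distrib sum.If_cases cong: if_cong)
  also have "\<dots> = (\<Prod>b\<in>(Basis :: (real ^ 'n) set). \<integral>\<^sup>+x. ennreal (normal_density 0 (sqrt 2) x) \<partial>lborel)"
    by (intro product_nn_integral_prod) auto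
  finally show ?thesis by (simp add: nd)
qed

lemma heat_kernel_rescale:
  fixes z :: "real ^ 'n"
  assumes "s > 0"
  shows "heat_kernel s (sqrt s *\<^sub>R z) = heat_kernel 1 z / sqrt s ^ CARD('n)"
proof -
  have "(4 * pi * s) powr (- (real CARD('n) / 2)) =
      (4 * pi) powr (- (real CARD('n) / 2)) * s powr (- (real CARD('n) / 2))"
    using assms by (simp add: powr_mult)
  also have "s powr (- (real CARD('n) / 2)) = 1 / sqrt s ^ CARD('n)"
    using inverse_sqrt_power_eq_powr[OF assms, of "CARD('n)"] by (simp add: power_divide)
  finally show ?thesis using assms
    by (simp add: heat_kernel_def power_mult_distrib)
qed

text \<open>After the substitution the kernel is frozen at time 1 and \<open>s\<close> occurs only
  in the argument of \<open>f\<close>; this opens the limit of short times to dominated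
  convergence.\<close>

lemma heat_kernel_substitution:
  fixes f :: "real ^ 'n \<Rightarrow> real"
  assumes s: "s > 0" and [measurable]: "f \<in> borel_measurable borel"
  shows "(\<integral>x. heat_kernel s (x - y) * f x \<partial>lborel) = (\<integral>z. heat_kernel 1 z * f (y + sqrt s *\<^sub>R z) \<partial>lborel)"
  using s by (subst lborel_affine[of "sqrt s" y])
    (simp_all add: integral_density integral_distr heat_kernel_rescale)

lemma heat_kernel_mass:
  assumes s: "s > 0"
  shows "(\<integral>\<^sup>+x. ennreal (heat_kernel s (x - y :: real ^ 'n)) \<partial>lborel) = 1"
proof -
  have "(\<integral>\<^sup>+x. ennreal (heat_kernel s (x - y)) \<partial>lborel) =
      (\<integral>\<^sup>+z. ennreal (sqrt s ^ CARD('n)) * ennreal (heat_kernel s (sqrt s *\<^sub>R z :: real ^ 'n)) \<partial>lborel)"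
    using s by (subst lborel_affine[of "sqrt s" y])
      (simp_all add: nn_integral_density nn_integral_distr)
  also have "\<dots> = (\<integral>\<^sup>+z. ennreal (heat_kernel 1 (z :: real ^ 'n)) \<partial>lborel)"
    using s by (intro nn_integral_cong) (simp add: heat_kernel_rescale ennreal_mult[symmetric] heat_kernel_nonneg)
  finally show ?thesis by (simp add: heat_kernel_1_mass)
qed

lemma integrable_heat_kernel:
  assumes "s > 0"
  shows "integrable lborel (\<lambda>x. heat_kernel s (x - y :: real ^ 'n))"
    "(\<integral>x. heat_kernel s (x - y) \<partial>lborel) = 1"
proof -
  show "integrable lborel (\<lambda>x. heat_kernel s (x - y :: real ^ 'n))"
    by (rule integrableI_bounded) (simp_all add: heat_kernel_nonneg heat_kernel_mass[OF assms])
  show "(\<integral>x. heat_kernel s (x - y) \<partial>lborel) = 1"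
    using heat_kernel_mass[OF assms, of y] by (simp add: integral_eq_nn_integral heat_kernel_nonneg)
qed

text \<open>The fundamental solution of the heat equation with pole \<open>w\<close>, as a function
  of \<open>z\<close>. Being 0 up to the time of the pole, it encodes the upper limit of the Duhamel
  integral, which becomes an integral over all of space-time.\<close>

definition forward_kernel :: "real \<times> (real ^ 'n) \<Rightarrow> real \<times> (real ^ 'n) \<Rightarrow> real" where
  "forward_kernel w z = (if fst w < fst z then heat_kernel (fst z - fst w) (snd z - snd w) else 0)"

lemma forward_kernel_measurable [measurable]:
  assumes [measurable]: "f \<in> borel_measurable M" "g \<in> borel_measurable M"
  shows "(\<lambda>z. forward_kernel (f z) (g z :: real \<times> (real ^ 'n))) \<in> borel_measurable M"
proof -
  have [measurable]: "(\<lambda>z. fst (f z)) \<in> borel_measurable M" "(\<lambda>z. snd (f z)) \<in> borel_measurable M"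
    "(\<lambda>z. fst (g z)) \<in> borel_measurable M" "(\<lambda>z. snd (g z)) \<in> borel_measurable M"
    by (auto intro!: measurable_compose[OF assms(1)] measurable_compose[OF assms(2)]
        borel_measurable_continuous_onI continuous_intros)
  show ?thesis unfolding forward_kernel_def by measurable
qed

lemma forward_kernel_nonneg: "forward_kernel w z \<ge> 0"
  by (simp add: forward_kernel_def heat_kernel_nonneg)

lemma forward_kernel_slice_mass: "(\<integral>\<^sup>+x. ennreal (forward_kernel w (t, x)) \<partial>lborel) \<le> 1"
  using heat_kernel_mass[of "t - fst w" "snd w"] by (cases "fst w < t") (simp_all add: forward_kernel_def)

section \<open>Derivatives of the heat kernel\<close>

lemma has_real_derivative_heat_kernel:
  fixes x :: "real ^ 'n"
  assumes "s > 0"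
  shows "((\<lambda>r. heat_kernel (s + r) x) has_real_derivative
      heat_kernel s x * ((norm x)\<^sup>2 / (4 * s\<^sup>2) - real CARD('n) / (2 * s))) (at 0)"
proof -
  have "((\<lambda>r. (4 * pi * (s + r)) powr a) has_real_derivative (4 * pi * s) powr a * (a / s)) (at 0)" for a
  proof -
    have "((\<lambda>r. (4 * pi * (s + r)) powr a) has_real_derivative (a * (4 * pi * s) powr (a - 1)) * (4 * pi)) (at 0)"
      using assms by (auto intro!: derivative_eq_intros)
    also have "(a * (4 * pi * s) powr (a - 1)) * (4 * pi) = (4 * pi * s) powr a * (a / s)"
      using assms by (simp add: powr_diff)
    finally show ?thesis .
  qed
  note d1 = this
  have d2: "((\<lambda>r. exp (- (norm x)\<^sup>2 / (4 * (s + r)))) has_real_derivative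
      exp (- (norm x)\<^sup>2 / (4 * s)) * ((norm x)\<^sup>2 / (4 * s\<^sup>2))) (at 0)"
    using assms by (auto intro!: derivative_eq_intros simp: power2_eq_square)
  show ?thesis
    unfolding heat_kernel_def
    by (rule DERIV_cong[OF DERIV_mult[OF d1 d2]]) (simp add: algebra_simps)
qed

lemma norm_add_axis_square:
  fixes x :: "real ^ 'n"
  shows "(norm (x + r *\<^sub>R axis i 1))\<^sup>2 = (norm x)\<^sup>2 + 2 * r * (x $ i) + r\<^sup>2"
  unfolding power2_norm_eq_inner
  by (simp add: inner_add_left inner_add_right inner_axis inner_commute
      inner_axis_axis power2_eq_square algebra_simps)

lemma has_real_derivative_heat_kernel_space:
  fixes x :: "real ^ 'n"
  assumes "s > 0"
  shows "((\<lambda>r. heat_kernel s (x + r *\<^sub>R axis i 1)) has_real_derivative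
      - heat_kernel s x * (x $ i) / (2 * s)) (at 0)"
proof -
  note n = norm_add_axis_square[of x _ i]
  have "((\<lambda>r. - ((norm x)\<^sup>2 + 2 * r * (x $ i) + r\<^sup>2) / (4 * s)) has_real_derivative
      - (x $ i) / (2 * s)) (at 0)"
    using assms by (auto intro!: derivative_eq_intros)
  from DERIV_cmult[OF DERIV_fun_exp[OF this], of "(4 * pi * s) powr (- (real CARD('n) / 2))"]
  show ?thesis
    unfolding heat_kernel_def n by (simp add: mult.assoc)
qed

section \<open>The heat kernel against a test function\<close>

text \<open>A quotient of squared positive parts whose denominator never vanishes. One continuous
  derivative is enough: the cutoff acts on time, which enters the heat operator to first order
  only.\<close>

lemma C1_cutoff_exists:
  obtains \<theta> \<theta>' :: "real \<Rightarrow> real" where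
    "\<And>r. (\<theta> has_real_derivative \<theta>' r) (at r)" "continuous_on UNIV \<theta>'"
    "\<And>r. r \<le> 1 \<Longrightarrow> \<theta> r = 0" "\<And>r. r \<ge> 2 \<Longrightarrow> \<theta> r = 1"
    "\<And>r. \<bar>\<theta> r\<bar> \<le> 1" "\<And>r. r \<notin> {1..2} \<Longrightarrow> \<theta>' r = 0"
proof
  define A where "A r = max 0 (r - 1) ^ 2" for r :: real
  define B where "B r = max 0 (2 - r) ^ 2" for r :: real
  let ?\<theta> = "\<lambda>r. A r / (A r + B r)"
  let ?\<theta>' = "\<lambda>r. (2 * max 0 (r - 1) * (A r + B r) - A r * (2 * max 0 (r - 1) - 2 * max 0 (2 - r))) / ((A r + B r) * (A r + B r))"
  have pos: "A r + B r > 0" for r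
    by (cases "r < 2") (auto simp: A_def B_def add_nonneg_pos add_pos_nonneg)
  have d: "((\<lambda>y. max 0 y ^ 2) has_real_derivative 2 * max 0 x) (at x)" for x :: real
    using DERIV_max_0_power[of 2 x] by simp
  have A: "(A has_real_derivative 2 * max 0 (r - 1)) (at r)" for r
    unfolding A_def
    by (rule DERIV_cong[OF DERIV_chain2[where f = "\<lambda>y. max 0 y ^ 2" and Db = 1, OF d]])
       (auto intro!: derivative_eq_intros)
  have B: "(B has_real_derivative - 2 * max 0 (2 - r)) (at r)" for r
    unfolding B_def
    by (rule DERIV_cong[OF DERIV_chain2[where f = "\<lambda>y. max 0 y ^ 2" and Db = "-1", OF d]])
       (auto intro!: derivative_eq_intros)
  show "(?\<theta> has_real_derivative ?\<theta>' r) (at r)" for r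
    using DERIV_divide[OF A DERIV_add[OF A B]] pos[of r] by (simp add: less_imp_neq[THEN not_sym])
  show "continuous_on UNIV ?\<theta>'"
  proof -
    have "continuous_on UNIV A" "continuous_on UNIV B"
      unfolding A_def B_def by (intro continuous_intros)+
    then show ?thesis
      using pos by (intro continuous_intros) (auto simp: less_imp_neq[THEN not_sym])
  qed
  show "?\<theta> r = 0" if "r \<le> 1" for r using that by (simp add: A_def)
  show "?\<theta> r = 1" if "r \<ge> 2" for r using that pos[of r] by (simp add: B_def)
  show "\<bar>?\<theta> r\<bar> \<le> 1" for r using pos[of r] by (simp add: A_def B_def)
  show "?\<theta>' r = 0" if "r \<notin> {1..2}" for r using that by (auto simp: A_def B_def)
qed

text \<open>Each time slice of the kernel has mass at most 1, however close to the pole it lies. So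
  the singularity is harmless and the integral is at most \<open>M\<close> times the length of the
  time interval.\<close>

lemma integrable_forward_kernel_mult:
  fixes f :: "real \<times> (real ^ 'n) \<Rightarrow> real"
  assumes [measurable]: "f \<in> borel_measurable borel"
    and M: "\<And>z. \<bar>f z\<bar> \<le> M" and R: "\<And>z. \<bar>fst z\<bar> > R \<Longrightarrow> f z = 0"
  shows "integrable lborel (\<lambda>z. forward_kernel w z * f z)"
proof (rule integrableI_bounded)
  have M0: "M \<ge> 0" using M[of 0] by linarith
  have "(\<integral>\<^sup>+z. ennreal (norm (forward_kernel w z * f z)) \<partial>lborel)
      = (\<integral>\<^sup>+t. \<integral>\<^sup>+x. ennreal (norm (forward_kernel w (t, x) * f (t, x))) \<partial>lborel \<partial>lborel)"
    unfolding lborel_prod[symmetric]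
    by (rule lborel.nn_integral_fst[symmetric]) (simp add: lborel_prod)
  also have "\<dots> \<le> (\<integral>\<^sup>+t. ennreal M * indicator {-R..R} t \<partial>lborel)"
  proof (rule nn_integral_mono)
    fix t :: real
    have "(\<integral>\<^sup>+x. ennreal (norm (forward_kernel w (t, x) * f (t, x))) \<partial>lborel)
        \<le> (\<integral>\<^sup>+x. (ennreal M * indicator {-R..R} t) * ennreal (forward_kernel w (t, x)) \<partial>lborel)"
    proof (rule nn_integral_mono)
      fix x
      have *: "\<bar>f (t, x)\<bar> \<le> M * indicator {-R..R} t"
        using M[of "(t, x)"] R[of "(t, x)"] by (auto simp: indicator_def)
      have "norm (forward_kernel w (t, x) * f (t, x)) \<le> (M * indicator {-R..R} t) * forward_kernel w (t, x)"
        using mult_right_mono[OF *, of "forward_kernel w (t, x)"]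
        by (simp add: abs_mult forward_kernel_nonneg mult.commute[of "\<bar>f (t, x)\<bar>"])
      then show "ennreal (norm (forward_kernel w (t, x) * f (t, x)))
          \<le> (ennreal M * indicator {-R..R} t) * ennreal (forward_kernel w (t, x))"
        using M0 by (simp add: ennreal_mult[symmetric] forward_kernel_nonneg ennreal_leI
            ennreal_indicator[symmetric] del: ennreal_indicator)
    qed
    also have "\<dots> = (ennreal M * indicator {-R..R} t) * (\<integral>\<^sup>+x. ennreal (forward_kernel w (t, x)) \<partial>lborel)"
      by (rule nn_integral_cmult) simp
    also have "\<dots> \<le> (ennreal M * indicator {-R..R} t) * 1"
      by (intro mult_left_mono forward_kernel_slice_mass) simp
    finally show "(\<integral>\<^sup>+x. ennreal (norm (forward_kernel w (t, x) * f (t, x))) \<partial>lborel)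
        \<le> ennreal M * indicator {-R..R} t" by simp
  qed
  also have "\<dots> < \<infinity>"
    by (simp add: nn_integral_cmult ennreal_mult_less_top emeasure_lborel_Icc_eq)
  finally show "(\<integral>\<^sup>+z. ennreal (norm (forward_kernel w z * f z)) \<partial>lborel) < \<infinity>" .
qed simp

context test_function
begin

lemma support_bounds:
  obtains M R where "M > 0" "R > 0" "\<And>z. \<bar>\<psi> z\<bar> \<le> M" "\<And>z. \<bar>heat_op z\<bar> \<le> M"
    "\<And>z. z \<in> S \<Longrightarrow> norm z \<le> R"
proof -
  have *: "\<exists>M>0. \<forall>z. \<bar>h z\<bar> \<le> M"
    if c: "continuous_on UNIV h" and 0: "\<And>z. z \<notin> S \<Longrightarrow> h z = 0" for h :: "real \<times> (real ^ 'n) \<Rightarrow> real"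
  proof -
    have "bounded (h ` S)"
      using compact_S c continuous_on_subset compact_continuous_image compact_imp_bounded by blast
    then obtain M where M: "M > 0" "\<And>z. z \<in> S \<Longrightarrow> \<bar>h z\<bar> \<le> M" by (auto simp: bounded_pos)
    then have "\<bar>h z\<bar> \<le> M" for z using 0 by (cases "z \<in> S") auto
    with M show ?thesis by blast
  qed
  obtain M1 where M1: "M1 > 0" "\<And>z. \<bar>\<psi> z\<bar> \<le> M1" using *[OF cont(1) zero] by blast
  obtain M2 where M2: "M2 > 0" "\<And>z. \<bar>heat_op z\<bar> \<le> M2" using *[OF cont_heat_op heat_op_zero] by blast
  obtain R where "R > 0" "\<And>z. z \<in> S \<Longrightarrow> norm z \<le> R"
    using compact_imp_bounded[OF compact_S] by (auto simp: bounded_pos)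
  with M1 M2 show ?thesis
    using that[of "max M1 M2" R] by (meson less_max_iff_disj max.coboundedI1 max.coboundedI2)
qed

lemma borel_psi: "\<psi> \<in> borel_measurable borel"
  by (rule borel_measurable_continuous_onI[OF cont(1)])

lemma borel_heat_op: "heat_op \<in> borel_measurable borel"
  by (rule borel_measurable_continuous_onI[OF cont_heat_op])

lemma integrable_forward_kernel_heat_op: "integrable lborel (\<lambda>z. forward_kernel w z * heat_op z)"
proof -
  obtain M R where "\<And>z. \<bar>heat_op z\<bar> \<le> M" and R: "\<And>z. z \<in> S \<Longrightarrow> norm z \<le> R"
    using support_bounds by metis
  moreover have "heat_op z = 0" if "\<bar>fst z\<bar> > R" for z
    using that R[of z] norm_fst_le[of "fst z" "snd z"] by (force intro: heat_op_zero)
  ultimately show ?thesis by (intro integrable_forward_kernel_mult[OF borel_heat_op])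
qed

text \<open>Green's identity for the kernel at times after the pole. The kernel solves the heat
  equation there, so only the backward operator applied to the truncated test function
  remains.\<close>

lemma time_cutoff_weak_form:
  fixes \<theta> \<theta>' :: "real \<Rightarrow> real"
  assumes \<theta>: "\<And>r. (\<theta> has_real_derivative \<theta>' r) (at r)" "continuous_on UNIV \<theta>'"
    "\<And>r. r \<le> 1 \<Longrightarrow> \<theta> r = 0" and \<epsilon>: "\<epsilon> > 0"
  shows "(\<integral>z. forward_kernel w z * (\<theta> ((fst z - fst w) / \<epsilon>) * heat_op z + \<theta>' ((fst z - fst w) / \<epsilon>) / \<epsilon> * \<psi> z) \<partial>lborel) = 0"
proof -
  let ?\<theta> = "\<lambda>z :: real \<times> (real ^ 'n). \<theta> ((fst z - fst w) / \<epsilon>)"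
  let ?\<theta>' = "\<lambda>z :: real \<times> (real ^ 'n). \<theta>' ((fst z - fst w) / \<epsilon>) / \<epsilon>"
  have c\<theta>: "continuous_on UNIV \<theta>" using \<theta>(1) by (meson DERIV_isCont continuous_at_imp_continuous_on)
  have c: "continuous_on UNIV ?\<theta>" "continuous_on UNIV ?\<theta>'"
    using \<epsilon> by (auto intro!: continuous_intros continuous_on_compose2[OF c\<theta>] continuous_on_compose2[OF \<theta>(2)])
  have dt: "dird ?\<theta> (1, 0) (?\<theta>' z) z" for z
  proof -
    have "((\<lambda>s. (fst z + s - fst w) / \<epsilon>) has_real_derivative 1 / \<epsilon>) (at 0)"
      using \<epsilon> by (auto intro!: derivative_eq_intros)
    from DERIV_chain2[OF \<theta>(1)[of "(fst z + 0 - fst w) / \<epsilon>"] this]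
    show ?thesis by (simp add: dird_def)
  qed
  have dx: "dird ?\<theta> (0, axis i 1) 0 z" for i z
    by (simp add: dird_def)
  \<comment> \<open>The cutoff vanishes up to time \<open>fst w + \<epsilon>\<close>, which moves
    the support off the pole.\<close>
  interpret c: test_function "S \<inter> {z. fst w + \<epsilon> \<le> fst z}" "\<lambda>z. ?\<theta> z * \<psi> z"
    "\<lambda>z. ?\<theta>' z * \<psi> z + ?\<theta> z * \<psi>t z" "\<lambda>i z. ?\<theta> z * \<psi>x i z" "\<lambda>i z. ?\<theta> z * \<psi>xx i z"
  proof
    show "compact (S \<inter> {z. fst w + \<epsilon> \<le> fst z})"
      by (intro compact_Int_closed compact_S closed_Collect_le continuous_intros)
    show "?\<theta> z * \<psi> z = 0" if "z \<notin> S \<inter> {z. fst w + \<epsilon> \<le> fst z}" for z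
    proof (cases "z \<in> S")
      case True
      then have "(fst z - fst w) / \<epsilon> \<le> 1" using that \<epsilon> by (simp add: divide_le_eq)
      then show ?thesis by (simp add: \<theta>(3))
    qed (simp add: zero)
    show "dird (\<lambda>z. ?\<theta> z * \<psi> z) (1, 0) (?\<theta>' z * \<psi> z + ?\<theta> z * \<psi>t z) z" for z
      using dird_mult[OF dt der_t] .
    show "dird (\<lambda>z. ?\<theta> z * \<psi> z) (0, axis i 1) (?\<theta> z * \<psi>x i z) z" for z i
      using dird_mult[OF dx der_x, of i z] by simp
    show "dird (\<lambda>z. ?\<theta> z * \<psi>x i z) (0, axis i 1) (?\<theta> z * \<psi>xx i z) z" for z i
      using dird_mult[OF dx der_xx, of i z] by simp
  qed (intro continuous_intros c cont)+
  let ?U = "{z :: real \<times> (real ^ 'n). fst w < fst z}"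
  define s where "s z = fst z - fst w" for z :: "real \<times> (real ^ 'n)"
  define X where "X z = snd z - snd w" for z :: "real \<times> (real ^ 'n)"
  define u where "u z = heat_kernel (s z) (X z)" for z
  define ut where "ut z = u z * ((norm (X z))\<^sup>2 / (4 * (s z)\<^sup>2) - real CARD('n) / (2 * s z))" for z
  define ux where "ux i z = - u z * (X z $ i) / (2 * s z)" for i z
  define uxx where "uxx i z = u z * ((X z $ i)\<^sup>2 / (4 * (s z)\<^sup>2) - 1 / (2 * s z))" for i z
  have U: "s z > 0" if "z \<in> ?U" for z using that by (simp add: s_def)
  have sne: "s z \<noteq> 0" if "fst w < fst z" for z using that by (simp add: s_def)
  have cs: "continuous_on ?U s" "continuous_on ?U X"
    unfolding s_def X_def by (intro continuous_intros)+
  have cu: "continuous_on ?U u"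
    unfolding u_def heat_kernel_def by (intro continuous_intros cs) (auto simp: sne)
  have dx1: "dird u (0, axis i 1) (ux i z) z" if "z \<in> ?U" for i z
    using has_real_derivative_heat_kernel_space[OF U[OF that], of "X z" i]
    by (simp add: dird_def u_def ux_def s_def X_def add_diff_eq diff_add_eq)
  have "(\<integral>z. (ut z - (\<Sum>i\<in>UNIV. uxx i z)) * (?\<theta> z * \<psi> z) \<partial>lborel) = - (\<integral>z. u z * c.heat_op z \<partial>lborel)"
  proof (rule c.weak_form(3))
    show "open ?U" by (intro open_Collect_less continuous_intros)
    show "S \<inter> {z. fst w + \<epsilon> \<le> fst z} \<subseteq> ?U" using \<epsilon> by auto
    show "continuous_on ?U u" by fact
    show "continuous_on ?U ut" unfolding ut_def by (intro continuous_intros cs cu) (auto simp: sne)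
    show "continuous_on ?U (uxx i)" for i unfolding uxx_def by (intro continuous_intros cs cu) (auto simp: sne)
    show "dird u (1, 0) (ut z) z" if "z \<in> ?U" for z
      using has_real_derivative_heat_kernel[OF U[OF that], of "X z"]
      by (simp add: dird_def u_def ut_def s_def X_def add_diff_eq diff_add_eq)
    show "dird u (0, axis i 1) (ux i z) z" if "z \<in> ?U" for z i using dx1 that .
    show "dird (ux i) (0, axis i 1) (uxx i z) z" if "z \<in> ?U" for z i
    proof -
      have "dird (\<lambda>z. - (X z $ i) / (2 * s z)) (0, axis i 1) (- 1 / (2 * s z)) z"
      proof -
        have eq: "(\<lambda>r. - (X (z + r *\<^sub>R (0, axis i 1)) $ i) / (2 * s (z + r *\<^sub>R (0, axis i 1))))
            = (\<lambda>r. - (X z $ i + r) / (2 * s z))"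
          by (simp add: fun_eq_iff X_def s_def axis_def algebra_simps)
        show ?thesis unfolding dird_def eq
          by (rule DERIV_cdivide) (auto intro!: derivative_eq_intros)
      qed
      from dird_mult[OF dx1[OF that] this]
      show ?thesis using U[OF that]
        by (simp add: ux_def[abs_def] uxx_def field_simps power2_eq_square)
    qed
  qed
  moreover have "ut z - (\<Sum>i\<in>UNIV. uxx i z) = 0" for z
  proof -
    have "(norm (X z))\<^sup>2 = (\<Sum>i\<in>UNIV. (X z $ i)\<^sup>2)"
      unfolding power2_norm_eq_inner by (simp add: inner_vec_def power2_eq_square)
    then show ?thesis
      by (simp add: ut_def uxx_def sum_distrib_left[symmetric] sum_subtractf sum_divide_distrib[symmetric])
  qed
  ultimately have "(\<integral>z. u z * c.heat_op z \<partial>lborel) = 0" by simp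
  \<comment> \<open>\<open>u\<close> and \<open>forward_kernel\<close> may differ at times up to
    that of the pole, but \<open>c.heat_op\<close> is 0 there.\<close>
  moreover have "u z * c.heat_op z = forward_kernel w z * (?\<theta> z * heat_op z + ?\<theta>' z * \<psi> z)" for z
  proof -
    have e: "c.heat_op z = ?\<theta> z * heat_op z + ?\<theta>' z * \<psi> z"
      unfolding c.heat_op_def heat_op_def by (simp add: distrib_left sum_distrib_left)
    show ?thesis
    proof (cases "fst w < fst z")
      case True then show ?thesis unfolding e by (simp add: forward_kernel_def u_def s_def X_def)
    next
      case False
      then have "c.heat_op z = 0" using \<epsilon> by (intro c.heat_op_zero) auto
      with False show ?thesis by (simp add: forward_kernel_def)
    qed
  qed
  ultimately show ?thesis by simp
qed

text \<open>Let the cutoff width tend to 0 in \<open>time_cutoff_weak_form\<close>. The term with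
  \<theta> tends to the left-hand side. The term with the derivative of \<theta> is a weighted mean,
  of total weight 1, of values \<open>H t\<close> at times just after the pole, where
  \<open>H t\<close> averages \<open>\<psi>\<close> over space with the heat kernel; so it tends to
  \<open>\<psi> w\<close>.\<close>

lemma integral_forward_kernel_heat_op: "(\<integral>z. forward_kernel w z * heat_op z \<partial>lborel) = - \<psi> w"
proof -
  obtain \<theta> \<theta>' :: "real \<Rightarrow> real" where \<theta>: "\<And>r. (\<theta> has_real_derivative \<theta>' r) (at r)" "continuous_on UNIV \<theta>'"
    "\<And>r. r \<le> 1 \<Longrightarrow> \<theta> r = 0" "\<And>r. r \<ge> 2 \<Longrightarrow> \<theta> r = 1" "\<And>r. \<bar>\<theta> r\<bar> \<le> 1"
    "\<And>r. r \<notin> {1..2} \<Longrightarrow> \<theta>' r = 0"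
    using C1_cutoff_exists by metis
  obtain M R where M: "M > 0" "\<And>z. \<bar>\<psi> z\<bar> \<le> M" and R: "\<And>z. z \<in> S \<Longrightarrow> norm z \<le> R"
    using support_bounds by metis
  note [measurable] = borel_psi borel_heat_op borel_measurable_continuous_onI[OF \<theta>(2)]
  have c\<theta>: "continuous_on UNIV \<theta>" using \<theta>(1) by (meson DERIV_isCont continuous_at_imp_continuous_on)
  note [measurable] = borel_measurable_continuous_onI[OF c\<theta>]
  have [measurable]: "(\<lambda>z :: real \<times> (real ^ 'n). fst z) \<in> borel_measurable borel"
    by (intro borel_measurable_continuous_onI continuous_intros)
  obtain M' where M': "\<And>r. \<bar>\<theta>' r\<bar> \<le> M'"
  proof -
    have "bounded (\<theta>' ` {1..2})"
      by (intro compact_imp_bounded compact_continuous_image continuous_on_subset[OF \<theta>(2)]) auto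
    then obtain M' where M': "M' > 0" "\<And>r. r \<in> {1..2} \<Longrightarrow> \<bar>\<theta>' r\<bar> \<le> M'" by (auto simp: bounded_pos)
    have "\<bar>\<theta>' r\<bar> \<le> M'" for r using M' \<theta>(6)[of r] by (cases "r \<in> {1..2}") auto
    then show ?thesis using that by blast
  qed
  have int\<theta>': "integrable lborel \<theta>'"
    by (rule integrable_compact_support[of "{1..2}"])
       (use continuous_on_subset[OF \<theta>(2)] \<theta>(6) in auto)
  have one: "(\<integral>r. \<theta>' r \<partial>lborel) = 1"
  proof -
    have "has_bochner_integral lborel (\<lambda>x. \<theta>' x * indicator {1..2} x) (\<theta> 2 - \<theta> 1)"
      using \<theta>(1) continuous_on_subset[OF \<theta>(2)]
      by (intro has_bochner_integral_FTC_Icc_real) (auto simp: continuous_on_eq_continuous_at \<theta>(2)[unfolded continuous_on_eq_continuous_at[OF open_UNIV]])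
    moreover have "(\<lambda>x. \<theta>' x * indicator {1..2} x) = \<theta>'" using \<theta>(6) by (force simp: fun_eq_iff indicator_def)
    ultimately show ?thesis using \<theta>(3)[of 1] \<theta>(4)[of 2] by (simp add: has_bochner_integral_integral_eq)
  qed
  define \<epsilon> where "\<epsilon> n = 1 / real (Suc n)" for n
  have \<epsilon>: "\<epsilon> n > 0" "\<epsilon> n \<le> 1" for n by (auto simp: \<epsilon>_def)
  have \<epsilon>0: "\<epsilon> \<longlonglongrightarrow> 0" unfolding \<epsilon>_def using LIMSEQ_inverse_real_of_nat by (simp add: inverse_eq_divide)
  define k where "k = forward_kernel w"
  define H where "H t = (\<integral>x. k (t, x) * \<psi> (t, x) \<partial>lborel)" for t
  define L where "L n = (\<integral>z. k z * heat_op z * \<theta> ((fst z - fst w) / \<epsilon> n) \<partial>lborel)" for n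
  define R where "R n = (\<integral>z. k z * (\<theta>' ((fst z - fst w) / \<epsilon> n) / \<epsilon> n * \<psi> z) \<partial>lborel)" for n
  have k[measurable]: "k \<in> borel_measurable borel" "k \<in> borel_measurable (lborel \<Otimes>\<^sub>M lborel)"
    unfolding k_def by (simp_all add: lborel_prod)
  have ik: "integrable lborel (\<lambda>z. k z * heat_op z)"
    unfolding k_def by (rule integrable_forward_kernel_heat_op)
  have iL: "integrable lborel (\<lambda>z. k z * heat_op z * \<theta> ((fst z - fst w) / \<epsilon> n))" for n
    by (rule Bochner_Integration.integrable_bound[OF ik])
       (auto simp: abs_mult \<theta>(5) intro!: mult_left_le)
  have iR: "integrable lborel (\<lambda>z. k z * (\<theta>' ((fst z - fst w) / \<epsilon> n) / \<epsilon> n * \<psi> z))" for n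
    unfolding k_def
  proof (rule integrable_forward_kernel_mult)
    show "\<bar>\<theta>' ((fst z - fst w) / \<epsilon> n) / \<epsilon> n * \<psi> z\<bar> \<le> M' / \<epsilon> n * M" for z
      using M' M \<epsilon>[of n] by (simp add: abs_mult) (meson abs_ge_zero divide_right_mono less_imp_le mult_mono' order_trans divide_nonneg_pos)
    show "\<theta>' ((fst z - fst w) / \<epsilon> n) / \<epsilon> n * \<psi> z = 0" if "\<bar>fst z\<bar> > \<bar>fst w\<bar> + 2" for z
    proof -
      have "(fst z - fst w) / \<epsilon> n \<notin> {1..2}"
        using that \<epsilon>[of n] by (auto simp: divide_le_eq le_divide_eq)
      then show ?thesis using \<theta>(6) by auto
    qed
  qed measurable
  have LR: "L n = - R n" for n
    using time_cutoff_weak_form[OF \<theta>(1,2,3) \<epsilon>(1)[of n], of w] iL[of n] iR[of n]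
    by (simp add: L_def R_def k_def distrib_left mult.assoc mult.left_commute[of _ "heat_op _"] mult.commute[of "heat_op _"])
  have "L \<longlonglongrightarrow> (\<integral>z. k z * heat_op z \<partial>lborel)"
    unfolding L_def
  proof (rule integral_dominated_convergence[where w = "\<lambda>z. \<bar>k z * heat_op z\<bar>"])
    show "AE z in lborel. (\<lambda>n. k z * heat_op z * \<theta> ((fst z - fst w) / \<epsilon> n)) \<longlonglongrightarrow> k z * heat_op z"
    proof (rule AE_I2)
      fix z
      show "(\<lambda>n. k z * heat_op z * \<theta> ((fst z - fst w) / \<epsilon> n)) \<longlonglongrightarrow> k z * heat_op z"
      proof (cases "fst w < fst z")
        case True
        have "eventually (\<lambda>n. \<epsilon> n < (fst z - fst w) / 2) sequentially"
          using order_tendstoD(2)[OF \<epsilon>0, of "(fst z - fst w) / 2"] True by simp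
        then have "eventually (\<lambda>n. k z * heat_op z * \<theta> ((fst z - fst w) / \<epsilon> n) = k z * heat_op z) sequentially"
          by eventually_elim (simp add: \<theta>(4) le_divide_eq \<epsilon>)
        then show ?thesis by (rule tendsto_eventually)
      qed (simp add: k_def forward_kernel_def)
    qed
    show "AE z in lborel. norm (k z * heat_op z * \<theta> ((fst z - fst w) / \<epsilon> n)) \<le> \<bar>k z * heat_op z\<bar>" for n
      by (auto simp: abs_mult \<theta>(5) intro!: mult_left_le)
  qed (use ik in auto)
  moreover have "R \<longlonglongrightarrow> \<psi> w"
  proof -
    \<comment> \<open>Substituting \<open>t = fst w + \<epsilon> n * r\<close> absorbs the factor
      \<open>1 / \<epsilon> n\<close> of the differentiated cutoff.\<close>
    have RH: "R n = (\<integral>r. \<theta>' r * H (fst w + \<epsilon> n * r) \<partial>lborel)" for n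
    proof -
      have "R n = (\<integral>t. \<integral>x. k (t, x) * (\<theta>' ((t - fst w) / \<epsilon> n) / \<epsilon> n * \<psi> (t, x)) \<partial>lborel \<partial>lborel)"
        unfolding R_def
        by (rule sym, rule lborel_pair.integral_fst'[of "\<lambda>z. k z * (\<theta>' ((fst z - fst w) / \<epsilon> n) / \<epsilon> n * \<psi> z)",
              unfolded lborel_prod fst_conv, OF iR])
      also have "\<dots> = (\<integral>t. \<theta>' ((t - fst w) / \<epsilon> n) / \<epsilon> n * H t \<partial>lborel)"
        unfolding H_def by (intro Bochner_Integration.integral_cong refl)
          (simp add: mult.left_commute integral_mult_right_zero[symmetric] del: integral_mult_right_zero)
      also have "\<dots> = (\<integral>r. \<theta>' r * H (fst w + \<epsilon> n * r) \<partial>lborel)"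
      proof -
        have "(\<integral>t. \<theta>' ((t - fst w) / \<epsilon> n) / \<epsilon> n * H t \<partial>lborel)
            = \<epsilon> n * (\<integral>r. (1 / \<epsilon> n) * (\<theta>' r * H (fst w + \<epsilon> n * r)) \<partial>lborel)"
          using \<epsilon>[of n] by (subst lborel_integral_real_affine[of "\<epsilon> n" _ "fst w"]) simp_all
        then show ?thesis using \<epsilon>[of n] by (simp only: integral_mult_right_zero) simp
      qed
      finally show ?thesis .
    qed
    have ik1: "integrable lborel (\<lambda>z. heat_kernel 1 (z :: real ^ 'n))"
      using integrable_heat_kernel(1)[of 1 0] by simp
    have Hsub: "H t = (\<integral>z. heat_kernel 1 z * \<psi> (t, snd w + sqrt (t - fst w) *\<^sub>R z) \<partial>lborel)" if "t > fst w" for t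
      using heat_kernel_substitution[of "t - fst w" "\<lambda>x. \<psi> (t, x)" "snd w"] that
      by (simp add: H_def k_def forward_kernel_def)
    have HM: "\<bar>H t\<bar> \<le> M" for t
    proof (cases "fst w < t")
      case True
      have "\<bar>H t\<bar> \<le> (\<integral>z. heat_kernel 1 (z :: real ^ 'n) * M \<partial>lborel)"
        unfolding Hsub[OF True] real_norm_def[symmetric]
      proof (rule order_trans[OF integral_norm_bound integral_mono])
        show b: "norm (heat_kernel 1 z * \<psi> (t, snd w + sqrt (t - fst w) *\<^sub>R z)) \<le> heat_kernel 1 z * M" for z
          using M(2) by (auto simp: abs_mult heat_kernel_nonneg intro!: mult_left_mono)
        show "integrable lborel (\<lambda>z. heat_kernel 1 (z :: real ^ 'n) * M)" using ik1 by simp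
        then show "integrable lborel (\<lambda>z. norm (heat_kernel 1 z * \<psi> (t, snd w + sqrt (t - fst w) *\<^sub>R z)))"
          by (rule Bochner_Integration.integrable_bound)
             (auto intro!: AE_I2 order_trans[OF b[unfolded real_norm_def] abs_ge_self])
      qed
      also have "\<dots> = M" using integrable_heat_kernel(2)[of 1 "0 :: real ^ 'n"] by simp
      finally show ?thesis .
    next
      case False
      then have "H t = 0" by (simp add: H_def k_def forward_kernel_def)
      then show ?thesis using M by simp
    qed
    have "(\<lambda>n. \<integral>r. \<theta>' r * H (fst w + \<epsilon> n * r) \<partial>lborel) \<longlonglongrightarrow> (\<integral>r. \<theta>' r * \<psi> w \<partial>lborel)"
    proof (rule integral_dominated_convergence[where w = "\<lambda>r. \<bar>\<theta>' r\<bar> * M"])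
      have [measurable]: "H \<in> borel_measurable borel"
      proof -
        have s: "sets (borel \<Otimes>\<^sub>M lborel) = sets (borel :: (real \<times> (real ^ 'n)) measure)"
          by (subst borel_prod[symmetric], rule sets_pair_measure_cong) simp_all
        have "(\<lambda>z. k z * \<psi> z) \<in> borel_measurable borel" by measurable
        then have "(\<lambda>z. k z * \<psi> z) \<in> borel_measurable (borel \<Otimes>\<^sub>M lborel)"
          using measurable_cong_sets[OF s refl] by blast
        then show ?thesis unfolding H_def by (intro lborel.borel_measurable_lebesgue_integral) (simp add: case_prod_unfold)
      qed
      show "(\<lambda>r. \<theta>' r * H (fst w + \<epsilon> n * r)) \<in> borel_measurable lborel" for n by measurable
      show "integrable lborel (\<lambda>r. \<bar>\<theta>' r\<bar> * M)" using int\<theta>' by auto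
      show "AE r in lborel. norm (\<theta>' r * H (fst w + \<epsilon> n * r)) \<le> \<bar>\<theta>' r\<bar> * M" for n
        by (auto simp: abs_mult HM intro!: mult_left_mono)
      show "AE r in lborel. (\<lambda>n. \<theta>' r * H (fst w + \<epsilon> n * r)) \<longlonglongrightarrow> \<theta>' r * \<psi> w"
      proof (rule AE_I2)
        fix r :: real
        show "(\<lambda>n. \<theta>' r * H (fst w + \<epsilon> n * r)) \<longlonglongrightarrow> \<theta>' r * \<psi> w"
        proof (cases "r \<in> {1..2}")
          case True
          have H: "H (fst w + \<epsilon> n * r) = (\<integral>z. heat_kernel 1 z * \<psi> (fst w + \<epsilon> n * r, snd w + sqrt (\<epsilon> n * r) *\<^sub>R z) \<partial>lborel)" for n
            using Hsub[of "fst w + \<epsilon> n * r"] True \<epsilon>[of n] by simp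
          have "(\<lambda>n. H (fst w + \<epsilon> n * r)) \<longlonglongrightarrow> (\<integral>z. heat_kernel 1 (z :: real ^ 'n) * \<psi> w \<partial>lborel)"
            unfolding H
          proof (rule integral_dominated_convergence[where w = "\<lambda>z :: real ^ 'n. heat_kernel 1 z * M"])
            show "AE z in lborel. (\<lambda>n. heat_kernel 1 z * \<psi> (fst w + \<epsilon> n * r, snd w + sqrt (\<epsilon> n * r) *\<^sub>R z)) \<longlonglongrightarrow> heat_kernel 1 z * \<psi> w"
            proof (rule AE_I2)
              fix z
              have "(\<lambda>n. (fst w + \<epsilon> n * r, snd w + sqrt (\<epsilon> n * r) *\<^sub>R z)) \<longlonglongrightarrow> (fst w + 0 * r, snd w + sqrt (0 * r) *\<^sub>R z)"
                by (intro tendsto_intros \<epsilon>0)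
              then show "(\<lambda>n. heat_kernel 1 z * \<psi> (fst w + \<epsilon> n * r, snd w + sqrt (\<epsilon> n * r) *\<^sub>R z)) \<longlonglongrightarrow> heat_kernel 1 z * \<psi> w"
                using continuous_on_tendsto_compose[OF cont(1), of _ w sequentially] by (intro tendsto_intros) simp
            qed
            show "AE z in lborel. norm (heat_kernel 1 z * \<psi> (fst w + \<epsilon> n * r, snd w + sqrt (\<epsilon> n * r) *\<^sub>R z)) \<le> heat_kernel 1 z * M" for n
              using M(2) by (auto simp: abs_mult heat_kernel_nonneg intro!: mult_left_mono)
          qed (use ik1 in auto)
          then show ?thesis using integrable_heat_kernel(2)[of 1 "0 :: real ^ 'n"] by (intro tendsto_intros) simp
        next
          case False then show ?thesis using \<theta>(6) by simp
        qed
      qed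
    qed (auto)
    then show ?thesis using one by (simp add: RH[abs_def])
  qed
  ultimately have "(\<integral>z. k z * heat_op z \<partial>lborel) = - \<psi> w"
    using LIMSEQ_unique[of L] tendsto_minus[of R] by (simp add: LR[abs_def])
  then show ?thesis by (simp add: k_def)
qed

end

section \<open>Weak form of mild solutions\<close>

context test_function
begin

text \<open>Fubini, with \<open>integral_forward_kernel_heat_op\<close> as inner integral. The
  source measure is general so that one lemma covers the initial datum, with
  \<open>v y = (0, y)\<close> on the space, and both Duhamel terms, with \<open>v\<close> the
  identity on space-time. Absolute integrability comes from the bound \<open>B\<close>, uniform on
  \<open>S\<close>, and the compact support of \<open>heat_op\<close>.\<close>

lemma adjoint_identity:
  fixes \<nu> :: "'b measure" and v :: "'b \<Rightarrow> real \<times> (real ^ 'n)" and f :: "'b \<Rightarrow> real"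
  assumes "sigma_finite_measure \<nu>"
    and [measurable]: "v \<in> borel_measurable \<nu>" "f \<in> borel_measurable \<nu>"
    and int: "\<And>z. z \<in> S \<Longrightarrow> integrable \<nu> (\<lambda>b. forward_kernel (v b) z * f b)"
    and bd: "\<And>z. z \<in> S \<Longrightarrow> (\<integral>b. forward_kernel (v b) z * \<bar>f b\<bar> \<partial>\<nu>) \<le> B"
  shows "integrable \<nu> (\<lambda>b. f b * \<psi> (v b))"
    and "integrable lborel (\<lambda>z. (\<integral>b. forward_kernel (v b) z * f b \<partial>\<nu>) * heat_op z)"
    and "(\<integral>z. (\<integral>b. forward_kernel (v b) z * f b \<partial>\<nu>) * heat_op z \<partial>lborel) = - (\<integral>b. f b * \<psi> (v b) \<partial>\<nu>)"
proof -
  interpret \<nu>: sigma_finite_measure \<nu> by fact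
  interpret P: pair_sigma_finite "lborel :: (real \<times> (real ^ 'n)) measure" \<nu> ..
  note [measurable] = borel_heat_op
  define g where "g = (\<lambda>(z, b). forward_kernel (v b) z * f b * heat_op z)"
  have gm [measurable]: "g \<in> borel_measurable (lborel \<Otimes>\<^sub>M \<nu>)"
    unfolding g_def by measurable
  have norm_g: "norm (g (z, b)) = forward_kernel (v b) z * \<bar>f b\<bar> * \<bar>heat_op z\<bar>" for z b
    by (simp add: g_def abs_mult forward_kernel_nonneg)
  have intg: "integrable (lborel \<Otimes>\<^sub>M \<nu>) g"
  proof (rule P.Fubini_integrable)
    show "AE z in lborel. integrable \<nu> (\<lambda>b. g (z, b))"
      using int heat_op_zero by (auto simp: g_def intro!: AE_I2)
    have "integrable lborel (\<lambda>z. B * heat_op z)"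
      using integrable_compact_support[OF compact_S continuous_on_subset[OF cont_heat_op] heat_op_zero]
      by auto
    then show "integrable lborel (\<lambda>z. \<integral>b. norm (g (z, b)) \<partial>\<nu>)"
    proof (rule Bochner_Integration.integrable_bound)
      show "AE z in lborel. norm (\<integral>b. norm (g (z, b)) \<partial>\<nu>) \<le> norm (B * heat_op z)"
      proof (rule AE_I2)
        fix z
        have eq: "(\<integral>b. norm (g (z, b)) \<partial>\<nu>) = (\<integral>b. forward_kernel (v b) z * \<bar>f b\<bar> \<partial>\<nu>) * \<bar>heat_op z\<bar>"
          unfolding norm_g by simp
        have nn: "(\<integral>b. forward_kernel (v b) z * \<bar>f b\<bar> \<partial>\<nu>) \<ge> 0"
          by (simp add: forward_kernel_nonneg)
        show "norm (\<integral>b. norm (g (z, b)) \<partial>\<nu>) \<le> norm (B * heat_op z)"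
        proof (cases "z \<in> S")
          case True
          with nn bd[of z] show ?thesis
            unfolding eq by (simp add: abs_mult) (intro mult_right_mono; simp)
        qed (simp add: g_def heat_op_zero)
      qed
    qed measurable
  qed measurable
  have 1: "(\<integral>z. g (z, b) \<partial>lborel) = - (f b * \<psi> (v b))" for b
  proof -
    have "(\<integral>z. g (z, b) \<partial>lborel) = (\<integral>z. f b * (forward_kernel (v b) z * heat_op z) \<partial>lborel)"
      by (simp add: g_def mult_ac)
    then show ?thesis by (simp add: integral_forward_kernel_heat_op)
  qed
  have 2: "(\<integral>b. g (z, b) \<partial>\<nu>) = (\<integral>b. forward_kernel (v b) z * f b \<partial>\<nu>) * heat_op z" for z
    by (simp add: g_def)
  have "integrable \<nu> (\<lambda>b. \<integral>z. g (z, b) \<partial>lborel)"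
    using P.integrable_snd[of "\<lambda>z b. g (z, b)"] intg by simp
  then show "integrable \<nu> (\<lambda>b. f b * \<psi> (v b))" unfolding 1 by simp
  show "integrable lborel (\<lambda>z. (\<integral>b. forward_kernel (v b) z * f b \<partial>\<nu>) * heat_op z)"
    using P.integrable_fst'[OF intg] unfolding 2 .
  show "(\<integral>z. (\<integral>b. forward_kernel (v b) z * f b \<partial>\<nu>) * heat_op z \<partial>lborel) = - (\<integral>b. f b * \<psi> (v b) \<partial>\<nu>)"
    using P.Fubini_integral[of "\<lambda>z b. g (z, b)"] intg unfolding 1 2 by simp
qed

end

section \<open>Duhamel terms as integrals over space-time\<close>

lemma forward_kernel_source_slice_mass: "(\<integral>\<^sup>+y. ennreal (forward_kernel (\<tau>, y) z) \<partial>lborel) \<le> 1"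
  using heat_kernel_mass[of "fst z - \<tau>" "snd z"]
  by (cases "\<tau> < fst z") (simp_all add: forward_kernel_def heat_kernel_minus_commute[of _ "snd z"])

text \<open>Integrating out the source position first costs a factor of at most 1 and leaves the
  integral of \<open>g\<close>. The majorant is only integrable in time because the forcing blows up
  at time 0 for \<sigma> < 0.\<close>

lemma forward_kernel_source_bound:
  fixes f :: "real \<times> (real ^ 'n) \<Rightarrow> real"
  assumes [measurable]: "f \<in> borel_measurable borel"
    and g: "integrable lborel g" "\<And>v. \<bar>f v\<bar> \<le> g (fst v)" "\<And>t. g t \<ge> 0"
  shows "integrable lborel (\<lambda>v. forward_kernel v z * f v)"
    and "(\<integral>v. forward_kernel v z * \<bar>f v\<bar> \<partial>lborel) \<le> (\<integral>t. g t \<partial>lborel)"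
proof -
  have [measurable]: "g \<in> borel_measurable borel" using g(1) by auto
  have "(\<integral>\<^sup>+v. ennreal (norm (forward_kernel v z * f v)) \<partial>lborel)
      = (\<integral>\<^sup>+t. \<integral>\<^sup>+y. ennreal (norm (forward_kernel (t, y) z * f (t, y))) \<partial>lborel \<partial>lborel)"
    unfolding lborel_prod[symmetric]
    by (rule lborel.nn_integral_fst[symmetric]) (simp add: lborel_prod)
  also have "\<dots> \<le> (\<integral>\<^sup>+t. ennreal (g t) \<partial>lborel)"
  proof (rule nn_integral_mono)
    fix t :: real
    have "(\<integral>\<^sup>+y. ennreal (norm (forward_kernel (t, y) z * f (t, y))) \<partial>lborel)
        \<le> (\<integral>\<^sup>+y. ennreal (g t) * ennreal (forward_kernel (t, y) z) \<partial>lborel)"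
    proof (rule nn_integral_mono)
      fix y
      show "ennreal (norm (forward_kernel (t, y) z * f (t, y))) \<le> ennreal (g t) * ennreal (forward_kernel (t, y) z)"
        using mult_right_mono[OF g(2)[of "(t, y)"] forward_kernel_nonneg[of "(t, y)" z]]
        by (simp add: ennreal_mult[symmetric] g(3) forward_kernel_nonneg abs_mult mult.commute ennreal_leI)
    qed
    also have "\<dots> = ennreal (g t) * (\<integral>\<^sup>+y. ennreal (forward_kernel (t, y) z) \<partial>lborel)"
      by (rule nn_integral_cmult) simp
    also have "\<dots> \<le> ennreal (g t) * 1"
      by (intro mult_left_mono forward_kernel_source_slice_mass) simp
    finally show "(\<integral>\<^sup>+y. ennreal (norm (forward_kernel (t, y) z * f (t, y))) \<partial>lborel) \<le> ennreal (g t)" by simp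
  qed
  also have "\<dots> = ennreal (\<integral>t. g t \<partial>lborel)"
    by (rule nn_integral_eq_integral[OF g(1)]) (simp add: g(3))
  finally have *: "(\<integral>\<^sup>+v. ennreal (norm (forward_kernel v z * f v)) \<partial>lborel) \<le> ennreal (\<integral>t. g t \<partial>lborel)" .
  show i: "integrable lborel (\<lambda>v. forward_kernel v z * f v)"
    by (rule integrableI_bounded) (use * in \<open>auto intro: le_less_trans\<close>)
  have "ennreal (\<integral>v. norm (forward_kernel v z * f v) \<partial>lborel) \<le> ennreal (\<integral>t. g t \<partial>lborel)"
    using * nn_integral_eq_integral[OF integrable_norm[OF i]] by simp
  then have "(\<integral>v. norm (forward_kernel v z * f v) \<partial>lborel) \<le> (\<integral>t. g t \<partial>lborel)"
    by (subst (asm) ennreal_le_iff) (simp_all add: g(3))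
  then show "(\<integral>v. forward_kernel v z * \<bar>f v\<bar> \<partial>lborel) \<le> (\<integral>t. g t \<partial>lborel)"
    by (simp add: abs_mult forward_kernel_nonneg)
qed

text \<open>Values at times \<open>t \<le> 0\<close> are arbitrary, so they are replaced by 0 before
  integrating over space-time; this also encodes the lower limit of the Duhamel integral.\<close>

definition positive_time :: "(real \<Rightarrow> real ^ 'n \<Rightarrow> real) \<Rightarrow> real \<times> (real ^ 'n) \<Rightarrow> real" where
  "positive_time f v = (if 0 < fst v then f (fst v) (snd v) else 0)"

lemma forward_kernel_positive_time_slice:
  "(\<integral>y. forward_kernel (\<tau>, y) (t, x) * positive_time f (\<tau>, y) \<partial>lborel) =
    (if \<tau> \<in> {0<..<t} then heat_semigroup (t - \<tau>) (f \<tau>) x else 0)"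
  by (auto simp: forward_kernel_def positive_time_def heat_semigroup_def)

text \<open>The Duhamel integral runs over a closed interval, at whose right end
  \<open>heat_semigroup\<close> has its separate value for time 0, whereas the kernel cuts out the
  open interval. Only the two endpoints differ.\<close>

lemma AE_indicator_Icc_Ioo:
  "AE \<tau> in lborel. (if \<tau> \<in> {0<..<t} then h \<tau> else 0) = indicator {0..t} \<tau> *\<^sub>R (h \<tau> :: real)"
  for t :: real
  using AE_lborel_singleton[of 0] AE_lborel_singleton[of t]
  by eventually_elim (auto simp: indicator_def)

lemma duhamel_eq_forward_kernel:
  assumes "integrable lborel (\<lambda>v. forward_kernel v (t, x) * positive_time f v)"
    and "positive_time f \<in> borel_measurable borel" and conv: "duhamel_convergent t f x"
  shows "duhamel t f x = (\<integral>v. forward_kernel v (t, x) * positive_time f v \<partial>lborel)"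
proof -
  note [measurable] = assms(2)
  define F where "F \<tau> = (\<integral>y. forward_kernel (\<tau>, y) (t, x) * positive_time f (\<tau>, y) \<partial>lborel)" for \<tau>
  have "(\<integral>v. forward_kernel v (t, x) * positive_time f v \<partial>lborel) = (\<integral>\<tau>. F \<tau> \<partial>lborel)"
    unfolding F_def
    by (rule sym, rule lborel_pair.integral_fst'[of "\<lambda>v. forward_kernel v (t, x) * positive_time f v",
        unfolded lborel_prod, OF assms(1)])
  also have "\<dots> = duhamel t f x"
    unfolding duhamel_def set_lebesgue_integral_def
  proof (rule integral_cong_AE)
    show "F \<in> borel_measurable lborel"
      using borel_measurable_integrable[OF lborel_pair.integrable_fst'[of "\<lambda>v. forward_kernel v (t, x) * positive_time f v",
            unfolded lborel_prod, OF assms(1)]]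
      by (simp add: F_def[abs_def])
    show "(\<lambda>\<tau>. indicator {0..t} \<tau> *\<^sub>R heat_semigroup (t - \<tau>) (f \<tau>) x) \<in> borel_measurable lborel"
      using conv by (auto simp: duhamel_convergent_def set_integrable_def)
    show "AE \<tau> in lborel. F \<tau> = indicator {0..t} \<tau> *\<^sub>R heat_semigroup (t - \<tau>) (f \<tau>) x"
      unfolding F_def forward_kernel_positive_time_slice by (rule AE_indicator_Icc_Ioo)
  qed
  finally show ?thesis ..
qed

text \<open>\<open>duhamel_convergent\<close> speaks of iterated integrals. For a nonnegative
  integrand the inner integral is that of the norm, so iterated convergence is already joint
  integrability.\<close>

lemma duhamel_convergent_imp_integrable:
  assumes [measurable]: "positive_time f \<in> borel_measurable borel" and conv: "duhamel_convergent t f x"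
    and nonneg: "\<And>\<tau> y. f \<tau> y \<ge> 0"
  shows "integrable lborel (\<lambda>v. forward_kernel v (t, x) * positive_time f v)"
proof -
  let ?g = "\<lambda>v. forward_kernel v (t, x) * positive_time f v"
  have "integrable (lborel \<Otimes>\<^sub>M lborel) ?g"
  proof (rule lborel_pair.Fubini_integrable)
    show "?g \<in> borel_measurable (lborel \<Otimes>\<^sub>M lborel)" unfolding lborel_prod by measurable
    have "norm (?g (\<tau>, y)) = ?g (\<tau>, y)" for \<tau> y
      using nonneg by (simp add: forward_kernel_nonneg positive_time_def)
    then have eq: "(\<integral>y. norm (?g (\<tau>, y)) \<partial>lborel) = (if \<tau> \<in> {0<..<t} then heat_semigroup (t - \<tau>) (f \<tau>) x else 0)" for \<tau>
      using forward_kernel_positive_time_slice[of \<tau> t x f] by simp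
    have m: "(\<lambda>\<tau>. \<integral>y. norm (?g (\<tau>, y)) \<partial>lborel) \<in> borel_measurable lborel"
    proof (rule lborel.borel_measurable_lebesgue_integral)
      have "(\<lambda>v. norm (?g v)) \<in> borel_measurable (lborel \<Otimes>\<^sub>M lborel)" unfolding lborel_prod by measurable
      then show "(\<lambda>(\<tau>, y). norm (?g (\<tau>, y))) \<in> borel_measurable (lborel \<Otimes>\<^sub>M lborel)"
        by (simp add: case_prod_unfold)
    qed
    have "integrable lborel (\<lambda>\<tau>. indicator {0..t} \<tau> *\<^sub>R heat_semigroup (t - \<tau>) (f \<tau>) x)"
      using conv by (auto simp: duhamel_convergent_def set_integrable_def)
    then show "integrable lborel (\<lambda>\<tau>. \<integral>y. norm (?g (\<tau>, y)) \<partial>lborel)"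
      using m AE_indicator_Icc_Ioo[of t "\<lambda>\<tau>. heat_semigroup (t - \<tau>) (f \<tau>) x"] unfolding eq
      by (subst integrable_cong_AE[where g = "\<lambda>\<tau>. indicator {0..t} \<tau> *\<^sub>R heat_semigroup (t - \<tau>) (f \<tau>) x"]) auto
    have "AE \<tau> in lborel. \<tau> \<in> {0<..<t} \<longrightarrow> heat_convergent (t - \<tau>) (f \<tau>) x"
      using conv by (simp add: duhamel_convergent_def)
    then show "AE \<tau> in lborel. integrable lborel (\<lambda>y. ?g (\<tau>, y))"
    proof eventually_elim
      case (elim \<tau>)
      show ?case
      proof (cases "\<tau> \<in> {0<..<t}")
        case True
        then show ?thesis using elim by (simp add: heat_convergent_def forward_kernel_def positive_time_def)
      next
        case False
        then have "(\<lambda>y. ?g (\<tau>, y)) = (\<lambda>y. 0)" by (auto simp: forward_kernel_def positive_time_def)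
        then show ?thesis by simp
      qed
    qed
  qed
  then show ?thesis by (simp add: lborel_prod)
qed

text \<open>\<open>\<sigma> > -1\<close> makes the power integrable at 0, and
  \<open>m \<le> 0\<close> bounds \<open>zeta\<close> by 1 from time 1 on.\<close>

lemma integrable_zeta_Ioo:
  assumes "\<sigma> > -1" "m \<le> 0"
  shows "integrable lborel (\<lambda>t. if t \<in> {0<..<T} then zeta \<sigma> m t else 0)"
proof -
  have "(\<lambda>x. x powr \<sigma>) absolutely_integrable_on {0..1}"
    using integrable_on_powr_from_0[of \<sigma> 1] assms by (intro nonnegative_absolutely_integrable_1) auto
  then have "integrable lebesgue (\<lambda>x. indicator {0..1} x *\<^sub>R (x powr \<sigma>))"
    by (simp add: set_integrable_def)
  then have 1: "integrable lborel (\<lambda>x::real. indicator {0..1} x *\<^sub>R (x powr \<sigma>))"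
    by (subst (asm) integrable_completion) auto
  have 2: "integrable lborel (\<lambda>x::real. indicator {0..T} x :: real)"
    by (intro integrable_real_indicator) (auto simp: emeasure_lborel_Icc_eq)
  have [measurable]: "zeta \<sigma> m \<in> borel_measurable borel" unfolding zeta_def by measurable
  show ?thesis
  proof (rule Bochner_Integration.integrable_bound[OF Bochner_Integration.integrable_add[OF 1 2]])
    show "AE t in lborel. norm (if t \<in> {0<..<T} then zeta \<sigma> m t else 0)
        \<le> norm (indicator {0..1} t *\<^sub>R t powr \<sigma> + indicator {0..T} t)"
    proof (rule AE_I2)
      fix t :: real
      have "t powr m \<le> 1" if "t \<ge> 1" using that assms powr_mono[of m 0 t] by simp
      then show "norm (if t \<in> {0<..<T} then zeta \<sigma> m t else 0)
        \<le> norm (indicator {0..1} t *\<^sub>R t powr \<sigma> + indicator {0..T} t)"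
        by (auto simp: zeta_def indicator_def)
    qed
  qed measurable
qed

lemma zeta_nonneg: "zeta \<sigma> m t \<ge> 0"
  by (simp add: zeta_def)

lemma C0_space_bounded:
  fixes w :: "real ^ 'n \<Rightarrow> real"
  assumes "w \<in> C0_space"
  obtains W where "W > 0" "\<And>x. \<bar>w x\<bar> \<le> W"
proof -
  have c: "continuous_on UNIV w" and l: "(w \<longlongrightarrow> 0) at_infinity" using assms by (auto simp: C0_space_def)
  obtain b where b: "\<And>x. norm x \<ge> b \<Longrightarrow> \<bar>w x\<bar> < 1"
    using tendstoD[OF l, of 1] by (auto simp: eventually_at_infinity)
  have "bounded (w ` cball 0 b)"
    by (intro compact_imp_bounded compact_continuous_image continuous_on_subset[OF c]) auto
  then obtain W where W: "W > 0" "\<And>x. x \<in> cball 0 b \<Longrightarrow> \<bar>w x\<bar> \<le> W" by (auto simp: bounded_pos)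
  have "\<bar>w x\<bar> \<le> max W 1" for x
    using W(2)[of x] b[of x] by (cases "norm x \<le> b") (auto simp: le_max_iff_disj)
  then show ?thesis using that[of "max W 1"] by simp
qed

context test_function
begin

text \<open>On \<open>S\<close> the solution is the sum of \<open>A\<close>, \<open>N\<close> and
  \<open>Z\<close>, the parts due to the initial datum, the nonlinearity and the forcing, each an
  integral of \<open>forward_kernel\<close> against a source. For each of them
  \<open>adjoint_identity\<close> turns the pairing with \<open>heat_op\<close> into a pairing of
  the source with \<open>- \<psi>\<close>.\<close>

lemma mild_solution_weak_form:
  fixes u :: "real \<Rightarrow> real ^ 'n \<Rightarrow> real"
  assumes S: "\<And>z. z \<in> S \<Longrightarrow> fst z > 0"
    and par: "\<sigma> > -1" "m \<le> 0" and w: "w \<in> C0_space"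
    and u0: "u0 \<in> CB_space UNIV" and u: "\<And>T. T > 0 \<Longrightarrow> (\<lambda>(t, x). u t x) \<in> CB_space ({0..T} \<times> UNIV)"
    and mild: "mild_solution \<alpha> p (zeta \<sigma> m) w u0 u"
  shows "integrable lborel (\<lambda>(t, x). nonlinearity \<alpha> p (u t) x * \<psi> (t, x))" (is ?A)
    and "integrable lborel (\<lambda>(t, x). u t x * heat_op (t, x))" (is ?B)
    and "(\<integral>(t, x). nonlinearity \<alpha> p (u t) x * \<psi> (t, x) \<partial>lborel) + (\<integral>(t, x). zeta \<sigma> m t * w x * \<psi> (t, x) \<partial>lborel)
      = - (\<integral>(t, x). u t x * heat_op (t, x) \<partial>lborel)" (is ?D)
proof -
  obtain R where R: "R > 0" "\<And>z. z \<in> S \<Longrightarrow> norm z \<le> R" using support_bounds by metis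
  have SR: "fst z \<in> {0<..R}" if "z \<in> S" for z
    using S[OF that] R(2)[OF that] norm_fst_le[of "fst z" "snd z"] by simp
  obtain W where W: "W > 0" "\<And>x. \<bar>w x\<bar> \<le> W" using C0_space_bounded[OF w] by blast
  obtain M0 where M0: "\<And>x. \<bar>u0 x\<bar> \<le> M0" using u0 by (auto simp: CB_space_def bounded_iff)
  obtain M where M: "\<forall>t\<in>{0..R}. \<forall>x. \<bar>u t x\<bar> \<le> M"
    using u[OF R(1)] by (auto simp: CB_space_def bounded_iff)
  have cu: "continuous_on ({0<..} \<times> UNIV) (\<lambda>z. u (fst z) (snd z))"
  proof (intro continuous_at_imp_continuous_on ballI)
    fix z :: "real \<times> (real ^ 'n)" assume z: "z \<in> {0<..} \<times> UNIV"
    let ?T = "fst z + 1"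
    have "continuous_on ({0<..<?T} \<times> UNIV) (\<lambda>z. u (fst z) (snd z))"
      using u[of ?T] z by (auto simp: CB_space_def case_prod_unfold intro: continuous_on_subset)
    then show "isCont (\<lambda>z. u (fst z) (snd z)) z"
      using z by (subst (asm) continuous_on_eq_continuous_at) (cases z, auto simp: open_Times)
  qed
  have op: "open ({0 :: real<..} \<times> (UNIV :: (real ^ 'n) set))" by (intro open_Times) auto
  have fm [measurable]: "(\<lambda>z :: real \<times> (real ^ 'n). fst z) \<in> borel_measurable borel"
    "(\<lambda>z :: real \<times> (real ^ 'n). snd z) \<in> borel_measurable borel"
    by (intro borel_measurable_continuous_onI continuous_intros)+
  have um [measurable]: "positive_time u \<in> borel_measurable borel"
  proof -
    have "positive_time u = (\<lambda>z. indicator ({0<..} \<times> UNIV) z *\<^sub>R u (fst z) (snd z))"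
      by (auto simp: positive_time_def indicator_def fun_eq_iff mem_Times_iff)
    then show ?thesis
      using borel_measurable_continuous_on_indicator[OF _ cu] borel_open[OF op] by simp
  qed
  let ?N = "\<lambda>\<tau>. nonlinearity \<alpha> p (u \<tau>)" and ?Z = "\<lambda>\<tau> y. zeta \<sigma> m \<tau> * w y"
  have wm [measurable]: "w \<in> borel_measurable borel" and u0m [measurable]: "u0 \<in> borel_measurable borel"
    using w u0 by (auto simp: C0_space_def CB_space_def intro: borel_measurable_continuous_onI)
  have [measurable]: "zeta \<sigma> m \<in> borel_measurable borel" unfolding zeta_def by measurable
  have Nm [measurable]: "positive_time ?N \<in> borel_measurable borel"
  proof -
    have "positive_time ?N = (\<lambda>z. if 0 < fst z then norm (snd z) powr \<alpha> * \<bar>positive_time u z\<bar> powr p else 0)"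
      by (auto simp: positive_time_def nonlinearity_def)
    also have "\<dots> \<in> borel_measurable borel" by measurable
    finally show ?thesis .
  qed
  have Zm [measurable]: "positive_time ?Z \<in> borel_measurable borel"
    unfolding positive_time_def by measurable
  define g where "g t = W * (if t \<in> {0<..<R} then zeta \<sigma> m t else 0)" for t
  have g: "integrable lborel g" "g t \<ge> 0" for t
    unfolding g_def using integrable_zeta_Ioo[OF par, of R] W by (auto simp: zeta_nonneg)
  \<comment> \<open>For \<open>z\<close> in \<open>S\<close> the kernel sees only sources earlier
    than \<open>fst z \<le> R\<close>, so the forcing may be cut at time \<open>R\<close>; this
    makes the majorant \<open>g\<close> integrable.\<close>
  define Z' where "Z' v = (if fst v < R then positive_time ?Z v else 0)" for v
  have [measurable]: "Z' \<in> borel_measurable borel" unfolding Z'_def by measurable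
  have Z'g: "\<bar>Z' v\<bar> \<le> g (fst v)" for v
    using W by (auto simp: Z'_def positive_time_def g_def abs_mult zeta_nonneg mult.commute[of W] intro!: mult_left_mono)
  have kZ: "forward_kernel v z * positive_time ?Z v = forward_kernel v z * Z' v"
    if "z \<in> S" for v z
    using SR[OF that] by (auto simp: forward_kernel_def Z'_def)
  have Zi: "integrable lborel (\<lambda>v. forward_kernel v z * positive_time ?Z v)" if "z \<in> S" for z
    unfolding kZ[OF that] by (rule forward_kernel_source_bound(1)[OF _ g(1) Z'g g(2)]) measurable
  have Zb: "(\<integral>v. forward_kernel v z * \<bar>positive_time ?Z v\<bar> \<partial>lborel) \<le> (\<integral>t. g t \<partial>lborel)" if "z \<in> S" for z
  proof -
    have *: "forward_kernel v z * \<bar>positive_time ?Z v\<bar> = forward_kernel v z * \<bar>Z' v\<bar>" for v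
      using SR[OF that] by (auto simp: forward_kernel_def Z'_def)
    show ?thesis unfolding * by (rule forward_kernel_source_bound(2)[OF _ g(1) Z'g g(2)]) measurable
  qed
  have mild': "heat_convergent (fst z) u0 (snd z)" "duhamel_convergent (fst z) ?N (snd z)"
      "duhamel_convergent (fst z) ?Z (snd z)"
      "u (fst z) (snd z) = heat_semigroup (fst z) u0 (snd z) + duhamel (fst z) ?N (snd z) + duhamel (fst z) ?Z (snd z)"
    if "z \<in> S" for z
    using mild S[OF that] unfolding mild_solution_def by (auto simp: less_imp_le)
  define A where "A z = (\<integral>y. forward_kernel (0, y) z * u0 y \<partial>lborel)" for z
  define N where "N z = (\<integral>v. forward_kernel v z * positive_time ?N v \<partial>lborel)" for z
  define Z where "Z z = (\<integral>v. forward_kernel v z * positive_time ?Z v \<partial>lborel)" for z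
  have Ni: "integrable lborel (\<lambda>v. forward_kernel v z * positive_time ?N v)" if "z \<in> S" for z
    using duhamel_convergent_imp_integrable[OF Nm mild'(2)[OF that]] by (simp add: nonlinearity_def)
  have dec: "u (fst z) (snd z) = A z + N z + Z z" if "z \<in> S" for z
  proof -
    have "A z = heat_semigroup (fst z) u0 (snd z)"
      using S[OF that] by (simp add: A_def forward_kernel_def heat_semigroup_def)
    moreover have "N z = duhamel (fst z) ?N (snd z)"
      unfolding N_def using duhamel_eq_forward_kernel[OF _ Nm mild'(2)[OF that]] Ni[OF that] by simp
    moreover have "Z z = duhamel (fst z) ?Z (snd z)"
      unfolding Z_def using duhamel_eq_forward_kernel[OF _ Zm mild'(3)[OF that]] Zi[OF that] by simp
    ultimately show ?thesis using mild'(4)[OF that] by simp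
  qed
  have Ai: "integrable lborel (\<lambda>y. forward_kernel (0, y) z * u0 y)" if "z \<in> S" for z
    using mild'(1)[OF that] S[OF that] by (simp add: heat_convergent_def forward_kernel_def)
  have Ab: "(\<integral>y. forward_kernel (0, y) z * \<bar>u0 y\<bar> \<partial>lborel) \<le> M0" if "z \<in> S" for z
  proof -
    have ik: "integrable lborel (\<lambda>y. forward_kernel (0, y) z)" "(\<integral>y. forward_kernel (0, y) z \<partial>lborel) = 1"
      using integrable_heat_kernel[OF S[OF that], of "snd z"] S[OF that]
      by (simp_all add: forward_kernel_def heat_kernel_minus_commute[of _ "snd z"])
    have "(\<integral>y. forward_kernel (0, y) z * \<bar>u0 y\<bar> \<partial>lborel) \<le> (\<integral>y. forward_kernel (0, y) z * M0 \<partial>lborel)"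
    proof (rule integral_mono)
      show "integrable lborel (\<lambda>y. forward_kernel (0, y) z * \<bar>u0 y\<bar>)"
        using integrable_norm[OF Ai[OF that]] by (simp add: abs_mult forward_kernel_nonneg)
    qed (use ik M0 in \<open>auto intro!: mult_left_mono forward_kernel_nonneg\<close>)
    then show ?thesis using ik by simp
  qed
  \<comment> \<open>\<open>M\<close> bounds \<open>u\<close> up to time \<open>R\<close>,
    \<open>M0\<close> the part of the initial datum, and the integral of \<open>g\<close> that of
    the forcing.\<close>
  have Nb: "(\<integral>v. forward_kernel v z * \<bar>positive_time ?N v\<bar> \<partial>lborel) \<le> M + M0 + (\<integral>t. g t \<partial>lborel)" if "z \<in> S" for z
  proof -
    have "\<bar>A z\<bar> \<le> (\<integral>y. forward_kernel (0, y) z * \<bar>u0 y\<bar> \<partial>lborel)"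
      using integral_norm_bound[of lborel "\<lambda>y. forward_kernel (0, y) z * u0 y"]
      by (simp add: A_def abs_mult forward_kernel_nonneg)
    moreover have "\<bar>Z z\<bar> \<le> (\<integral>v. forward_kernel v z * \<bar>positive_time ?Z v\<bar> \<partial>lborel)"
      using integral_norm_bound[of lborel "\<lambda>v. forward_kernel v z * positive_time ?Z v"]
      by (simp add: Z_def abs_mult forward_kernel_nonneg)
    moreover have "\<bar>u (fst z) (snd z)\<bar> \<le> M" using M SR[OF that] by auto
    moreover have "(\<integral>v. forward_kernel v z * \<bar>positive_time ?N v\<bar> \<partial>lborel) = N z"
      unfolding N_def by (intro Bochner_Integration.integral_cong) (auto simp: positive_time_def nonlinearity_def)
    ultimately show ?thesis using dec[OF that] Ab[OF that] Zb[OF that] by linarith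
  qed
  \<comment> \<open>Up to sign, the initial part contributes the integral of
    \<open>u0 y * \<psi> (0, y)\<close>, which therefore drops out.\<close>
  have \<psi>0: "\<psi> (0, y) = 0" for y using S[of "(0, y)"] zero by force
  note adj = adjoint_identity[OF sigma_finite_lborel]
  have vm: "(\<lambda>y :: real ^ 'n. (0 :: real, y)) \<in> borel_measurable lborel"
    unfolding measurable_lborel2 by (intro borel_measurable_continuous_onI continuous_intros)
  have vm': "(\<lambda>v :: real \<times> (real ^ 'n). v) \<in> borel_measurable lborel" by simp
  have u0m': "u0 \<in> borel_measurable lborel" and Nm': "positive_time ?N \<in> borel_measurable lborel"
    and Zm': "positive_time ?Z \<in> borel_measurable lborel" by simp_all
  note adjA = adj[OF vm u0m' Ai Ab, folded A_def, simplified \<psi>0, simplified]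
  note adjN = adj[OF vm' Nm' Ni Nb, folded N_def]
  note adjZ = adj[OF vm' Zm' Zi Zb, folded Z_def]
  have pt: "positive_time f v * \<psi> v = (case v of (t, x) \<Rightarrow> f t x * \<psi> (t, x))" for f v
  proof (cases "v \<in> S")
    case True then show ?thesis using S[of v] by (cases v) (auto simp: positive_time_def)
  next
    case False then show ?thesis by (cases v) (simp add: zero)
  qed
  have ue: "(case z of (t, x) \<Rightarrow> u t x * heat_op (t, x)) = A z * heat_op z + N z * heat_op z + Z z * heat_op z" for z
  proof (cases "z \<in> S")
    case True
    then show ?thesis using dec[OF True] by (cases z) (simp add: algebra_simps)
  next
    case False then show ?thesis by (cases z) (simp add: heat_op_zero)
  qed
  show ?A using adjN(1) unfolding pt .

  show ?B unfolding ue using adjA adjN(2) adjZ(2) by simp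
  show ?D unfolding ue using adjA adjN adjZ unfolding pt by simp
qed

end

section \<open>Weak form of global solutions\<close>

context test_function
begin

text \<open>At positive times the sum of the two powers is a continuous majorant of
  \<open>zeta\<close>, and \<open>S\<close> is a compact set of such times.\<close>

lemma integrable_zeta_mult:
  assumes S: "\<And>z. z \<in> S \<Longrightarrow> fst z > 0" and w: "continuous_on UNIV w"
  shows "integrable lborel (\<lambda>(t, x). zeta \<sigma> m t * w x * \<psi> (t, x))"
proof -
  have fm [measurable]: "(\<lambda>z :: real \<times> (real ^ 'n). fst z) \<in> borel_measurable borel"
    "(\<lambda>z :: real \<times> (real ^ 'n). snd z) \<in> borel_measurable borel"
    by (intro borel_measurable_continuous_onI continuous_intros)+
  have [measurable]: "zeta \<sigma> m \<in> borel_measurable borel" unfolding zeta_def by measurable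
  note [measurable] = borel_measurable_continuous_onI[OF w] borel_psi
  let ?g = "\<lambda>z. (fst z powr \<sigma> + fst z powr m) * w (snd z) * \<psi> z"
  have "integrable lborel ?g"
  proof (rule integrable_compact_support[OF compact_S])
    show "continuous_on S ?g"
      using S by (intro continuous_intros continuous_on_compose2[OF w] continuous_on_subset[OF cont(1)]) force+
  qed (simp add: zero)
  then show ?thesis
    unfolding case_prod_unfold
  proof (rule Bochner_Integration.integrable_bound)
    show "AE z in lborel. norm (zeta \<sigma> m (fst z) * w (snd z) * \<psi> (fst z, snd z)) \<le> norm (?g z)"
    proof (rule AE_I2)
      fix z :: "real \<times> (real ^ 'n)"
      have "\<bar>zeta \<sigma> m (fst z)\<bar> \<le> \<bar>fst z powr \<sigma> + fst z powr m\<bar>" by (simp add: zeta_def)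
      from mult_right_mono[OF mult_right_mono[OF this abs_ge_zero] abs_ge_zero]
      show "norm (zeta \<sigma> m (fst z) * w (snd z) * \<psi> (fst z, snd z)) \<le> norm (?g z)"
        by (simp add: abs_mult)
    qed
  qed (simp, measurable)
qed

lemma classical_solution_weak_form:
  assumes S: "\<And>z. z \<in> S \<Longrightarrow> fst z > 0" and w: "continuous_on UNIV w"
    and sol: "classical_solution \<alpha> p (zeta \<sigma> m) w u0 u"
  shows "integrable lborel (\<lambda>(t, x). nonlinearity \<alpha> p (u t) x * \<psi> (t, x))" (is ?A)
    and "integrable lborel (\<lambda>(t, x). u t x * heat_op (t, x))" (is ?B)
    and "(\<integral>(t, x). nonlinearity \<alpha> p (u t) x * \<psi> (t, x) \<partial>lborel) + (\<integral>(t, x). zeta \<sigma> m t * w x * \<psi> (t, x) \<partial>lborel)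
      = - (\<integral>(t, x). u t x * heat_op (t, x) \<partial>lborel)" (is ?D)
proof -
  from sol[unfolded classical_solution_def] obtain ut ux uxx
    where c0: "continuous_on ({0..} \<times> UNIV) (\<lambda>(t, x). u t x)"
    and d0: "\<forall>t>0. \<forall>x. ((\<lambda>s. u s x) has_real_derivative ut t x) (at t) \<and>
           (\<forall>j. has_partial_derivative (u t) j (ux j t x) x) \<and>
           (\<forall>i j. has_partial_derivative (ux j t) i (uxx i j t x) x)"
    and c: "continuous_on ({0<..} \<times> UNIV) (\<lambda>(t, x). ut t x)"
      "\<And>i j. continuous_on ({0<..} \<times> UNIV) (\<lambda>(t, x). uxx i j t x)"
    and pde: "\<And>t x. t > 0 \<Longrightarrow> ut t x - (\<Sum>i\<in>UNIV. uxx i i t x) = nonlinearity \<alpha> p (u t) x + zeta \<sigma> m t * w x"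
    by (elim conjE exE) blast
  have d: "((\<lambda>s. u s x) has_real_derivative ut t x) (at t)"
      "has_partial_derivative (u t) j (ux j t x) x"
      "has_partial_derivative (ux j t) i (uxx i j t x) x" if "t > 0" for t x i j
    using d0 that by blast+
  let ?U = "{0 :: real<..} \<times> (UNIV :: (real ^ 'n) set)"
  have U: "open ?U" by (intro open_Times) auto
  have SU: "S \<subseteq> ?U" using S by (auto simp: mem_Times_iff)
  have c0': "continuous_on ?U (\<lambda>z. u (fst z) (snd z))"
    by (rule continuous_on_subset[OF c0[unfolded case_prod_unfold]]) auto
  have dt: "dird (\<lambda>z. u (fst z) (snd z)) (1, 0) (ut (fst z) (snd z)) z" if "z \<in> ?U" for z
    using DERIV_shift[of "\<lambda>s. u s (snd z)" "ut (fst z) (snd z)" 0 "fst z"] d(1)[of "fst z" "snd z"] that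
    by (simp add: dird_def mem_Times_iff add.commute)
  have dx: "dird (\<lambda>z. u (fst z) (snd z)) (0, axis i 1) (ux i (fst z) (snd z)) z" if "z \<in> ?U" for i z
    using d(2)[of "fst z"] that by (simp add: dird_def has_partial_derivative_def mem_Times_iff)
  have dxx: "dird (\<lambda>z. ux i (fst z) (snd z)) (0, axis i 1) (uxx i i (fst z) (snd z)) z" if "z \<in> ?U" for i z
    using d(3)[of "fst z"] that by (simp add: dird_def has_partial_derivative_def mem_Times_iff)
  note wf = weak_form[OF U SU c0' c[unfolded case_prod_unfold] dt dx dxx]
  have eq: "(ut (fst z) (snd z) - (\<Sum>i\<in>UNIV. uxx i i (fst z) (snd z))) * \<psi> z =
      nonlinearity \<alpha> p (u (fst z)) (snd z) * \<psi> z + zeta \<sigma> m (fst z) * w (snd z) * \<psi> z" for z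
  proof (cases "z \<in> S")
    case True then show ?thesis using pde[OF S[OF True]] by (simp add: distrib_right)
  qed (simp add: zero)
  have i2: "integrable lborel (\<lambda>z. zeta \<sigma> m (fst z) * w (snd z) * \<psi> z)"
    using integrable_zeta_mult[OF S w] by (simp add: case_prod_unfold)
  \<comment> \<open>The equation writes the tested nonlinearity as a difference of two integrable
    functions, so the power of \<open>norm x\<close> needs no estimate of its own.\<close>
  have i1: "integrable lborel (\<lambda>z. nonlinearity \<alpha> p (u (fst z)) (snd z) * \<psi> z)"
    using Bochner_Integration.integrable_diff[OF wf(1) i2] unfolding eq by simp
  show ?A using i1 by (simp add: case_prod_unfold)
  show ?B using wf(2) by (simp add: case_prod_unfold)
  show ?D using wf(3) i1 i2 unfolding eq by (simp add: case_prod_unfold)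
qed

lemma global_solution_weak_form:
  assumes S: "\<And>z. z \<in> S \<Longrightarrow> fst z > 0" and "\<sigma> > -1" "m \<le> 0" and w: "w \<in> C0_space"
    and sol: "global_solution \<alpha> p (zeta \<sigma> m) w u0 u"
  shows "integrable lborel (\<lambda>(t, x). nonlinearity \<alpha> p (u t) x * \<psi> (t, x))" (is ?A)
    and "integrable lborel (\<lambda>(t, x). u t x * heat_op (t, x))" (is ?B)
    and "(\<integral>(t, x). nonlinearity \<alpha> p (u t) x * \<psi> (t, x) \<partial>lborel) + (\<integral>(t, x). zeta \<sigma> m t * w x * \<psi> (t, x) \<partial>lborel)
      = - (\<integral>(t, x). u t x * heat_op (t, x) \<partial>lborel)" (is ?D)
proof -
  have cw: "continuous_on UNIV w" using w by (simp add: C0_space_def)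
  have "?A \<and> ?B \<and> ?D"
  proof (cases "\<alpha> \<le> 0")
    case True
    then have u0: "u0 \<in> CB_space UNIV" and u: "\<And>T. T > 0 \<Longrightarrow> (\<lambda>(t, x). u t x) \<in> CB_space ({0..T} \<times> UNIV)"
      and mild: "mild_solution \<alpha> p (zeta \<sigma> m) w u0 u"
      using sol by (simp_all add: global_solution_def)
    show ?thesis using mild_solution_weak_form[OF S assms(2,3) w u0 u mild] by blast
  next
    case False
    then have "classical_solution \<alpha> p (zeta \<sigma> m) w u0 u"
      using sol by (simp add: global_solution_def)
    from classical_solution_weak_form[OF S cw this] show ?thesis by blast
  qed
  then show ?A ?B ?D by blast+
qed

end

section \<open>A bump that is almost caloric near the axis\<close>

text \<open>
  Writing \<open>X = \<bar>x\<bar>\<^sup>2\<close> and \<open>b = t (1 - t)\<close>, the bump is \<open>\<psi> = (max 0 Q)\<^sup>q P\<close> with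
  \<open>Q = (\<epsilon> b)\<^sup>L - X\<^sup>L\<close> and \<open>L = K + 1\<close> odd, where \<open>P\<close> is such that \<open>b\<^bsup>Lq\<^esup> P\<close> is the Taylor
  polynomial of degree \<open>K\<close> in \<open>X\<close> of the solution of the backward heat equation with value
  \<open>b\<^bsup>M+Lq\<^esup>\<close> on the axis \<open>X = 0\<close>.  This makes \<open>\<psi>\<^sub>t + \<Delta>\<psi>\<close> of order \<open>X\<^sup>K\<close> near the axis.\<close>

lemma bump_profile_ring_identity:
  fixes b b' q q1 l N k W w D P Pt PX PXX X Y Y' cE :: real
  assumes "b * (Pt + 2 * N * PX + 4 * X * PXX) = cE * Y - l * q * b' * P"
    and "b * D = l * b' * (w + Y * X)" and "X * Y' * k = k * Y"
  shows "b * (((q * (W * w) * D) * P + Pt * (W * w\<^sup>2))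
      + 2 * N * ((q * (W * w) * (- l * Y)) * P + PX * (W * w\<^sup>2))
      + 4 * X * ((q * (W * w) * (- l * (k * Y')) + (q * (q1 * W * (- l * Y))) * (- l * Y)) * P
        + PX * (q * (W * w) * (- l * Y))
        + (PXX * (W * w\<^sup>2) + (q * (W * w) * (- l * Y)) * PX)))
    = Y * W * (cE * w\<^sup>2 + (q * l) * b' * P * (w * X) - (2 * N * q * l) * b * P * w
      + (4 * q * q1 * l\<^sup>2) * b * P * (Y * X) - (4 * q * l * k) * b * P * w - (8 * q * l) * b * PX * (w * X))"
  using assms by algebra

text \<open>In the variable \<open>X\<close> the Laplacian is \<open>2 * N\<close> times the first
  plus \<open>4 * X\<close> times the second derivative. Two derivatives cost two powers of
  \<open>Q\<close>; the Taylor coefficients and a division by \<open>b\<close> cost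
  \<open>K + 2\<close> powers of \<open>b\<close>. So the operator is of order
  \<open>X ^ K * Q ^ (q - 2) * b ^ (M - K - 2)\<close>, while \<open>g\<close> is at least
  \<open>Q ^ q * b ^ M / 2\<close> where \<open>Q\<close> is positive. For large \<open>q\<close>
  and \<open>M\<close> this gives domination by \<open>g powr (1 / p)\<close>.\<close>

lemma bump_profile_exists:
  fixes N K :: nat and p :: real
  assumes N: "N > 0" and K: "even K" and p: "p > 1"
  obtains g gt gX gXX :: "real \<Rightarrow> real \<Rightarrow> real" and C :: real where
    "\<And>t X. ((\<lambda>t. g t X) has_real_derivative gt t X) (at t)"
    "\<And>t X. (g t has_real_derivative gX t X) (at X)"
    "\<And>t X. (gX t has_real_derivative gXX t X) (at X)"
    "continuous_on UNIV (\<lambda>z. g (fst z) (snd z))" "continuous_on UNIV (\<lambda>z. gt (fst z) (snd z))"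
    "continuous_on UNIV (\<lambda>z. gX (fst z) (snd z))" "continuous_on UNIV (\<lambda>z. gXX (fst z) (snd z))"
    "\<And>t X. X \<ge> 0 \<Longrightarrow> g t X \<ge> 0"
    "\<And>t X. X \<ge> 0 \<Longrightarrow> t \<notin> {0..1} \<or> X > 1 \<Longrightarrow> g t X = 0"
    "\<And>t. 0 < t \<Longrightarrow> t < 1 \<Longrightarrow> g t 0 > 0" "C \<ge> 0"
    "\<And>t X. X \<ge> 0 \<Longrightarrow> \<bar>gt t X + 2 * real N * gX t X + 4 * X * gXX t X\<bar> \<le> C * X ^ K * g t X powr (1 / p)"
proof -
  define L where "L = Suc K"
  \<comment> \<open>For odd \<open>L\<close> and \<open>X \<ge> 0\<close>, positivity of
    \<open>Q t X\<close> forces \<open>b t > 0\<close>, hence \<open>0 < t < 1\<close>; an even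
    power would let the bump reappear at times where \<open>b\<close> is negative.\<close>
  have "odd L" using K by (simp add: L_def)
  \<comment> \<open>Chosen for \<open>M / p \<le> M - K - 2\<close>, the comparison of the powers of
    \<open>b\<close>.\<close>
  obtain M :: nat where M0: "real M * (1 - 1 / p) > real (K + 2)"
    using ex_less_of_nat_mult[of "1 - 1 / p" "real (K + 2)"] p by auto

  have "real M * (1 - 1 / p) \<le> real M * 1" using p by (intro mult_left_mono) auto
  then have "real (K + 2) < real M" using M0 by simp
  then have KM: "K + 2 < M" by linarith
  have Mp: "real M / p \<le> real (M - K - 2)" using M0 KM by (simp add: right_diff_distrib of_nat_diff)
  \<comment> \<open>Chosen for \<open>q / p \<le> q - 2\<close>, the comparison of the powers of
    \<open>Q\<close>; the resulting \<open>q \<ge> 3\<close> also yields two continuous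
    derivatives.\<close>
  obtain q :: nat where q0: "real q * (1 - 1 / p) > 2"
    using ex_less_of_nat_mult[of "1 - 1 / p" 2] p by auto

  have "real q * (1 - 1 / p) \<le> real q * 1" using p by (intro mult_left_mono) auto
  then have "2 < real q" using q0 by simp
  then have q3: "q \<ge> 3" by linarith
  have qp: "real q / p \<le> real (q - 2)" using q0 q3 by (simp add: right_diff_distrib of_nat_diff)
  define B :: "real poly" where "B = [:0, 1, -1:]"
  define b where "b t = t * (1 - t)" for t :: real
  define b' where "b' t = 1 - 2 * t" for t :: real
  have pB: "poly B t = b t" "poly (pderiv B) t = b' t" for t
    by (simp_all add: B_def b_def b'_def pderiv_pCons algebra_simps)
  \<comment> \<open>The k-th derivative of \<open>b ^ (M + L * q)\<close> is
    \<open>b ^ (M + L * q - k)\<close> times \<open>r k\<close>. Thus for \<open>k \<le> M\<close>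
    it equals \<open>b ^ (L * q) * e k\<close>, which is the content of \<open>erec\<close>.\<close>
  define r :: "nat \<Rightarrow> real poly" where
    "r = rec_nat 1 (\<lambda>k f. B * pderiv f + smult (real (M + L * q) - real k) (pderiv B * f))"
  have r0: "r 0 = 1" and rS: "r (Suc k) = B * pderiv (r k) + smult (real (M + L * q) - real k) (pderiv B * r k)" for k
    by (simp_all add: r_def)
  define e where "e k t = b t ^ (M - k) * poly (r k) t" for k t
  define e' where "e' k t = poly (pderiv (B ^ (M - k) * r k)) t" for k t
  have e: "e k t = poly (B ^ (M - k) * r k) t" for k t by (simp add: e_def pB)
  have de: "(e k has_real_derivative e' k t) (at t)" for k t
    unfolding e[abs_def] e'_def by (rule poly_DERIV)
  have erec: "b t * e' k t + real (L * q) * b' t * e k t = b t * e (Suc k) t" if "k < M" for k t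
  proof -
    define j where "j = M - Suc k"
    have j: "M - k = Suc j" "M - Suc k = j" and Mk: "real M = real k + real j + 1"
      using that by (auto simp: j_def)
    have 1: "e' k t = real (Suc j) * b t ^ j * b' t * poly (r k) t + b t ^ Suc j * poly (pderiv (r k)) t"
      unfolding e'_def j pderiv_mult pderiv_power_Suc poly_add poly_mult poly_smult poly_power pB
      by simp
    have 2: "poly (r (Suc k)) t = b t * poly (pderiv (r k)) t + (real j + 1 + real (L * q)) * (b' t * poly (r k) t)"
      unfolding rS poly_add poly_mult poly_smult pB by (simp add: Mk)
    show ?thesis
      unfolding 1 2 e_def j by (simp add: distrib_left distrib_right mult_ac del: of_nat_mult)
  qed
  \<comment> \<open>\<open>2 * (k + 1) * (2 * k + N)\<close> is the factor with which the radial
    Laplacian maps \<open>X ^ (k + 1)\<close> to \<open>X ^ k\<close>. With these coefficients and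
    alternating signs the power series in \<open>X\<close> formally solves the backward heat
    equation.\<close>
  define a :: "nat \<Rightarrow> real" where "a = rec_nat 1 (\<lambda>k f. f / (2 * real (Suc k) * (2 * real k + real N)))"
  have a0: "a 0 = 1" and aS: "a (Suc k) * (2 * real (Suc k) * (2 * real k + real N)) = a k" for k
  proof -
    show "a 0 = 1" by (simp add: a_def)
    have "2 * real (Suc k) * (2 * real k + real N) \<noteq> 0" using N by (simp add: add_nonneg_eq_0_iff)
    then show "a (Suc k) * (2 * real (Suc k) * (2 * real k + real N)) = a k" by (simp add: a_def)
  qed
  define c where "c k = (- 1) ^ k * a k" for k
  define P where "P J t X = (\<Sum>k\<le>J. c k * e k t * X ^ k)" for J t and X :: real
  define Pt where "Pt J t X = (\<Sum>k\<le>J. c k * e' k t * X ^ k)" for J t and X :: real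
  define PX where "PX J t X = (\<Sum>k\<le>J. c k * e k t * (real k * X ^ (k - 1)))" for J t and X :: real
  define PXX where "PXX J t X = (\<Sum>k\<le>J. c k * e k t * (real k * (real (k - 1) * X ^ (k - 1 - 1))))" for J t and X :: real
  have dPt: "((\<lambda>t. P J t X) has_real_derivative Pt J t X) (at t)" for J t X
    unfolding P_def Pt_def by (auto intro!: derivative_eq_intros de simp: mult_ac)
  have dPX: "((\<lambda>X. P J t X) has_real_derivative PX J t X) (at X)" for J t X
    unfolding P_def PX_def by (auto intro!: derivative_eq_intros simp: mult_ac)
  have dPXX: "((\<lambda>X. PX J t X) has_real_derivative PXX J t X) (at X)" for J t X
    unfolding PX_def PXX_def by (auto intro!: derivative_eq_intros simp: mult_ac)
  \<comment> \<open>Raising the truncation by one, the Laplacian of the new term cancels the old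
    remainder, and its time derivative is the new remainder.\<close>
  have heat: "b t * (Pt J t X + 2 * real N * PX J t X + 4 * X * PXX J t X) + real (L * q) * b' t * P J t X
      = c J * b t * e (Suc J) t * X ^ J" if "J < M" for J t X
    using that
  proof (induction J)
    case 0
    then show ?case using erec[of 0 t]
      by (simp add: P_def Pt_def PX_def PXX_def c_def a0 algebra_simps)
  next
    case (Suc J)
    have pw: "2 * real N * (real (Suc J) * X ^ J) + 4 * X * (real (Suc J) * (real J * X ^ (J - 1)))
        = 2 * real (Suc J) * (2 * real J + real N) * X ^ J"
      by (cases J) (simp_all add: algebra_simps)
    have cJ: "c (Suc J) * (2 * real (Suc J) * (2 * real J + real N)) = - c J"
      using aS[of J] by (simp add: c_def mult.assoc)
    have "b t * (Pt (Suc J) t X + 2 * real N * PX (Suc J) t X + 4 * X * PXX (Suc J) t X) + real (L * q) * b' t * P (Suc J) t X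
      = (b t * (Pt J t X + 2 * real N * PX J t X + 4 * X * PXX J t X) + real (L * q) * b' t * P J t X)
        + c (Suc J) * (b t * e' (Suc J) t + real (L * q) * b' t * e (Suc J) t) * X ^ Suc J
        + b t * c (Suc J) * e (Suc J) t * (2 * real N * (real (Suc J) * X ^ J) + 4 * X * (real (Suc J) * (real J * X ^ (J - 1))))"
      by (simp add: P_def Pt_def PX_def PXX_def algebra_simps)
    also have "\<dots> = c J * b t * e (Suc J) t * X ^ J + c (Suc J) * (b t * e (Suc (Suc J)) t) * X ^ Suc J
        + b t * e (Suc J) t * X ^ J * (c (Suc J) * (2 * real (Suc J) * (2 * real J + real N)))"
      using Suc by (simp only: pw erec) (simp add: mult_ac)
    also have "\<dots> = c (Suc J) * b t * e (Suc (Suc J)) t * X ^ Suc J"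
      unfolding cJ by (simp add: algebra_simps)
    finally show ?case .
  qed
  obtain R where R: "R \<ge> 1" "\<And>k t. k \<le> Suc K \<Longrightarrow> t \<in> {0..1} \<Longrightarrow> \<bar>poly (r k) t\<bar> \<le> R"
  proof -
    have "\<exists>R. \<forall>t\<in>{0..1}. \<bar>poly (r k) t\<bar> \<le> R" for k
    proof -
      have "bounded (poly (r k) ` {0..1})"
        by (intro compact_imp_bounded compact_continuous_image continuous_intros) auto
      then show ?thesis by (auto simp: bounded_iff)
    qed
    then obtain R' where R': "\<And>k t. t \<in> {0..1} \<Longrightarrow> \<bar>poly (r k) t\<bar> \<le> R' k" by metis
    define R where "R = 1 + (\<Sum>k\<le>Suc K. \<bar>R' k\<bar>)"
    have "R \<ge> 1" unfolding R_def by (simp add: sum_nonneg)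
    moreover have "\<bar>poly (r k) t\<bar> \<le> R" if "k \<le> Suc K" "t \<in> {0..1}" for k t
    proof -
      have "\<bar>R' k\<bar> \<le> (\<Sum>k\<le>Suc K. \<bar>R' k\<bar>)" using that by (intro member_le_sum) auto
      then show ?thesis using R'[OF that(2), of k] unfolding R_def by linarith
    qed
    ultimately show ?thesis using that by blast
  qed
  \<comment> \<open>The factor \<open>1 + real k\<close> lets \<open>A\<close> serve for
    \<open>P\<close> and for its derivative in \<open>X\<close>.\<close>
  define A where "A = 1 + (\<Sum>k\<le>K. \<bar>c k\<bar> * (1 + real k))"
  have A1: "A \<ge> 1" unfolding A_def by (simp add: sum_nonneg)
  \<comment> \<open>Where \<open>Q\<close> is positive, \<open>X < \<epsilon> * b t\<close>, so
    \<open>X ^ k \<le> \<epsilon> * b t ^ k\<close> for \<open>k \<ge> 1\<close>. This choice keeps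
    the terms of \<open>P\<close> after the first one, \<open>b t ^ M\<close>, at most half as large
    in total.\<close>
  define \<epsilon> where "\<epsilon> = 1 / (2 * A * R)"
  have \<epsilon>: "\<epsilon> > 0" "\<epsilon> \<le> 1" "\<epsilon> * (A * R) = 1 / 2"
    using A1 R(1) mult_mono[of 1 A 1 R] by (auto simp: \<epsilon>_def field_simps)
  define Q where "Q t X = (\<epsilon> * b t) ^ L - X ^ L" for t X :: real
  have dQt: "((\<lambda>t. Q t X) has_real_derivative real L * (\<epsilon> * b t) ^ K * (\<epsilon> * b' t)) (at t)" for t X
  proof -
    have "(b has_real_derivative b' t) (at t)"
      unfolding b_def[abs_def] b'_def by (auto intro!: derivative_eq_intros)
    from DERIV_diff[OF DERIV_power[OF DERIV_cmult[OF this]] DERIV_const] show ?thesis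
      unfolding Q_def by (rule DERIV_cong) (simp add: L_def mult_ac)
  qed
  have dQX: "(Q t has_real_derivative - real L * X ^ K) (at X)" for t X
    unfolding Q_def
    by (rule DERIV_cong[OF DERIV_diff[OF DERIV_const DERIV_power[OF DERIV_ident]]]) (simp add: L_def algebra_simps)
  define h where "h j t X = max 0 (Q t X) ^ j" for j t X
  have dht: "((\<lambda>t. h j t X) has_real_derivative real j * h (j - 1) t X * (real L * (\<epsilon> * b t) ^ K * (\<epsilon> * b' t))) (at t)"
    if "j \<ge> 2" for j t X
    unfolding h_def by (rule DERIV_chain2[where f = "\<lambda>y. max 0 y ^ j", OF DERIV_max_0_power[OF that] dQt])
  have dhX: "(h j t has_real_derivative real j * h (j - 1) t X * (- real L * X ^ K)) (at X)"
    if "j \<ge> 2" for j t X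
    unfolding h_def by (rule DERIV_chain2[where f = "\<lambda>y. max 0 y ^ j", OF DERIV_max_0_power[OF that] dQX])
  define g where "g t X = h q t X * P K t X" for t X
  define gt where "gt t X = (real q * h (q - 1) t X * (real L * (\<epsilon> * b t) ^ K * (\<epsilon> * b' t))) * P K t X + Pt K t X * h q t X" for t X
  define gX where "gX t X = (real q * h (q - 1) t X * (- real L * X ^ K)) * P K t X + PX K t X * h q t X" for t X
  define gXX where "gXX t X =
      (real q * h (q - 1) t X * (- real L * (real K * X ^ (K - 1)))
        + (real q * (real (q - 1) * h (q - 2) t X * (- real L * X ^ K))) * (- real L * X ^ K)) * P K t X
      + PX K t X * (real q * h (q - 1) t X * (- real L * X ^ K))
      + (PXX K t X * h q t X + (real q * h (q - 1) t X * (- real L * X ^ K)) * PX K t X)" for t X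
  have D1: "((\<lambda>t. g t X) has_real_derivative gt t X) (at t)" for t X
    unfolding g_def gt_def using q3 by (intro DERIV_mult dht dPt) auto
  have D2: "(g t has_real_derivative gX t X) (at X)" for t X
    unfolding g_def[abs_def] gX_def using q3 by (intro DERIV_mult dhX dPX) auto
  have D3: "(gX t has_real_derivative gXX t X) (at X)" for t X
  proof -
    have 1: "((\<lambda>X. real q * h (q - 1) t X) has_real_derivative real q * (real (q - 1) * h (q - 1 - 1) t X * (- real L * X ^ K))) (at X)"
      using q3 by (intro DERIV_cmult dhX) auto
    have 2: "((\<lambda>X. - real L * X ^ K) has_real_derivative - real L * (real K * X ^ (K - 1))) (at X)"
      by (intro DERIV_cmult) (auto intro!: derivative_eq_intros)
    have 3: "((\<lambda>X. h q t X) has_real_derivative real q * h (q - 1) t X * (- real L * X ^ K)) (at X)"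
      using q3 by (intro dhX) auto
    show ?thesis
      unfolding gX_def[abs_def]
      by (rule DERIV_cong[OF DERIV_add[OF DERIV_mult[OF DERIV_mult[OF 1 2] dPX] DERIV_mult[OF dPXX 3]]])
         (simp add: gXX_def numeral_2_eq_2 algebra_simps)
  qed
  have cb: "continuous_on UNIV (\<lambda>z::real \<times> real. b (fst z))" "continuous_on UNIV (\<lambda>z::real \<times> real. b' (fst z))"
    unfolding b_def b'_def by (intro continuous_intros)+
  have ce: "continuous_on UNIV (\<lambda>z::real \<times> real. e k (fst z))" "continuous_on UNIV (\<lambda>z::real \<times> real. e' k (fst z))" for k
    unfolding e e'_def by (intro continuous_intros)+
  have ch: "continuous_on UNIV (\<lambda>z. h j (fst z) (snd z))" for j
    unfolding h_def Q_def by (intro continuous_intros cb)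
  have cP: "continuous_on UNIV (\<lambda>z. P K (fst z) (snd z))" "continuous_on UNIV (\<lambda>z. Pt K (fst z) (snd z))"
    "continuous_on UNIV (\<lambda>z. PX K (fst z) (snd z))" "continuous_on UNIV (\<lambda>z. PXX K (fst z) (snd z))"
    unfolding P_def Pt_def PX_def PXX_def by (intro continuous_intros ce)+
  have C1: "continuous_on UNIV (\<lambda>z. g (fst z) (snd z))" "continuous_on UNIV (\<lambda>z. gt (fst z) (snd z))"
    "continuous_on UNIV (\<lambda>z. gX (fst z) (snd z))" "continuous_on UNIV (\<lambda>z. gXX (fst z) (snd z))"
    unfolding g_def gt_def gX_def gXX_def by (intro continuous_intros cb ch cP)+
  have b14: "b t \<le> 1" for t
  proof -
    have "b t = 1 / 4 - (t - 1 / 2)\<^sup>2" by (simp add: b_def power2_eq_square algebra_simps)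
    then show ?thesis using zero_le_power2[of "t - 1/2"] by linarith
  qed
  have reg: "0 < t" "t < 1" "0 < b t" "X < \<epsilon> * b t" "X \<le> 1" "Q t X \<le> 1" if X: "X \<ge> 0" and Qp: "Q t X > 0" for t X
  proof -
    have *: "X ^ L < (\<epsilon> * b t) ^ L" using Qp by (simp add: Q_def)
    show lt: "X < \<epsilon> * b t"
      by (rule ccontr) (use * power_mono_odd[OF \<open>odd L\<close>, of "\<epsilon> * b t" X] in auto)
    then have "0 < \<epsilon> * b t" using X by linarith
    then show bp: "0 < b t" using \<epsilon> by (simp add: zero_less_mult_iff)
    then show "0 < t" "t < 1" unfolding b_def by (auto simp: zero_less_mult_iff)
    have le1: "\<epsilon> * b t \<le> 1" using \<epsilon> b14[of t] bp by (simp add: mult_le_one)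
    then show "X \<le> 1" using lt by linarith
    have "(\<epsilon> * b t) ^ L \<le> 1" using le1 bp \<epsilon> by (intro power_le_one) auto
    then show "Q t X \<le> 1" using X unfolding Q_def by (smt (verit) zero_le_power)
  qed
  have bpow: "b t ^ m \<le> b t ^ n" if "n \<le> m" "0 < b t" for m n t
    using that b14[of t] by (intro power_decreasing) auto
  have ebd: "\<bar>e k t\<bar> \<le> R * b t ^ (M - k)" if "0 < b t" "k \<le> Suc K" "0 < t" "t < 1" for k t
    using R(2)[OF that(2), of t] that
    by (simp add: e_def abs_mult power_abs mult.commute mult_left_mono)
  \<comment> \<open>The exponent \<open>M - K - 1\<close>, one less than \<open>P\<close> itself
    requires, is the one that also bounds \<open>e (Suc K)\<close> in the Taylor remainder.\<close>
  have PX_bd: "\<bar>P K t X\<bar> \<le> A * R * b t ^ (M - K - 1)" "\<bar>PX K t X\<bar> \<le> A * R * b t ^ (M - K - 1)"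
    and P_lower: "P K t X \<ge> b t ^ M / 2" if X: "X \<ge> 0" and Qp: "Q t X > 0" for t X
  proof -
    note rg = reg[OF X Qp]
    have ek: "\<bar>e k t\<bar> \<le> R * b t ^ (M - K - 1)" if "k \<le> K" for k
    proof -
      have "\<bar>e k t\<bar> \<le> R * b t ^ (M - k)" using ebd[of t k] rg that by auto
      also have "\<dots> \<le> R * b t ^ (M - K - 1)" using R(1) that rg by (intro mult_left_mono bpow) auto
      finally show ?thesis .
    qed
    have Rb: "R * b t ^ (M - K - 1) \<ge> 0" using R(1) rg by simp
    have term_bd: "(\<Sum>k\<le>K. \<bar>c k\<bar> * (1 + real k) * (R * b t ^ (M - K - 1))) \<le> A * R * b t ^ (M - K - 1)"
      unfolding A_def sum_distrib_right[symmetric] using Rb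
      by (simp add: algebra_simps)
    have "\<bar>P K t X\<bar> \<le> (\<Sum>k\<le>K. \<bar>c k\<bar> * (1 + real k) * (R * b t ^ (M - K - 1)))"
      unfolding P_def
    proof (rule sum_abs[THEN order_trans], rule sum_mono)
      fix k assume k: "k \<in> {..K}"
      have "\<bar>c k * e k t * X ^ k\<bar> = \<bar>c k\<bar> * 1 * (\<bar>e k t\<bar> * X ^ k)" using X by (simp add: abs_mult)
      also have "\<dots> \<le> \<bar>c k\<bar> * (1 + real k) * (R * b t ^ (M - K - 1) * 1)"
        using ek[of k] k rg X Rb by (intro mult_mono power_le_one) auto
      finally show "\<bar>c k * e k t * X ^ k\<bar> \<le> \<bar>c k\<bar> * (1 + real k) * (R * b t ^ (M - K - 1))" by simp
    qed
    with term_bd show "\<bar>P K t X\<bar> \<le> A * R * b t ^ (M - K - 1)" by linarith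
    have "\<bar>PX K t X\<bar> \<le> (\<Sum>k\<le>K. \<bar>c k\<bar> * (1 + real k) * (R * b t ^ (M - K - 1)))"
      unfolding PX_def
    proof (rule sum_abs[THEN order_trans], rule sum_mono)
      fix k assume k: "k \<in> {..K}"
      have "\<bar>c k * e k t * (real k * X ^ (k - 1))\<bar> = \<bar>c k\<bar> * real k * (\<bar>e k t\<bar> * X ^ (k - 1))"
        using X by (simp add: abs_mult)
      also have "\<dots> \<le> \<bar>c k\<bar> * (1 + real k) * (R * b t ^ (M - K - 1) * 1)"
        using ek[of k] k rg X Rb by (intro mult_mono power_le_one) auto
      finally show "\<bar>c k * e k t * (real k * X ^ (k - 1))\<bar> \<le> \<bar>c k\<bar> * (1 + real k) * (R * b t ^ (M - K - 1))" by simp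
    qed
    with term_bd show "\<bar>PX K t X\<bar> \<le> A * R * b t ^ (M - K - 1)" by linarith
    have split: "P K t X = b t ^ M + (\<Sum>k\<in>{1..K}. c k * e k t * X ^ k)"
      unfolding P_def by (simp add: sum.atLeast1_atMost_eq atMost_atLeast0 sum.atLeast_Suc_atMost c_def a0 e_def r0)
    have "\<bar>\<Sum>k\<in>{1..K}. c k * e k t * X ^ k\<bar> \<le> (\<Sum>k\<in>{1..K}. \<bar>c k\<bar> * (1 + real k) * (\<epsilon> * R * b t ^ M))"
    proof (rule sum_abs[THEN order_trans], rule sum_mono)
      fix k assume k: "k \<in> {1..K}"
      then have kM: "k \<le> M" using KM by auto
      have Xk: "X ^ k \<le> \<epsilon> * b t ^ k"
      proof -
        have "X ^ k \<le> (\<epsilon> * b t) ^ k" using X rg by (intro power_mono) auto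
        also have "\<dots> = \<epsilon> ^ k * b t ^ k" by (simp add: power_mult_distrib)
        also have "\<dots> \<le> \<epsilon> ^ 1 * b t ^ k" using k \<epsilon> rg by (intro mult_right_mono power_decreasing) auto
        finally show ?thesis by simp
      qed
      have "\<bar>e k t\<bar> * X ^ k \<le> (R * b t ^ (M - k)) * (\<epsilon> * b t ^ k)"
        using ebd[of t k] k rg Xk X R(1) by (intro mult_mono) auto
      also have "\<dots> = \<epsilon> * R * b t ^ M" using kM by (simp add: power_add[symmetric] mult_ac)
      finally have 1: "\<bar>e k t\<bar> * X ^ k \<le> \<epsilon> * R * b t ^ M" .
      have "\<bar>c k * e k t * X ^ k\<bar> = \<bar>c k\<bar> * 1 * (\<bar>e k t\<bar> * X ^ k)" using X by (simp add: abs_mult)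
      also have "\<dots> \<le> \<bar>c k\<bar> * (1 + real k) * (\<epsilon> * R * b t ^ M)"
        using X by (intro mult_mono[OF mult_left_mono 1]) auto
      finally show "\<bar>c k * e k t * X ^ k\<bar> \<le> \<bar>c k\<bar> * (1 + real k) * (\<epsilon> * R * b t ^ M)" .
    qed
    also have "\<dots> = (\<Sum>k\<in>{1..K}. \<bar>c k\<bar> * (1 + real k)) * (\<epsilon> * R * b t ^ M)"
      by (simp add: sum_distrib_right)
    also have "\<dots> \<le> A * (\<epsilon> * R * b t ^ M)"
    proof (rule mult_right_mono)
      have "(\<Sum>k\<in>{1..K}. \<bar>c k\<bar> * (1 + real k)) \<le> (\<Sum>k\<le>K. \<bar>c k\<bar> * (1 + real k))"
        by (intro sum_mono2) auto
      then show "(\<Sum>k\<in>{1..K}. \<bar>c k\<bar> * (1 + real k)) \<le> A" by (simp add: A_def)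
      show "0 \<le> \<epsilon> * R * b t ^ M" using \<epsilon> R(1) rg by simp
    qed
    also have "\<dots> = (\<epsilon> * (A * R)) * b t ^ M" by simp
    also have "\<dots> = b t ^ M / 2" unfolding \<epsilon>(3) by simp
    finally show "P K t X \<ge> b t ^ M / 2" unfolding split by linarith
  qed
  have g_pos: "g t X > 0" if "X \<ge> 0" "Q t X > 0" for t X
  proof -
    have "P K t X > 0" using P_lower[OF that] zero_less_power[OF reg(3)[OF that], of M] by linarith
    then show ?thesis using that by (simp add: g_def h_def)
  qed
  have g_0: "g t X = 0" if "Q t X \<le> 0" for t X
    using that q3 by (simp add: g_def h_def max_def)
  define k2 where "k2 = real q * real L"
  define k3 where "k3 = 2 * real N * real q * real L"
  define k4 where "k4 = 4 * real q * real (q - 1) * (real L)\<^sup>2"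
  define k5 where "k5 = 4 * real q * real L * real K"
  define k6 where "k6 = 8 * real q * real L"
  have kn: "k2 \<ge> 0" "k3 \<ge> 0" "k4 \<ge> 0" "k5 \<ge> 0" "k6 \<ge> 0"
    by (simp_all add: k2_def k3_def k4_def k5_def k6_def)
  \<comment> \<open>The factor 2 compensates for the one half in the lower bound of
    \<open>P\<close>, through \<open>1 / 2 \<le> (1 / 2) powr (1 / p)\<close>.\<close>
  define C where "C = 2 * (\<bar>c K\<bar> * R + (k2 + k3 + k4 + k5 + k6) * (A * R))"
  have C0: "C \<ge> 0" using A1 R kn by (simp add: C_def)
  have bound: "\<bar>gt t X + 2 * real N * gX t X + 4 * X * gXX t X\<bar> \<le> C * X ^ K * g t X powr (1 / p)" if X: "X \<ge> 0" for t X
  proof (cases "Q t X > 0")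
    case False
    then have "h (q - 2) t X = 0" "h (q - 1) t X = 0" "h q t X = 0" using q3 by (auto simp: h_def max_def)
    moreover have "g t X = 0" using False by (intro g_0) simp
    ultimately show ?thesis unfolding gt_def gX_def gXX_def by simp
  next
    case True
    note rg = reg[OF X True]
    define w where "w = Q t X"
    have w: "0 < w" "w \<le> 1" using True rg by (auto simp: w_def)
    define s where "s = q - 2"
    have qs: "q = s + 2" "q - 1 = s + 1" "q - 2 = s" using q3 by (auto simp: s_def)
    have hq: "h q t X = w ^ s * w\<^sup>2" "h (q - 1) t X = w ^ s * w" "h (q - 2) t X = w ^ s"
      using w qs by (simp_all add: h_def w_def max_def power_add power2_eq_square)
    have XL: "(\<epsilon> * b t) ^ L = w + X ^ L" by (simp add: w_def Q_def)
    have eK: "b t * (real L * (\<epsilon> * b t) ^ K * (\<epsilon> * b' t)) = real L * b' t * (w + X ^ L)"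
      unfolding XL[symmetric] by (simp add: L_def)
    have XK1: "X * X ^ (K - 1) * real K = real K * X ^ K" by (cases K) auto
    have XL': "X ^ L = X ^ K * X" by (simp add: L_def)
    define G where "G = c K * b t * e (Suc K) t * w\<^sup>2 + k2 * b' t * P K t X * (w * X)
        - k3 * b t * P K t X * w + k4 * b t * P K t X * X ^ L - k5 * b t * P K t X * w
        - k6 * b t * PX K t X * (w * X)"
    let ?F = "gt t X + 2 * real N * gX t X + 4 * X * gXX t X"
    \<comment> \<open>Multiplication by \<open>b t\<close> makes \<open>heat\<close> and the formula
      for the time derivative of \<open>Q\<close> applicable; dividing again costs the last power of
      \<open>b\<close>.\<close>
    have "b t * ?F = X ^ K * w ^ s * G"
      unfolding gt_def gX_def gXX_def hq G_def k2_def k3_def k4_def k5_def k6_def XL'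
    proof (rule bump_profile_ring_identity)
      show "b t * (Pt K t X + 2 * real N * PX K t X + 4 * X * PXX K t X)
          = c K * b t * e (Suc K) t * X ^ K - real L * real q * b' t * P K t X"
        using heat[of K t X] KM by simp
      show "b t * (real L * (\<epsilon> * b t) ^ K * (\<epsilon> * b' t)) = real L * b' t * (w + X ^ K * X)"
        using eK by (simp only: XL')
    qed (rule XK1)
    then have F: "?F = X ^ K * w ^ s * (G / b t)" using rg(3) by (simp add: field_simps)
    define \<beta> where "\<beta> = b t ^ (M - K - 1)"
    have \<beta>: "\<beta> > 0" using rg by (simp add: \<beta>_def)
    have b1: "\<bar>b' t\<bar> \<le> 1" using rg unfolding b'_def by linarith
    have AR: "A * R \<ge> 0" using A1 R by simp
    note PP = PX_bd[OF X True, folded \<beta>_def]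
    have eb: "\<bar>e (Suc K) t\<bar> \<le> R * \<beta>"
      using ebd[of t "Suc K"] rg by (simp add: \<beta>_def)
    have bt: "0 \<le> b t" "b t \<le> 1" using rg b14 by (auto simp: less_imp_le)
    have w2: "0 \<le> w\<^sup>2" "w\<^sup>2 \<le> 1" using w by (auto intro: power_le_one)
    have XL1: "0 \<le> X ^ L" "X ^ L \<le> 1" using X rg by (auto intro: power_le_one)
    have t1: "\<bar>c K * b t * e (Suc K) t * w\<^sup>2\<bar> \<le> \<bar>c K\<bar> * R * \<beta>"
    proof -
      have "\<bar>c K * b t * e (Suc K) t * w\<^sup>2\<bar> = \<bar>c K\<bar> * b t * \<bar>e (Suc K) t\<bar> * w\<^sup>2" using bt by (simp add: abs_mult)
      also have "\<dots> \<le> \<bar>c K\<bar> * 1 * (R * \<beta>) * 1" using bt eb w2 R \<beta> by (intro mult_mono) auto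
      finally show ?thesis by (simp add: mult_ac)
    qed
    have gen: "\<bar>k * u * v * y\<bar> \<le> k * (A * R) * \<beta>" if "k \<ge> 0" "\<bar>u\<bar> \<le> 1" "\<bar>v\<bar> \<le> A * R * \<beta>" "\<bar>y\<bar> \<le> 1" for k u v y
    proof -
      have "\<bar>k * u * v * y\<bar> = k * \<bar>u\<bar> * \<bar>v\<bar> * \<bar>y\<bar>" using that by (simp add: abs_mult)
      also have "\<dots> \<le> k * 1 * (A * R * \<beta>) * 1" using that AR \<beta> by (intro mult_mono) auto
      finally show ?thesis by (simp add: mult_ac)
    qed
    have le1: "\<bar>x * y\<bar> \<le> 1" if "\<bar>x\<bar> \<le> 1" "\<bar>y\<bar> \<le> 1" for x y :: real
      using that by (simp add: abs_mult mult_le_one)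
    have aw: "\<bar>w\<bar> \<le> 1" "\<bar>X\<bar> \<le> 1" "\<bar>b t\<bar> \<le> 1" "\<bar>X ^ L\<bar> \<le> 1" "\<bar>b' t\<bar> \<le> 1" using w X rg bt XL1 b1 by auto
    have tri: "\<bar>x1 + x2 - x3 + x4 - x5 - x6\<bar> \<le> y1 + y2 + y3 + y4 + y5 + y6"
      if "\<bar>x1\<bar> \<le> y1" "\<bar>x2\<bar> \<le> y2" "\<bar>x3\<bar> \<le> y3" "\<bar>x4\<bar> \<le> y4" "\<bar>x5\<bar> \<le> y5" "\<bar>x6\<bar> \<le> y6"
      for x1 x2 x3 x4 x5 x6 y1 y2 y3 y4 y5 y6 :: real
      using that by linarith
    have "\<bar>G\<bar> \<le> \<bar>c K\<bar> * R * \<beta> + k2 * (A * R) * \<beta> + k3 * (A * R) * \<beta>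
        + k4 * (A * R) * \<beta> + k5 * (A * R) * \<beta> + k6 * (A * R) * \<beta>"
      unfolding G_def
      by (rule tri[OF t1 gen[OF kn(1) aw(5) PP(1) le1[OF aw(1,2)]] gen[OF kn(2) aw(3) PP(1) aw(1)]
          gen[OF kn(3) aw(3) PP(1) aw(4)] gen[OF kn(4) aw(3) PP(1) aw(1)]
          gen[OF kn(5) aw(3) PP(2) le1[OF aw(1,2)]]])
    also have "\<dots> = C / 2 * \<beta>" unfolding C_def by (simp add: distrib_left distrib_right)
    finally have Gb: "\<bar>G\<bar> \<le> C / 2 * \<beta>" .
    have \<beta>b: "\<beta> / b t = b t ^ (M - K - 2)"
    proof -
      have "M - K - 1 = Suc (M - K - 2)" using KM by simp
      then show ?thesis using rg(3) by (simp add: \<beta>_def)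
    qed
    have "\<bar>?F\<bar> = X ^ K * w ^ s * (\<bar>G\<bar> / b t)"
      unfolding F using X w rg(3) by (simp add: abs_mult)
    also have "\<dots> \<le> X ^ K * w ^ s * (C / 2 * \<beta> / b t)"
      using Gb X w rg(3) by (intro mult_left_mono divide_right_mono) auto
    also have "\<dots> = C * X ^ K * (w ^ s * (b t ^ (M - K - 2)) / 2)"
      unfolding \<beta>b[symmetric] by (simp add: mult_ac)
    also have "\<dots> \<le> C * X ^ K * g t X powr (1 / p)"
    proof (rule mult_left_mono)
      have 1: "w ^ s \<le> w powr (real q / p)"
      proof -
        have "w ^ s = w powr real s" using w by (simp add: powr_realpow)
        also have "\<dots> \<le> w powr (real q / p)" using w qp qs by (intro powr_mono') auto
        finally show ?thesis .
      qed
      have 2: "b t ^ (M - K - 2) \<le> b t powr (real M / p)"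
      proof -
        have "b t ^ (M - K - 2) = b t powr real (M - K - 2)" using rg(3) by (simp add: powr_realpow)
        also have "\<dots> \<le> b t powr (real M / p)" using rg(3) bt Mp by (intro powr_mono') auto
        finally show ?thesis .
      qed
      have 3: "1 / 2 \<le> (1 / 2 :: real) powr (1 / p)"
        using powr_mono'[of "1 / p" 1 "1 / 2 :: real"] p by simp
      have "w ^ s * (b t ^ (M - K - 2)) / 2 \<le> w powr (real q / p) * b t powr (real M / p) * (1 / 2 :: real) powr (1 / p)"
        using mult_mono[OF mult_mono[OF 1 2] 3] w rg(3) by simp
      also have "\<dots> = (w ^ q * (b t ^ M / 2)) powr (1 / p)"
        using w rg(3) by (simp add: powr_mult powr_divide powr_powr powr_realpow[symmetric])
      also have "\<dots> \<le> g t X powr (1 / p)"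
      proof (rule powr_mono2)
        show "w ^ q * (b t ^ M / 2) \<le> g t X"
          unfolding g_def h_def w_def[symmetric] using P_lower[OF X True] w
          by (simp add: max_def mult_left_mono)
      qed (use p w rg(3) in auto)
      finally show "w ^ s * (b t ^ (M - K - 2)) / 2 \<le> g t X powr (1 / p)" .
    next
      show "0 \<le> C * X ^ K" using C0 X by simp
    qed
    finally show ?thesis .
  qed
  show ?thesis
  proof (rule that[OF D1 D2 D3 C1 _ _ _ _ bound])
    show "g t X \<ge> 0" if "X \<ge> 0" for t X
      using g_pos[OF that, of t] g_0[of t X] by (cases "Q t X > 0") auto
    show "g t X = 0" if "X \<ge> 0" "t \<notin> {0..1} \<or> X > 1" for t X
      using reg[OF that(1), of t] g_0[of t X] that by (cases "Q t X > 0") auto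
    show "g t 0 > 0" if "0 < t" "t < 1" for t
      using that \<epsilon> by (intro g_pos) (auto simp: Q_def L_def b_def)
    show "C \<ge> 0" by (rule C0)
  qed
qed

section \<open>Rescaling\<close>

lemma has_real_derivative_scaled_radius:
  fixes x :: "real ^ 'n"
  assumes f: "\<And>X. (f has_real_derivative f' X) (at X)"
  shows "((\<lambda>r. f ((norm (x + r *\<^sub>R axis i 1))\<^sup>2 / T)) has_real_derivative f' ((norm x)\<^sup>2 / T) * (2 * (x $ i) / T)) (at 0)"
proof -
  note n = norm_add_axis_square[of x _ i]
  have d: "((\<lambda>r. ((norm x)\<^sup>2 + 2 * r * (x $ i) + r\<^sup>2) / T) has_real_derivative 2 * (x $ i) / T) (at 0)"
    by (rule DERIV_cdivide) (auto intro!: derivative_eq_intros)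
  have "(f has_real_derivative f' ((norm x)\<^sup>2 / T)) (at (((norm x)\<^sup>2 + 2 * 0 * (x $ i) + 0\<^sup>2) / T))"
    using f[of "(norm x)\<^sup>2 / T"] by simp
  from DERIV_chain2[OF this d] show ?thesis unfolding n .
qed

text \<open>The profile is a function of the squared radius, so the chain rule gives derivatives
  without a singularity at the origin.\<close>

lemma scaled_radial_test_function:
  fixes g gt gX gXX :: "real \<Rightarrow> real \<Rightarrow> real" and T :: real
  assumes T: "T > 0"
    and d: "\<And>t X. ((\<lambda>t. g t X) has_real_derivative gt t X) (at t)"
      "\<And>t X. (g t has_real_derivative gX t X) (at X)"
      "\<And>t X. (gX t has_real_derivative gXX t X) (at X)"
    and c: "continuous_on UNIV (\<lambda>z. g (fst z) (snd z))" "continuous_on UNIV (\<lambda>z. gt (fst z) (snd z))"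
      "continuous_on UNIV (\<lambda>z. gX (fst z) (snd z))" "continuous_on UNIV (\<lambda>z. gXX (fst z) (snd z))"
    and z: "\<And>t X. X \<ge> 0 \<Longrightarrow> t \<notin> {0..1} \<or> X > 1 \<Longrightarrow> g t X = 0"
  defines "s \<equiv> \<lambda>z :: real \<times> (real ^ 'n). fst z / T - 1"
    and "X \<equiv> \<lambda>z :: real \<times> (real ^ 'n). (norm (snd z))\<^sup>2 / T"
  shows "test_function ({T..2 * T} \<times> cball 0 (sqrt T))
    (\<lambda>z. g (s z) (X z)) (\<lambda>z. gt (s z) (X z) / T) (\<lambda>i z. gX (s z) (X z) * (2 * (snd z $ i) / T))
    (\<lambda>i z. gXX (s z) (X z) * (2 * (snd z $ i) / T) * (2 * (snd z $ i) / T) + gX (s z) (X z) * (2 / T))"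
proof
  have cX: "continuous_on UNIV s" "continuous_on UNIV X"
    unfolding s_def X_def using T by (auto intro!: continuous_intros)
  have cc: "continuous_on UNIV (\<lambda>z. h (s z) (X z))" if "continuous_on UNIV (\<lambda>z. h (fst z) (snd z))"
    for h :: "real \<Rightarrow> real \<Rightarrow> real"
    using continuous_on_compose2[OF that, of UNIV "\<lambda>z. (s z, X z)"] cX
    by (auto intro!: continuous_intros)
  show "compact ({T..2 * T} \<times> cball (0 :: real ^ 'n) (sqrt T))" by (intro compact_Times) auto
  show "g (s z) (X z) = 0" if "z \<notin> {T..2 * T} \<times> cball 0 (sqrt T)" for z
  proof (rule assms(9))
    show "X z \<ge> 0" using T by (simp add: X_def)
    show "s z \<notin> {0..1} \<or> X z > 1"
    proof (cases "fst z \<in> {T..2 * T}")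
      case True
      then have "norm (snd z) > sqrt T" using that by (auto simp: mem_Times_iff)
      then have "(norm (snd z))\<^sup>2 > T" using T real_less_rsqrt not_less real_le_rsqrt by (meson real_le_lsqrt norm_ge_zero less_imp_le)
      then show ?thesis using T by (simp add: X_def)
    next
      case False then show ?thesis using T by (auto simp: s_def field_simps)
    qed
  qed
  show "continuous_on UNIV (\<lambda>z. g (s z) (X z))" "continuous_on UNIV (\<lambda>z. gt (s z) (X z) / T)"
    "continuous_on UNIV (\<lambda>z. gXX (s z) (X z) * (2 * (snd z $ i) / T) * (2 * (snd z $ i) / T) + gX (s z) (X z) * (2 / T))" for i
    using T by (intro continuous_intros cc c; simp)+
  show "dird (\<lambda>z. g (s z) (X z)) (1, 0) (gt (s z) (X z) / T) z" for z
  proof -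
    have 1: "((\<lambda>r. (fst z + r) / T - 1) has_real_derivative 1 / T) (at 0)"
      using T by (auto intro!: derivative_eq_intros)
    have "((\<lambda>t. g t (X z)) has_real_derivative gt (s z) (X z)) (at ((fst z + 0) / T - 1))"
      using d(1)[of "X z" "s z"] by (simp add: s_def)
    from DERIV_chain2[OF this 1] show ?thesis by (simp add: dird_def s_def X_def)
  qed
  show "dird (\<lambda>z. g (s z) (X z)) (0, axis i 1) (gX (s z) (X z) * (2 * (snd z $ i) / T)) z" for i z
    using has_real_derivative_scaled_radius[OF d(2), of "s z" "snd z" i T]
    by (simp add: dird_def s_def X_def)
  show "dird (\<lambda>z. gX (s z) (X z) * (2 * (snd z $ i) / T)) (0, axis i 1)
      (gXX (s z) (X z) * (2 * (snd z $ i) / T) * (2 * (snd z $ i) / T) + gX (s z) (X z) * (2 / T)) z" for i z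
  proof (rule dird_mult)
    show "dird (\<lambda>z. gX (s z) (X z)) (0, axis i 1) (gXX (s z) (X z) * (2 * (snd z $ i) / T)) z"
      using has_real_derivative_scaled_radius[OF d(3), of "s z" "snd z" i T]
      by (simp add: dird_def s_def X_def)
    have "((\<lambda>r. 2 * (snd z $ i + r) / T) has_real_derivative 2 / T) (at 0)"
      by (rule DERIV_cdivide) (auto intro!: derivative_eq_intros)
    then show "dird (\<lambda>z. 2 * (snd z $ i) / T) (0, axis i 1) (2 / T) z"
      by (simp add: dird_def axis_def)
  qed
qed

text \<open>Turns the sum over the coordinates into the radial operator for which the profile is
  estimated, with the parabolic factor \<open>1 / T\<close>.\<close>

lemma radial_laplacian:
  fixes x :: "real ^ 'n"
  shows "(\<Sum>i\<in>UNIV. a * (2 * (x $ i) / T) * (2 * (x $ i) / T) + b * (2 / T))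
    = (2 * real CARD('n) * b + 4 * ((norm x)\<^sup>2 / T) * a) / T"
proof -
  have "(norm x)\<^sup>2 = (\<Sum>i\<in>UNIV. (x $ i)\<^sup>2)"
    unfolding power2_norm_eq_inner by (simp add: inner_vec_def power2_eq_square)
  moreover have "(\<Sum>i\<in>UNIV. a * (2 * (x $ i) / T) * (2 * (x $ i) / T)) = (4 * a / T\<^sup>2) * (\<Sum>i\<in>UNIV. (x $ i)\<^sup>2)"
    by (simp add: sum_distrib_left sum_divide_distrib power2_eq_square mult_ac)
  ultimately show ?thesis by (simp add: sum.distrib power2_eq_square add_divide_distrib mult_ac)
qed

text \<open>Only time is substituted, since \<open>w\<close> does not scale. For
  \<open>T \<ge> 1\<close> the support lies in \<open>t \<ge> 1\<close>, where \<open>zeta\<close>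
  is the pure power \<open>t powr m\<close>; this yields \<open>T powr m\<close>, and the
  substitution one more factor \<open>T\<close>.\<close>

lemma scaled_forcing_integral:
  fixes g :: "real \<Rightarrow> real \<Rightarrow> real" and w :: "real ^ 'n \<Rightarrow> real"
  assumes T: "T \<ge> 1"
    and z: "\<And>t X. X \<ge> 0 \<Longrightarrow> t \<notin> {0..1} \<or> X > 1 \<Longrightarrow> g t X = 0"
    and int: "integrable lborel (\<lambda>(t, x). zeta \<sigma> m t * w x * g (t / T - 1) ((norm x)\<^sup>2 / T))"
  shows "(\<integral>(t, x). zeta \<sigma> m t * w x * g (t / T - 1) ((norm x)\<^sup>2 / T) \<partial>lborel)
    = T powr (m + 1) * (\<integral>s. (1 + s) powr m * (\<integral>x. w x * g s ((norm x)\<^sup>2 / T) \<partial>lborel) \<partial>lborel)"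
proof -
  let ?f = "\<lambda>t x. zeta \<sigma> m t * w x * g (t / T - 1) ((norm x)\<^sup>2 / T)"
  have "(\<integral>(t, x). ?f t x \<partial>lborel) = (\<integral>t. \<integral>x. ?f t x \<partial>lborel \<partial>lborel)"
    using lborel_pair.integral_fst'[of "\<lambda>(t, x). ?f t x", unfolded lborel_prod, OF int] by simp
  also have "\<dots> = T * (\<integral>s. \<integral>x. ?f (T + T * s) x \<partial>lborel \<partial>lborel)"
    using T by (subst lborel_integral_real_affine[of T _ T]) auto
  also have "(\<lambda>s. \<integral>x. ?f (T + T * s) x \<partial>lborel)
      = (\<lambda>s. T powr m * ((1 + s) powr m * (\<integral>x. w x * g s ((norm x)\<^sup>2 / T) \<partial>lborel)))"
  proof
    fix s
    have s: "(T + T * s) / T - 1 = s" using T by (simp add: add_divide_distrib)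
    show "(\<integral>x. ?f (T + T * s) x \<partial>lborel) = T powr m * ((1 + s) powr m * (\<integral>x. w x * g s ((norm x)\<^sup>2 / T) \<partial>lborel))"
    proof (cases "s \<in> {0..1}")
      case True
      have "T + T * s = T * (1 + s)" by (simp add: algebra_simps)
      moreover have "T * (1 + s) \<ge> 1" using T True mult_mono[of 1 T 1 "1 + s"] by simp
      ultimately have "zeta \<sigma> m (T + T * s) = T powr m * (1 + s) powr m"
        using T True by (simp add: zeta_def powr_mult)
      then show ?thesis unfolding s by (simp add: mult.assoc)
    next
      case False
      then have "g s ((norm x)\<^sup>2 / T) = 0" for x :: "real ^ 'n" using z[of "(norm x)\<^sup>2 / T" s] T by simp
      then show ?thesis unfolding s by simp
    qed
  qed
  finally show ?thesis using T by (simp add: powr_add mult_ac)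
qed

text \<open>At fixed \<open>x\<close> the second argument of \<open>g\<close> tends to 0, so the
  spatial profile flattens to its value on the axis and the limit factorizes. The majorant comes
  from the integrability of \<open>w\<close>.\<close>

lemma scaled_forcing_limit:
  fixes g :: "real \<Rightarrow> real \<Rightarrow> real" and w :: "real ^ 'n \<Rightarrow> real"
  assumes g: "continuous_on UNIV (\<lambda>z. g (fst z) (snd z))" and w: "integrable lborel w"
    and z: "\<And>t X. X \<ge> 0 \<Longrightarrow> t \<notin> {0..1} \<or> X > 1 \<Longrightarrow> g t X = 0"
    and T: "\<And>n. T n \<ge> 1" "filterlim T at_top sequentially" and m: "m \<le> 0"
  shows "(\<lambda>n. \<integral>s. (1 + s) powr m * (\<integral>x. w x * g s ((norm x)\<^sup>2 / T n) \<partial>lborel) \<partial>lborel)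
    \<longlonglongrightarrow> (\<integral>s. (1 + s) powr m * g s 0 \<partial>lborel) * (\<integral>x. w x \<partial>lborel)"
proof -
  have "bounded ((\<lambda>z. g (fst z) (snd z)) ` ({0..1} \<times> {0..1}))"
    by (intro compact_imp_bounded compact_continuous_image continuous_on_subset[OF g] compact_Times) auto
  then obtain G where G: "G > 0" "\<And>s X. s \<in> {0..1} \<Longrightarrow> X \<in> {0..1} \<Longrightarrow> \<bar>g s X\<bar> \<le> G"
    by (auto simp: bounded_pos)
  have G': "\<bar>g s X\<bar> \<le> G * indicator {0..1} s" if "X \<ge> 0" for s X
    using G z[OF that, of s] that by (cases "s \<in> {0..1} \<and> X \<le> 1") (auto simp: indicator_def)
  have cg: "continuous_on UNIV (\<lambda>z. g (a z) (b z))" if "continuous_on UNIV a" "continuous_on UNIV b"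
    for a b :: "'c::topological_space \<Rightarrow> real"
    using continuous_on_compose2[OF g, of UNIV "\<lambda>z. (a z, b z)"] that by (auto intro!: continuous_intros)
  have [measurable]: "w \<in> borel_measurable borel" using w by auto
  have [measurable]: "(\<lambda>s. g s 0) \<in> borel_measurable borel"
    by (intro borel_measurable_continuous_onI cg continuous_intros)
  have gm [measurable]: "(\<lambda>x :: real ^ 'n. g s ((norm x)\<^sup>2 / T n)) \<in> borel_measurable borel" for s n
    using T(1)[of n] by (intro borel_measurable_continuous_onI cg continuous_intros) auto
  define I where "I n s = (\<integral>x. w x * g s ((norm x)\<^sup>2 / T n) \<partial>lborel)" for n s
  have pos: "(norm x)\<^sup>2 / T n \<ge> 0" for x :: "real ^ 'n" and n using T(1)[of n] by simp
  have I_lim: "(\<lambda>n. I n s) \<longlonglongrightarrow> (\<integral>x. w x * g s 0 \<partial>lborel)" for s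
    unfolding I_def
  proof (rule integral_dominated_convergence[where w = "\<lambda>x. \<bar>w x\<bar> * G"])
    show "integrable lborel (\<lambda>x. \<bar>w x\<bar> * G)" using w by auto
    show "AE x in lborel. norm (w x * g s ((norm x)\<^sup>2 / T n)) \<le> \<bar>w x\<bar> * G" for n
    proof (rule AE_I2)
      fix x :: "real ^ 'n"
      have "\<bar>g s ((norm x)\<^sup>2 / T n)\<bar> \<le> G" using G'[OF pos, of s x n] G(1) by (cases "s \<in> {0..1}") auto
      then show "norm (w x * g s ((norm x)\<^sup>2 / T n)) \<le> \<bar>w x\<bar> * G" by (simp add: abs_mult mult_left_mono)
    qed
    show "AE x in lborel. (\<lambda>n. w x * g s ((norm x)\<^sup>2 / T n)) \<longlonglongrightarrow> w x * g s 0"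
    proof (rule AE_I2)
      fix x :: "real ^ 'n"
      have "(\<lambda>n. (norm x)\<^sup>2 / T n) \<longlonglongrightarrow> 0"
        by (intro real_tendsto_divide_at_top[OF tendsto_const T(2)])
      then have "(\<lambda>n. g s ((norm x)\<^sup>2 / T n)) \<longlonglongrightarrow> g s 0"
        using continuous_on_tendsto_compose[OF cg[of "\<lambda>_. s" "\<lambda>y. y"], of "\<lambda>n. (norm x)\<^sup>2 / T n" 0 sequentially]
        by (simp add: continuous_on_const continuous_on_id)
      then show "(\<lambda>n. w x * g s ((norm x)\<^sup>2 / T n)) \<longlonglongrightarrow> w x * g s 0" by (intro tendsto_intros)
    qed
  qed measurable
  have I_bd: "\<bar>I n s\<bar> \<le> G * indicator {0..1} s * (\<integral>x. \<bar>w x\<bar> \<partial>lborel)" for n s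
  proof -
    have b: "norm (w x * g s ((norm x)\<^sup>2 / T n)) \<le> \<bar>w x\<bar> * (G * indicator {0..1} s)" for x
      using G'[OF pos, of s x n] by (simp add: abs_mult mult_left_mono)
    have "norm (I n s) \<le> (\<integral>x. \<bar>w x\<bar> * (G * indicator {0..1} s) \<partial>lborel)"
      unfolding I_def
    proof (rule order_trans[OF integral_norm_bound integral_mono[OF _ _ b]])
      show i: "integrable lborel (\<lambda>x. \<bar>w x\<bar> * (G * indicator {0..1} s))" using w by auto
      show "integrable lborel (\<lambda>x. norm (w x * g s ((norm x)\<^sup>2 / T n)))"
        by (rule Bochner_Integration.integrable_bound[OF i])
           (auto intro!: AE_I2 order_trans[OF b[unfolded real_norm_def] abs_ge_self])
    qed
    then show ?thesis by (simp add: mult_ac)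
  qed
  have "(\<lambda>n. \<integral>s. (1 + s) powr m * I n s \<partial>lborel) \<longlonglongrightarrow> (\<integral>s. (1 + s) powr m * (\<integral>x. w x * g s 0 \<partial>lborel) \<partial>lborel)"
  proof (rule integral_dominated_convergence[where w = "\<lambda>s. indicator {0..1} s * (G * (\<integral>x. \<bar>w x\<bar> \<partial>lborel))"])
    show "integrable lborel (\<lambda>s :: real. indicator {0..1} s * (G * (\<integral>x. \<bar>w x\<bar> \<partial>lborel)))"
      by (intro integrable_mult_left integrable_real_indicator) (auto simp: emeasure_lborel_Icc_eq)
    show "(\<lambda>s. (1 + s) powr m * (\<integral>x. w x * g s 0 \<partial>lborel)) \<in> borel_measurable lborel"
      by simp
    show "(\<lambda>s. (1 + s) powr m * I n s) \<in> borel_measurable lborel" for n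
    proof -
      have [measurable]: "(\<lambda>z :: real \<times> (real ^ 'n). g (fst z) ((norm (snd z))\<^sup>2 / T n)) \<in> borel_measurable borel"
        using T(1)[of n] by (intro borel_measurable_continuous_onI cg continuous_intros) auto
      have [measurable]: "(\<lambda>z :: real \<times> (real ^ 'n). w (snd z)) \<in> borel_measurable borel"
        by (rule measurable_compose[OF borel_measurable_continuous_onI[OF continuous_on_snd[OF continuous_on_id]]]) simp
      have s: "sets (borel \<Otimes>\<^sub>M lborel) = sets (borel :: (real \<times> (real ^ 'n)) measure)"
        by (subst borel_prod[symmetric], rule sets_pair_measure_cong) simp_all
      have "(\<lambda>z :: real \<times> (real ^ 'n). w (snd z) * g (fst z) ((norm (snd z))\<^sup>2 / T n)) \<in> borel_measurable borel"
        by measurable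
      then have "(\<lambda>z :: real \<times> (real ^ 'n). w (snd z) * g (fst z) ((norm (snd z))\<^sup>2 / T n)) \<in> borel_measurable (borel \<Otimes>\<^sub>M lborel)"
        using measurable_cong_sets[OF s refl] by blast
      then have [measurable]: "I n \<in> borel_measurable borel"
        unfolding I_def[abs_def] by (intro lborel.borel_measurable_lebesgue_integral) (simp add: case_prod_unfold)
      show ?thesis by measurable
    qed
    show "AE s in lborel. (\<lambda>n. (1 + s) powr m * I n s) \<longlonglongrightarrow> (1 + s) powr m * (\<integral>x. w x * g s 0 \<partial>lborel)"
      by (intro AE_I2 tendsto_intros I_lim)
    show "AE s in lborel. norm ((1 + s) powr m * I n s) \<le> indicator {0..1} s * (G * (\<integral>x. \<bar>w x\<bar> \<partial>lborel))" for n
    proof (rule AE_I2)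
      fix s :: real
      show "norm ((1 + s) powr m * I n s) \<le> indicator {0..1} s * (G * (\<integral>x. \<bar>w x\<bar> \<partial>lborel))"
      proof (cases "s \<in> {0..1}")
        case True
        have "(1 + s) powr m \<le> 1" using powr_mono[of m 0 "1 + s"] m True by simp
        then have "(1 + s) powr m * \<bar>I n s\<bar> \<le> 1 * \<bar>I n s\<bar>" by (intro mult_right_mono) auto
        then show ?thesis using I_bd[of n s] True by (simp add: abs_mult)
      qed (use I_bd[of n s] in simp)
    qed
  qed
  then show ?thesis by (simp add: I_def mult_ac)
qed

text \<open>Young's inequality is applied pointwise with exponents \<open>p\<close> and
  \<open>p / (p - 1)\<close>. The first power reproduces the tested nonlinearity, which cancels in
  the weak form; the second is constant on the support, whose measure is of order T^(1 +
  N/2).\<close>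

lemma rescaled_weak_inequality:
  fixes \<alpha> \<sigma> m p T C :: real and w :: "real ^ 'n \<Rightarrow> real" and g gt gX gXX :: "real \<Rightarrow> real \<Rightarrow> real"
  assumes sol: "global_solution \<alpha> p (zeta \<sigma> m) w u0 u"
    and par: "\<sigma> > -1" "m \<le> 0" "p > 1" "w \<in> C0_space" "T > 0" and K: "K > 0" "\<alpha> / (2 * p) \<le> real K" and C: "C \<ge> 0"
    and d: "\<And>t X. ((\<lambda>t. g t X) has_real_derivative gt t X) (at t)"
      "\<And>t X. (g t has_real_derivative gX t X) (at X)"
      "\<And>t X. (gX t has_real_derivative gXX t X) (at X)"
    and c: "continuous_on UNIV (\<lambda>z. g (fst z) (snd z))" "continuous_on UNIV (\<lambda>z. gt (fst z) (snd z))"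
      "continuous_on UNIV (\<lambda>z. gX (fst z) (snd z))" "continuous_on UNIV (\<lambda>z. gXX (fst z) (snd z))"
    and z: "\<And>t X. X \<ge> 0 \<Longrightarrow> t \<notin> {0..1} \<or> X > 1 \<Longrightarrow> g t X = 0"
    and nonneg: "\<And>t X. X \<ge> 0 \<Longrightarrow> g t X \<ge> 0"
    and bound: "\<And>t X. X \<ge> 0 \<Longrightarrow>
      \<bar>gt t X + 2 * real CARD('n) * gX t X + 4 * X * gXX t X\<bar> \<le> C * X ^ K * g t X powr (1 / p)"
  shows "integrable lborel (\<lambda>(t, x). zeta \<sigma> m t * w x * g (t / T - 1) ((norm x)\<^sup>2 / T))"
    and "(\<integral>(t, x). zeta \<sigma> m t * w x * g (t / T - 1) ((norm x)\<^sup>2 / T) \<partial>lborel)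
      \<le> C powr (p / (p - 1)) * unit_ball_vol (real CARD('n))
          * T powr (1 + real CARD('n) / 2 - (2 * p + \<alpha>) / (2 * (p - 1)))"
proof -
  define S where "S = {T..2 * T} \<times> cball (0 :: real ^ 'n) (sqrt T)"
  define s where "s z = fst z / T - 1" for z :: "real \<times> (real ^ 'n)"
  define X where "X z = (norm (snd z))\<^sup>2 / T" for z :: "real \<times> (real ^ 'n)"
  have X0: "X z \<ge> 0" for z using par(5) by (simp add: X_def)
  interpret test_function S "\<lambda>z. g (s z) (X z)" "\<lambda>z. gt (s z) (X z) / T" "\<lambda>i z. gX (s z) (X z) * (2 * (snd z $ i) / T)"
    "\<lambda>i z. gXX (s z) (X z) * (2 * (snd z $ i) / T) * (2 * (snd z $ i) / T) + gX (s z) (X z) * (2 / T)"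
    unfolding S_def s_def X_def by (rule scaled_radial_test_function[OF par(5) d c z])
  have S: "fst z > 0" if "z \<in> S" for z using that par(5) by (auto simp: S_def mem_Times_iff)
  define N where "N z = nonlinearity \<alpha> p (u (fst z)) (snd z) * g (s z) (X z)" for z
  define F where "F z = zeta \<sigma> m (fst z) * w (snd z) * g (s z) (X z)" for z
  note wf = global_solution_weak_form[OF S par(1,2,4) sol]
  have iN: "integrable lborel N" and iu: "integrable lborel (\<lambda>z. u (fst z) (snd z) * heat_op z)"
    and wk: "(\<integral>z. N z \<partial>lborel) + (\<integral>z. F z \<partial>lborel) = - (\<integral>z. u (fst z) (snd z) * heat_op z \<partial>lborel)"
    using wf by (simp_all add: N_def[abs_def] F_def case_prod_unfold)
  have cw: "continuous_on UNIV w" using par(4) by (simp add: C0_space_def)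
  have iF: "integrable lborel F"
    using integrable_zeta_mult[OF S cw] by (simp add: F_def[abs_def] case_prod_unfold)
  then show "integrable lborel (\<lambda>(t, x). zeta \<sigma> m t * w x * g (t / T - 1) ((norm x)\<^sup>2 / T))"
    by (simp add: F_def[abs_def] case_prod_unfold s_def X_def)
  \<comment> \<open>\<open>X powr \<gamma>\<close> is
    \<open>norm x powr (\<alpha> / p) * T powr (- \<gamma>)\<close>. As \<open>0 < X \<le> 1\<close>
    on the support off the axis and \<open>K \<ge> \<gamma>\<close>, it dominates the factor
    \<open>X ^ K\<close> of the profile bound, whatever the sign of \<alpha>.\<close>
  define \<gamma> where "\<gamma> = \<alpha> / (2 * p)"
  define p' where "p' = p / (p - 1)"
  have p': "p' > 1" "1 / p + 1 / p' = 1" using par(3) by (auto simp: p'_def field_simps)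
  \<comment> \<open>One factor \<open>1 / T\<close> comes from the scaling of the heat operator,
    \<open>T powr (- \<gamma>)\<close> from the weight.\<close>
  define E where "E = C * T powr (- 1 - \<gamma>)"
  have E0: "E \<ge> 0" using C by (simp add: E_def)
  have pointwise: "\<bar>u (fst z) (snd z) * heat_op z\<bar> \<le> N z + E powr p' * indicator S z" for z
  proof (cases "z \<in> S \<and> snd z \<noteq> 0")
    case True
    then have zS: "z \<in> S" and xp: "norm (snd z) > 0" by auto
    have X1: "X z \<le> 1"
    proof -
      have "norm (snd z) \<le> sqrt T" using zS by (auto simp: S_def mem_Times_iff)
      then have "(norm (snd z))\<^sup>2 \<le> (sqrt T)\<^sup>2" by (intro power_mono) auto
      then show ?thesis using par(5) by (simp add: X_def)
    qed
    have Xp: "X z > 0" using xp par(5) by (simp add: X_def)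
    define G where "G = g (s z) (X z)"
    have G: "G \<ge> 0" using nonneg[OF X0] by (simp add: G_def)
    have ho: "heat_op z = (gt (s z) (X z) + 2 * real CARD('n) * gX (s z) (X z) + 4 * X z * gXX (s z) (X z)) / T"
      unfolding heat_op_def radial_laplacian by (simp add: X_def add_divide_distrib)
    have XK: "X z ^ K \<le> norm (snd z) powr (\<alpha> / p) * T powr (- \<gamma>)"
    proof -
      have "X z ^ K = X z powr real K" using Xp by (simp add: powr_realpow)
      also have "\<dots> \<le> X z powr \<gamma>" using Xp X1 K by (intro powr_mono') (auto simp: \<gamma>_def)
      also have "\<dots> = ((norm (snd z)) powr 2) powr \<gamma> * T powr (- \<gamma>)"
        using xp par(5) by (simp add: X_def powr_divide powr_minus_divide)
      also have "((norm (snd z)) powr 2) powr \<gamma> = norm (snd z) powr (\<alpha> / p)"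
        using par(3) by (simp only: powr_powr) (simp add: \<gamma>_def)
      finally show ?thesis .
    qed
    have hb: "\<bar>heat_op z\<bar> \<le> (norm (snd z) powr (\<alpha> / p) * G powr (1 / p)) * E"
    proof -
      have "\<bar>heat_op z\<bar> \<le> C * X z ^ K * G powr (1 / p) / T"
        unfolding ho G_def using bound[OF X0] par(5) by (simp add: divide_right_mono)
      also have "\<dots> \<le> C * (norm (snd z) powr (\<alpha> / p) * T powr (- \<gamma>)) * G powr (1 / p) / T"
        using C XK par(5) by (intro divide_right_mono mult_right_mono mult_left_mono) auto
      also have "\<dots> = (norm (snd z) powr (\<alpha> / p) * G powr (1 / p)) * E"
        using par(5) by (simp add: E_def powr_diff powr_minus_divide[of T 1] powr_minus_divide[of T \<gamma>] field_simps)
      finally show ?thesis .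
    qed
    define a where "a = norm (snd z) powr (\<alpha> / p) * \<bar>u (fst z) (snd z)\<bar> * G powr (1 / p)"
    have a0: "a \<ge> 0" by (simp add: a_def)
    have ap: "a powr p = N z"
      using par(3) G by (simp add: a_def N_def nonlinearity_def G_def powr_mult powr_powr)
    have "\<bar>u (fst z) (snd z) * heat_op z\<bar> \<le> \<bar>u (fst z) (snd z)\<bar> * ((norm (snd z) powr (\<alpha> / p) * G powr (1 / p)) * E)"
      unfolding abs_mult by (intro mult_left_mono hb) auto
    also have "\<dots> = a * E" by (simp add: a_def)
    also have "\<dots> \<le> a powr p / p + E powr p' / p'"
      using Youngs_inequality[OF par(3) p' a0 E0] .
    \<comment> \<open>The factor \<open>1 / p\<close> can be given up, since the nonlinearity stands
      with coefficient 1 on the other side.\<close>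
    also have "\<dots> \<le> a powr p + E powr p'"
      using par(3) p' by (intro add_mono) (auto simp: divide_le_eq mult_le_cancel_left1)
    finally show ?thesis using zS by (simp add: ap)
  next
    case False
    \<comment> \<open>On the axis \<open>norm x powr \<alpha>\<close> is 0 by the convention for
      \<open>powr\<close>, so the nonlinearity absorbs nothing there; but \<open>K > 0\<close> makes
      \<open>heat_op\<close> vanish.\<close>
    have "heat_op z = 0"
    proof (cases "z \<in> S")
      case True
      then have "X z = 0" using False by (simp add: X_def)
      moreover have "heat_op z = (gt (s z) (X z) + 2 * real CARD('n) * gX (s z) (X z) + 4 * X z * gXX (s z) (X z)) / T"
        unfolding heat_op_def radial_laplacian by (simp add: X_def add_divide_distrib)
      ultimately show ?thesis using bound[of 0 "s z"] K by (simp add: power_0_left)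
    qed (rule heat_op_zero)
    moreover have "N z \<ge> 0" using nonneg[OF X0] by (simp add: N_def nonlinearity_def)
    ultimately show ?thesis by (simp add: indicator_def)
  qed
  have S_meas: "emeasure lborel S = ennreal (T * (unit_ball_vol (real CARD('n)) * sqrt T ^ CARD('n)))"
    unfolding S_def lborel_prod[symmetric] using par(5)
    by (simp add: lborel.emeasure_pair_measure_Times emeasure_cball ennreal_mult)
  have S_sets: "S \<in> sets lborel" using borel_closed[OF closed_S] by simp
  have iS: "integrable lborel (\<lambda>z. indicator S z :: real)"
    using S_sets by (intro integrable_real_indicator) (simp_all add: S_meas)
  have "- (\<integral>z. u (fst z) (snd z) * heat_op z \<partial>lborel) \<le> (\<integral>z. \<bar>u (fst z) (snd z) * heat_op z\<bar> \<partial>lborel)"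
    by (rule order_trans[OF abs_ge_minus_self integral_abs_bound])
  also have "\<dots> \<le> (\<integral>z. N z + E powr p' * indicator S z \<partial>lborel)"
    using iu iN iS pointwise by (intro integral_mono) auto
  also have "\<dots> = (\<integral>z. N z \<partial>lborel) + E powr p' * measure lborel S"
    using iN iS S_sets by simp
  finally have "(\<integral>z. F z \<partial>lborel) \<le> E powr p' * measure lborel S"
    using wk by linarith
  also have "measure lborel S = T * (unit_ball_vol (real CARD('n)) * sqrt T ^ CARD('n))"
    using S_meas par(5) by (simp add: measure_def)
  also have "sqrt T ^ CARD('n) = T powr (real CARD('n) / 2)"
    using par(5) by (simp add: powr_half_sqrt[symmetric] powr_power)
  also have "E powr p' = C powr p' * T powr ((- 1 - \<gamma>) * p')"
    using C par(5) by (simp add: E_def powr_mult powr_powr)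
  also have "C powr p' * T powr ((- 1 - \<gamma>) * p') * (T * (unit_ball_vol (real CARD('n)) * T powr (real CARD('n) / 2)))
      = C powr p' * unit_ball_vol (real CARD('n)) * T powr ((- 1 - \<gamma>) * p' + 1 + real CARD('n) / 2)"
    using par(5) by (simp add: powr_add)
  also have "(- 1 - \<gamma>) * p' + 1 + real CARD('n) / 2 = 1 + real CARD('n) / 2 - (2 * p + \<alpha>) / (2 * (p - 1))"
    using par(3) by (simp add: \<gamma>_def p'_def field_simps)
  finally show "(\<integral>(t, x). zeta \<sigma> m t * w x * g (t / T - 1) ((norm x)\<^sup>2 / T) \<partial>lborel)
      \<le> C powr (p / (p - 1)) * unit_ball_vol (real CARD('n))
          * T powr (1 + real CARD('n) / 2 - (2 * p + \<alpha>) / (2 * (p - 1)))"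
    by (simp add: F_def case_prod_unfold s_def X_def p'_def)
qed

section \<open>Contradiction as \<open>T\<close> tends to infinity\<close>

theorem mainTheorem6:
  fixes \<alpha> \<sigma> m p :: real and w :: "real ^ 'n \<Rightarrow> real"
  assumes "CARD('n) \<in> {1, 2}"
    and "\<alpha> > -2" and "\<sigma> > -1" and "m < real CARD('n) / 2 - 1"
    and "1 < p" and "p < (real CARD('n) - 2 * m + \<alpha>) / (real CARD('n) - 2 * m - 2)"
    and "w \<in> C0_space" and "integrable lborel w" and "(\<integral>x. w x \<partial>lborel) > 0"
  shows "\<not> (\<exists>u0 u. global_solution \<alpha> p (zeta \<sigma> m) w u0 u)"
proof
  assume "\<exists>u0 u. global_solution \<alpha> p (zeta \<sigma> m) w u0 u"
  then obtain u0 u where sol: "global_solution \<alpha> p (zeta \<sigma> m) w u0 u" by blast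
  \<comment> \<open>The restriction \<open>N \<le> 2\<close> enters here, through
    \<open>m < N / 2 - 1 \<le> 0\<close>.\<close>
  have m0: "m \<le> 0" using assms(1,4) by auto
  \<comment> \<open>The order \<open>2 * (K0 + 1)\<close> is even for the profile, positive so that
    the backward operator vanishes on the axis, and at least \<open>\<alpha> / (2 * p)\<close> to
    absorb the weight.\<close>
  obtain K0 :: nat where "\<alpha> / (2 * p) \<le> real K0" using real_arch_simple by blast
  then have K: "even (2 * (K0 + 1))" "2 * (K0 + 1) > 0" "\<alpha> / (2 * p) \<le> real (2 * (K0 + 1))" by auto
  obtain g gt gX gXX :: "real \<Rightarrow> real \<Rightarrow> real" and C :: real where
    d: "\<And>t X. ((\<lambda>t. g t X) has_real_derivative gt t X) (at t)"
      "\<And>t X. (g t has_real_derivative gX t X) (at X)"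
      "\<And>t X. (gX t has_real_derivative gXX t X) (at X)"
    and c: "continuous_on UNIV (\<lambda>z. g (fst z) (snd z))" "continuous_on UNIV (\<lambda>z. gt (fst z) (snd z))"
      "continuous_on UNIV (\<lambda>z. gX (fst z) (snd z))" "continuous_on UNIV (\<lambda>z. gXX (fst z) (snd z))"
    and nonneg: "\<And>t X. X \<ge> 0 \<Longrightarrow> g t X \<ge> 0"
    and z: "\<And>t X. X \<ge> 0 \<Longrightarrow> t \<notin> {0..1} \<or> X > 1 \<Longrightarrow> g t X = 0"
    and pos: "\<And>t. 0 < t \<Longrightarrow> t < 1 \<Longrightarrow> g t 0 > 0" and C: "C \<ge> 0"
    and bound: "\<And>t X. X \<ge> 0 \<Longrightarrow>
      \<bar>gt t X + 2 * real CARD('n) * gX t X + 4 * X * gXX t X\<bar> \<le> C * X ^ (2 * (K0 + 1)) * g t X powr (1 / p)"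
  proof (rule bump_profile_exists[OF zero_less_card_finite[where 'a = 'n] K(1) assms(5)], goal_cases)
    case (1 g gt gX gXX C)
    show ?thesis by (rule 1(1)[OF 1(2-13)])
  qed
  \<comment> \<open>The forcing integral divided by \<open>T powr (m + 1)\<close>.\<close>
  define J where "J T = (\<integral>s. (1 + s) powr m * (\<integral>x. w x * g s ((norm x)\<^sup>2 / T) \<partial>lborel) \<partial>lborel)" for T
  define D where "D = C powr (p / (p - 1)) * unit_ball_vol (real CARD('n))"
  define \<theta> where "\<theta> = 1 + real CARD('n) / 2 - (2 * p + \<alpha>) / (2 * (p - 1))"
  have upper: "J T \<le> D * T powr (\<theta> - (m + 1))" if T: "T \<ge> 1" for T
  proof -
    have "T > 0" using T by simp
    note rw = rescaled_weak_inequality[OF sol assms(3) m0 assms(5,7) this K(2,3) C d c z nonneg bound]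
    have "T powr (m + 1) * J T \<le> D * T powr \<theta>"
      using rw(2) scaled_forcing_integral[OF T z rw(1)] by (simp add: J_def D_def \<theta>_def)
    then have "J T \<le> D * T powr \<theta> / T powr (m + 1)"
      using T by (simp add: le_divide_eq mult.commute)
    then show ?thesis by (simp add: powr_diff)
  qed
  have "\<theta> < m + 1"
  proof -
    have "real CARD('n) - 2 * m - 2 > 0" using assms(4) by simp
    then have "p * (real CARD('n) - 2 * m - 2) < real CARD('n) - 2 * m + \<alpha>"
      using assms(6) by (simp add: less_divide_eq)
    then have "(real CARD('n) / 2 - m) * (2 * (p - 1)) < 2 * p + \<alpha>"
      by (simp add: algebra_simps)
    then have "real CARD('n) / 2 - m < (2 * p + \<alpha>) / (2 * (p - 1))"
      using assms(5) by (subst pos_less_divide_eq) auto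
    then show ?thesis by (simp add: \<theta>_def)
  qed
  define T where "T n = real (Suc n)" for n
  have T: "T n \<ge> 1" "filterlim T at_top sequentially" for n
    unfolding T_def by simp (rule filterlim_compose[OF filterlim_real_sequentially filterlim_Suc])
  have "(\<lambda>n. J (T n)) \<longlonglongrightarrow> (\<integral>s. (1 + s) powr m * g s 0 \<partial>lborel) * (\<integral>x. w x \<partial>lborel)"
    unfolding J_def by (rule scaled_forcing_limit[OF c(1) assms(8) z T m0])
  moreover have "(\<lambda>n. D * T n powr (\<theta> - (m + 1))) \<longlonglongrightarrow> D * 0"
    using \<open>\<theta> < m + 1\<close> by (intro tendsto_intros tendsto_neg_powr T) auto
  ultimately have "(\<integral>s. (1 + s) powr m * g s 0 \<partial>lborel) * (\<integral>x. w x \<partial>lborel) \<le> D * 0"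
    using upper[OF T(1)] by (intro LIMSEQ_le) auto
  \<comment> \<open>This is impossible: the integrand is nonnegative and, \<open>g\<close> being
    positive on the axis for \<open>0 < s < 1\<close>, not zero almost everywhere.\<close>
  then have le0: "(\<integral>s. (1 + s) powr m * g s 0 \<partial>lborel) \<le> 0"
    using assms(9) by (simp add: mult_le_0_iff)
  let ?f = "\<lambda>s. (1 + s) powr m * g s 0"
  have cg: "continuous_on UNIV (\<lambda>s. g s 0)"
  proof -
    have "continuous_on UNIV (\<lambda>s :: real. (s, 0 :: real))" by (intro continuous_intros)
    from continuous_on_compose2[OF c(1) this] show ?thesis by simp
  qed
  have int: "integrable lborel ?f"
  proof (rule integrable_compact_support[of "{0..1}"])
    show "continuous_on {0..1} ?f"
      by (intro continuous_intros continuous_on_subset[OF cg]) auto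
  qed (use z[of 0] in auto)
  have nn: "?f s \<ge> 0" for s using nonneg[of 0 s] by simp
  have "(\<integral>s. ?f s \<partial>lborel) \<ge> 0" by (rule integral_nonneg_AE) (use nn in simp)
  then have "(\<integral>s. ?f s \<partial>lborel) = 0" using le0 by (rule order_antisym[rotated])
  then have "AE s in lborel. ?f s = 0"
    using integral_nonneg_eq_0_iff_AE[OF int] nn by simp
  then have "AE s in lborel. \<not> s \<in> {0<..<1 :: real}"
  proof eventually_elim
    case (elim s)
    then show ?case using pos[of s] by auto
  qed
  from emeasure_eq_0_AE[OF this] have "emeasure lborel {0<..<1 :: real} = 0"
    by (simp only: space_lborel space_borel UNIV_I simp_thms Collect_mem_eq)
  then show False by simp
qed

end
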